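(* For all $d\in\mathbb N$, $n\ge d+1$, and all $k\in\{0,\ldots,d-1\}$, $$ \mathbb E f_k(C_n\cap\mathbb S^d_+)=\frac{n!\,\pi^{k+1-n}}{(k+1)!}\sum_{\substack{s=0,1,\ldots\\ d-2s\ge k+1}}B\{n,d-2s\}\,(d-2s-1)^2\,A[d-2s-2,k-1]. $$
   Context: $U_1,\ldots,U_n$ are independent random points distributed uniformly on the half-sphere $\mathbb S^d_+=\{x=(x_0,\ldots,x_d)\in\mathbb R^{d+1}:x_0\ge0,\ \|x\|=1\}$, and $C_n=\operatorname{pos}(U_1,\ldots,U_n)=\{\sum_{i=1}^n\lambda_iU_i:\lambda_1,\ldots,\lambda_n\ge0\}$. $f_k(C_n\cap\mathbb S^d_+)$ is the number of $k$-dimensional faces of the spherical polytope $C_n\cap\mathbb S^d_+$, i.e. the number of $(k+1)$-dimensional faces of the cone $C_n$. Definition of $B\{n,k\}$ for $n\in\mathbb N$, $k\in\{1,\ldots,n\}$: $B\{n,k\}=\frac{1}{(k-1)!(n-k)!}\int_0^\pi(\sin x)^{k-1}x^{n-k}\,dx$. Definition of $A[n,k]$ for $n\in\mathbb N_0=\{0,1,2,\ldots\}$, $k\in\mathbb Z$: put $Q_0(x)=Q_1(x)=1$ and $Q_n(x)=\prod_{j\in\{1,\ldots,n-1\},\ j\not\equiv n\ (\mathrm{mod}\ 2)}(1+j^2x^2)$ for $n\ge2$. Then $A[n,k]=[x^k]Q_n(x)$ if $k$ is even; $A[n,k]=[x^k]\left(\tanh(\frac{\pi}{2x})Q_n(x)\right)$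 if $k$ is odd and $n$ is even; $A[n,k]=[x^k]\left(\coth(\frac{\pi}{2x})Q_n(x)\right)$ if $k$ is odd and $n$ is odd. Here $[x^k]H(x)$ is the coefficient of $x^k$ in $H(x)$, a formal series in positive and negative powers of $x$; $\tanh(\pi/(2x))$ and $\coth(\pi/(2x))$ are expanded in powers of $1/x$ via the Laurent expansions of $\tanh y$ and $\coth y$ at $y=0$ with $y=\pi/(2x)$. Convention: in the case $k=0$ the sum may involve the term $0^2A[-1,-1]$, which is by definition interpreted as $2/\pi$. *)

theory Defs
  imports "HOL-Probability.Probability" "HOL-Complex_Analysis.Complex_Analysis"
begin

subsection \<open>The uniform distribution on the half-sphere\<close>

text \<open>
  The Euclidean space of dimension $d+1$ is rendered as \<open>real \<times> (real ^ 'd)\<close> with \<open>d = CARD('d)\<close>;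
  the distinguished coordinate $x_0$ is \<open>fst x\<close>, and the norm of the product is the Euclidean one.
\<close>

definition half_sphere :: "(real \<times> (real ^ 'd)) set" where
  "half_sphere = {x. fst x \<ge> 0 \<and> norm x = 1}"

text \<open>
  Spherical Lebesgue measure (surface measure of the unit sphere): the measure of a Borel set
  \<open>A\<close> of unit vectors is the dimension of the space times the Lebesgue measure of
  $\{t u : 0 < t \le 1,\ u \in A\}$, see \<open>emeasure_spherical_measure\<close> below.
\<close>

definition spherical_measure :: "'e::euclidean_space measure" where
  "spherical_measure =
     distr (density lborel (\<lambda>x. of_nat DIM('e) * indicator (cball 0 1) x)) borel
       (\<lambda>x. x /\<^sub>R norm x)"

definition uniform_half_sphere :: "(real \<times> (real ^ 'd)) measure" where
  "uniform_half_sphere = uniform_measure spherical_measure half_sphere"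

lemma sets_spherical_measure [simp, measurable_cong]:
  "sets (spherical_measure :: 'e::euclidean_space measure) = sets borel"
  by (simp add: spherical_measure_def)

lemma emeasure_spherical_measure:
  fixes A :: "'e::euclidean_space set"
  assumes "A \<in> sets borel" and "A \<subseteq> sphere 0 1"
  shows "emeasure spherical_measure A =
           of_nat DIM('e) * emeasure lborel {t *\<^sub>R u |t u. 0 < t \<and> t \<le> 1 \<and> u \<in> A}"
proof -
  have m: "(\<lambda>x::'e. x /\<^sub>R norm x) \<in> borel_measurable borel" by measurable
  let ?S = "(\<lambda>x::'e. x /\<^sub>R norm x) -` A"
  have S: "?S \<in> sets borel" using measurable_sets[OF m assms(1)] by simp
  have eq: "{t *\<^sub>R u |t u. 0 < t \<and> t \<le> 1 \<and> u \<in> A} = cball 0 1 \<inter> ?S"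
  proof (intro equalityI subsetI)
    fix x assume "x \<in> {t *\<^sub>R u |t u. 0 < t \<and> t \<le> 1 \<and> u \<in> A}"
    then obtain t u where x: "x = t *\<^sub>R u" "0 < t" "t \<le> 1" "u \<in> A" by blast
    have "norm u = 1" using x(4) assms(2) by auto
    then show "x \<in> cball 0 1 \<inter> ?S" using x by simp
  next
    fix x assume x: "x \<in> cball 0 1 \<inter> ?S"
    have "x \<noteq> 0" using x assms(2) by auto
    then have "x = norm x *\<^sub>R (x /\<^sub>R norm x)" "0 < norm x" "norm x \<le> 1" using x by auto
    then show "x \<in> {t *\<^sub>R u |t u. 0 < t \<and> t \<le> 1 \<and> u \<in> A}" using x by blast
  qed
  have "emeasure spherical_measure A =
      (\<integral>\<^sup>+x. of_nat DIM('e) * indicator (cball 0 1) x * indicator ?S x \<partial>lborel)"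
    unfolding spherical_measure_def
    by (subst emeasure_distr, simp add: m, rule assms(1), subst emeasure_density)
      (use S in \<open>auto intro!: borel_measurable_times_ennreal borel_measurable_indicator\<close>)
  also have "\<dots> = (\<integral>\<^sup>+x. of_nat DIM('e) * indicator (cball 0 1 \<inter> ?S) x \<partial>lborel)"
    by (intro nn_integral_cong) (auto simp: indicator_def)
  also have "\<dots> = of_nat DIM('e) * emeasure lborel (cball 0 1 \<inter> ?S)"
    using S by (subst nn_integral_cmult_indicator) auto
  finally show ?thesis by (simp add: eq)
qed


subsection \<open>Cones and faces\<close>

definition pos :: "nat set \<Rightarrow> (nat \<Rightarrow> 'e::real_vector) \<Rightarrow> 'e set" where
  "pos I u = {\<Sum>i\<in>I. l i *\<^sub>R u i |l. \<forall>i\<in>I. 0 \<le> l i}"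

text \<open>
  The number of \<open>k\<close>-dimensional faces of the spherical polytope cut out by the cone \<open>C\<close>, that is,
  the number of \<open>(k + 1)\<close>-dimensional faces of \<open>C\<close>.
\<close>

definition spherical_face_number :: "nat \<Rightarrow> 'e::euclidean_space set \<Rightarrow> nat" where
  "spherical_face_number k C = card {F. F face_of C \<and> aff_dim F = int (k + 1)}"


subsection \<open>The numbers $B\{n,k\}$ and $A[n,k]$\<close>

definition B_num :: "nat \<Rightarrow> nat \<Rightarrow> real" where
  "B_num n k =
     1 / (fact (k - 1) * fact (n - k)) * integral {0..pi} (\<lambda>x. sin x ^ (k - 1) * x ^ (n - k))"

definition Q_poly :: "nat \<Rightarrow> 'a::comm_semiring_1 \<Rightarrow> 'a" where
  "Q_poly n x = (\<Prod>j | j \<in> {1..<n} \<and> j mod 2 \<noteq> n mod 2. 1 + of_nat (j ^ 2) * x ^ 2)"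

definition fls_tanh :: "'a::field_char_0 \<Rightarrow> 'a fls" where
  "fls_tanh c = fps_to_fls (fps_exp c - fps_exp (- c)) / fps_to_fls (fps_exp c + fps_exp (- c))"

definition fls_coth :: "'a::field_char_0 \<Rightarrow> 'a fls" where
  "fls_coth c = fps_to_fls (fps_exp c + fps_exp (- c)) / fps_to_fls (fps_exp c - fps_exp (- c))"

lemma has_laurent_expansion_tanh:
  "(\<lambda>z::complex. tanh (c * z)) has_laurent_expansion fls_tanh c"
proof -
  have "(\<lambda>z. (exp (c * z) - exp (- c * z)) / (exp (c * z) + exp (- c * z)))
      has_laurent_expansion fls_tanh c"
    unfolding fls_tanh_def
    by (intro laurent_expansion_intros has_laurent_expansion_fps fps_expansion_intros)
  then show ?thesis by (simp add: tanh_altdef)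
qed

lemma has_laurent_expansion_coth:
  "(\<lambda>z::complex. cosh (c * z) / sinh (c * z)) has_laurent_expansion fls_coth c"
proof -
  have "(\<lambda>z. (exp (c * z) + exp (- c * z)) / (exp (c * z) - exp (- c * z)))
      has_laurent_expansion fls_coth c"
    unfolding fls_coth_def
    by (intro laurent_expansion_intros has_laurent_expansion_fps fps_expansion_intros)
  moreover have "cosh w / sinh w = (exp w + exp (- w)) / (exp w - exp (- w))" for w :: complex
  proof -
    have "(a / 2) / (b / 2) = a / b" for a b :: complex by (cases "b = 0") (auto simp: divide_simps)
    then show ?thesis by (simp only: cosh_field_def sinh_field_def)
  qed
  ultimately show ?thesis by simp
qed

text \<open>
  The series in question contain finitely many positive and possibly infinitely many negative
  powers of $x$. They are represented as formal Laurent series in $z = 1/x$: the indeterminate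
  $x$ is \<open>fls_X_inv\<close>, the series $\tanh(\pi/(2x))$ is \<open>fls_tanh (pi / 2)\<close>, and the coefficient
  of $x^k$ is the coefficient of index \<open>- k\<close>.
\<close>

definition coeff_x :: "int \<Rightarrow> 'a::zero fls \<Rightarrow> 'a" where
  "coeff_x k H = fls_nth H (- k)"

definition A_num :: "nat \<Rightarrow> int \<Rightarrow> real" where
  "A_num n k =
     (if even k then coeff_x k (Q_poly n fls_X_inv)
      else if even n then coeff_x k (fls_tanh (pi / 2) * Q_poly n fls_X_inv)
      else coeff_x k (fls_coth (pi / 2) * Q_poly n fls_X_inv))"

text \<open>
  The factor $(m-1)^2 A[m-2,k-1]$ for $m \ge k+1 \ge 1$. The case \<open>m = 1\<close> forces \<open>k = 0\<close> and is
  the term $0^2 A[-1,-1]$, which is by convention $2/\pi$.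
\<close>

definition A_factor :: "nat \<Rightarrow> nat \<Rightarrow> real" where
  "A_factor m k =
     (if m = 1 then 2 / pi else (real m - 1) ^ 2 * A_num (m - 2) (int k - 1))"

end

theory Submission
  imports Defs
begin

text \<open>
  The points $U_i$ may be replaced by rows $x_i=(a_i,v_i)$ with $a_i$ half-normal and $v_i$ standard
  Gaussian, as normalising the generators of a cone changes none of its faces. Almost surely the
  $(k+1)$-dimensional faces correspond to the sets $R$ of $k+1$ indices for which some $y$ is
  orthogonal to $x_i$ for $i\in R$ and has $x_i\cdot y>0$ for $i\notin R$. Let $p_m$ be the
  probability that such a $y$ exists in a fixed $(m+1)$-dimensional coordinate subspace $S_m$
  containing the distinguished direction. Projected along $S_{m-2}$ to a plane, the cone of all
  these $y\in S_m$ is a wedge exactly when the event happens in $S_m$ but not in $S_{m-2}$, so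
  $p_m-p_{m-2}$ can be computed from the boundary rays of the wedge. Such a ray exposes a set
  $G\supseteq R$ with $|G|=m$, and the requirement on $G$ involves only the rows in $G$ and
  $S_{m-2}$. By rotation invariance its probability is a constant times
  $\int_0^\pi(\sin x)^{m-1}x^{n-m}\,dx$, and the constant is read off from the case of $m$ rows,
  where it is $1-p_{m-2}$ up to normalisation. This recursion determines the $p_m$. The partial sums
  of $B\{n,m\}\,(m-1)^2A[m-2,k-1]$ satisfy the same one, because the complete sum is constant for $n=m$:
  this is a telescoping consequence of the recurrence of $B\{n,k\}$ under partial integration
  and of $Q_{m}(x)=(1+(m-1)^2x^2)\,Q_{m-2}(x)$.
\<close>

subsection \<open>Reciprocity between the numbers $B\{n,k\}$ and $A[n,k]$\<close>

text \<open>Two dimensions are dropped at a time because the projected cone then lives in a plane,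
  where a wedge has exactly two boundary rays; averaging over both removes the orientation from the
  count. The obstacle is that exposure of R involves all n rows at once. A boundary ray decouples
  them: once the rows in G fix the line of the exposing vector y = (y_0, y'), every other row only
  has to lie on the right side of y, which has probability 1/2 + arctan(q)/pi with q = y_0/|y'|. The
  condition on G does not change when all v_i are replaced by v_i + a_i t or all a_i by a common
  positive multiple. The shear resamples q and the scaling absorbs its density, so the probability
  splits into a factor depending on G alone and an integral over q, which q = -cot x turns into a
  moment of sin. The factor can be read off at n = m because m generic rows are always exposed in
  S_m, so nothing is random there but p_{m-2}. If G is the full index set, both y and -y count; this
  doubling is matched by the exceptional value 2 = pi^0/0! + 1 in the reciprocity.\<close>

definition sin_moment :: "nat \<Rightarrow> nat \<Rightarrow> real" where
  "sin_moment p q = integral {0..pi} (\<lambda>x. sin x ^ p * x ^ q)"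

lemma sin_moment_has_integral:
  "((\<lambda>x. sin x ^ p * x ^ q) has_integral sin_moment p q) {0..pi}"
  unfolding sin_moment_def
  by (intro integrable_integral integrable_continuous_interval continuous_intros)

lemma sin_moment_0: "sin_moment 0 q = pi ^ Suc q / Suc q"
proof -
  have "((\<lambda>x. x ^ q) has_integral (pi ^ Suc q / Suc q - 0 ^ Suc q / Suc q)) {0..pi}"
    by (rule fundamental_theorem_of_calculus)
       (auto simp flip: has_real_derivative_iff_has_vector_derivative
             intro!: derivative_eq_intros simp del: power_Suc)
  with sin_moment_has_integral[of 0 q] show ?thesis
    by (auto dest: has_integral_unique)
qed

text \<open>Two partial integrations, packed into the antiderivative \<open>G\<close>. The boundary
  values are \<open>pi ^ q\<close> at the upper end and \<open>0 ^ q\<close> at the lower one,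
  whence the extra 1 for \<open>q = 0\<close>. The truncated \<open>q - 2\<close> is harmless
  because its factor q (q - 1) vanishes for q < 2.\<close>

lemma sin_moment_1:
  "sin_moment 1 q = pi ^ q + (if q = 0 then 1 else 0) - real q * (real q - 1) * sin_moment 1 (q - 2)"
proof -
  define G where "G = (\<lambda>x::real. x ^ q * cos x - real q * x ^ (q - 1) * sin x)"
  have "((\<lambda>x. - (sin x ^ 1 * x ^ q) - real q * (real q - 1) * (sin x ^ 1 * x ^ (q - 2)))
      has_integral (G pi - G 0)) {0..pi}"
  proof (rule fundamental_theorem_of_calculus)
    fix x :: real
    have q: "real (q - Suc 0) = real q - 1 \<or> q = 0" by (cases q) auto
    have "(G has_real_derivative
        - (sin x ^ 1 * x ^ q) - real q * (real q - 1) * (sin x ^ 1 * x ^ (q - 2))) (at x)"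
      unfolding G_def
      by (rule derivative_eq_intros refl | simp)+
         (use q in \<open>auto simp: algebra_simps numeral_2_eq_2\<close>)
    then show "(G has_vector_derivative
        - (sin x ^ 1 * x ^ q) - real q * (real q - 1) * (sin x ^ 1 * x ^ (q - 2))) (at x within {0..pi})"
      by (simp add: has_real_derivative_iff_has_vector_derivative has_vector_derivative_at_within)
  qed simp
  moreover have "((\<lambda>x. - (sin x ^ 1 * x ^ q) - real q * (real q - 1) * (sin x ^ 1 * x ^ (q - 2)))
      has_integral (- sin_moment 1 q - real q * (real q - 1) * sin_moment 1 (q - 2))) {0..pi}"
    by (intro has_integral_diff has_integral_neg has_integral_mult_right sin_moment_has_integral)
  ultimately have "- sin_moment 1 q - real q * (real q - 1) * sin_moment 1 (q - 2) = G pi - G 0"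
    by (rule has_integral_unique[rotated])
  then show ?thesis by (cases "q = 0") (auto simp: G_def power_0_left)
qed

text \<open>The function \<open>G\<close> is chosen such that the terms with
  \<open>x ^ (q - 1)\<close> cancel in its derivative and only the three moments remain. Both of its
  summands contain a positive power of sin, so it vanishes at both ends.\<close>

lemma sin_moment_Suc_Suc:
  "(real p + 2) ^ 2 * sin_moment (Suc (Suc p)) q =
     (real p + 2) * (real p + 1) * sin_moment p q - real q * (real q - 1) * sin_moment (Suc (Suc p)) (q - 2)"
proof -
  define G where "G = (\<lambda>x::real. (real p + 2) * (x ^ q * (sin x ^ Suc p * cos x))
      - real q * x ^ (q - 1) * sin x ^ Suc (Suc p))"
  define g where "g = (\<lambda>x::real. (real p + 2) * (real p + 1) * (sin x ^ p * x ^ q)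
      - (real p + 2) ^ 2 * (sin x ^ Suc (Suc p) * x ^ q)
      - real q * (real q - 1) * (sin x ^ Suc (Suc p) * x ^ (q - 2)))"
  have "(g has_integral (G pi - G 0)) {0..pi}"
  proof (rule fundamental_theorem_of_calculus)
    fix x :: real
    have q: "real (q - Suc 0) * real q = real q * (real q - 1)" by (cases q) auto
    have cs: "cos x * cos x = 1 - sin x * sin x"
      using sin_cos_squared_add[of x] by (simp add: power2_eq_square)
    have "(G has_real_derivative
        (real p + 2) * (real q * x ^ (q - 1) * (sin x ^ Suc p * cos x)
          + x ^ q * ((real p + 1) * (sin x ^ p * (cos x * cos x)) - sin x ^ Suc p * sin x))
        - (real (q - 1) * real q * x ^ (q - 2) * sin x ^ Suc (Suc p)
           + real q * x ^ (q - 1) * ((real p + 2) * (sin x ^ Suc p * cos x)))) (at x)"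
    proof -
      have 1: "((\<lambda>x. x ^ q) has_real_derivative real q * x ^ (q - 1)) (at x)"
        and 2: "((\<lambda>x. real q * x ^ (q - 1)) has_real_derivative real (q - 1) * real q * x ^ (q - 2)) (at x)"
        and 3: "((\<lambda>x. sin x ^ Suc p) has_real_derivative (real p + 1) * sin x ^ p * cos x) (at x)"
        and 4: "((\<lambda>x. sin x ^ Suc (Suc p)) has_real_derivative (real p + 2) * sin x ^ Suc p * cos x) (at x)"
        and 5: "(cos has_real_derivative - sin x) (at x)"
        by (auto intro!: derivative_eq_intros simp: algebra_simps numeral_2_eq_2 simp del: power_Suc)
      show ?thesis unfolding G_def
        by (rule DERIV_cong[OF DERIV_diff[OF DERIV_cmult[OF DERIV_mult[OF 1 DERIV_mult[OF 3 5]]] DERIV_mult[OF 2 4]]])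
          (simp only: power_Suc2, algebra)
    qed
    moreover have "(real p + 2) * (real q * x ^ (q - 1) * (sin x ^ Suc p * cos x)
          + x ^ q * ((real p + 1) * (sin x ^ p * (cos x * cos x)) - sin x ^ Suc p * sin x))
        - (real (q - 1) * real q * x ^ (q - 2) * sin x ^ Suc (Suc p)
           + real q * x ^ (q - 1) * ((real p + 2) * (sin x ^ Suc p * cos x))) = g x"
    proof -
      have "(P + 2) * (Q * X1 * (S * s * c) + X * ((P + 1) * (S * (1 - s * s)) - S * s * s))
          - (Q * (Q - 1) * X2 * (S * s * s) + Q * X1 * ((P + 2) * (S * s * c)))
        = (P + 2) * (P + 1) * (S * X) - (P + 2) ^ 2 * (S * s * s * X) - Q * (Q - 1) * (S * s * s * X2)"
        for P Q X X1 X2 S s c :: real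
        by algebra
      from this[of "real p" "real q" "x ^ (q - 1)" "sin x ^ p" "sin x" "cos x" "x ^ q" "x ^ (q - 2)"]
      show ?thesis unfolding g_def cs q[unfolded One_nat_def[symmetric]]
        by (simp only: power_Suc2)
    qed
    ultimately show "(G has_vector_derivative g x) (at x within {0..pi})"
      by (simp add: has_real_derivative_iff_has_vector_derivative has_vector_derivative_at_within)
  qed simp
  moreover have "(g has_integral ((real p + 2) * (real p + 1) * sin_moment p q
      - (real p + 2) ^ 2 * sin_moment (Suc (Suc p)) q
      - real q * (real q - 1) * sin_moment (Suc (Suc p)) (q - 2))) {0..pi}"
    unfolding g_def
    by (intro has_integral_diff has_integral_mult_right sin_moment_has_integral)
  ultimately have "(real p + 2) * (real p + 1) * sin_moment p q
      - (real p + 2) ^ 2 * sin_moment (Suc (Suc p)) q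
      - real q * (real q - 1) * sin_moment (Suc (Suc p)) (q - 2) = G pi - G 0"
    by (rule has_integral_unique[rotated])
  then show ?thesis by (simp add: G_def)
qed

text \<open>The extension of $B\{n,n-2s\}$ to $n=2s$ under which \<open>B_ext_recurrence\<close> holds without exception.\<close>

definition B_ext :: "nat \<Rightarrow> nat \<Rightarrow> real" where
  "B_ext n s = (if 2 * s < n then B_num n (n - 2 * s)
     else pi ^ n / fact n + (if n = 0 then 1 else 0))"

lemma B_num_eq_sin_moment:
  "m \<ge> 1 \<Longrightarrow> m \<le> n \<Longrightarrow> B_num n m = sin_moment (m - 1) (n - m) / (fact (m - 1) * fact (n - m))"
  by (simp add: B_num_def sin_moment_def)

lemma B_ext_last: "n \<ge> 1 \<Longrightarrow> n \<le> 2 * s + 1 \<Longrightarrow> 2 * s \<le> n \<Longrightarrow>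
    B_ext n s = pi ^ n / fact n"
proof -
  assume n: "n \<ge> 1" "n \<le> 2 * s + 1" "2 * s \<le> n"
  show ?thesis
  proof (cases "2 * s = n")
    case True
    then show ?thesis using n by (simp add: B_ext_def)
  next
    case False
    then have "n = 2 * s + 1" using n by simp
    then show ?thesis
      by (simp add: B_ext_def B_num_eq_sin_moment sin_moment_0 del: of_nat_Suc)
  qed
qed

text \<open>This is the recurrence of the moments divided by the factorials of \<open>B_num\<close>.
  For \<open>n = 2 * s + 2\<close> the power of sin is 1, and the boundary term of
  \<open>sin_moment_1\<close> is what \<open>B_ext\<close> was set to at the end of its
  range.\<close>

lemma B_ext_recurrence:
  assumes "2 * s + 2 \<le> n"
  shows "(real n - 2 * real s - 1) ^ 2 * B_ext n s =
    B_ext (n - 2) s - (if s = 0 then 0 else B_ext (n - 2) (s - 1))"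
proof -
  have f2: "real q * (real q - 1) * x / fact q = x / fact (q - 2)" if q: "q \<ge> 2" for q and x :: real
  proof -
    obtain j where "q = 2 + j" using le_Suc_ex[OF q] by blast
    then have "fact q = (real q * (real q - 1)) * fact (q - 2)" "real q * (real q - 1) \<noteq> 0"
      by simp_all
    then show ?thesis by (simp only: mult_divide_mult_cancel_left_if if_False)
  qed
  have second: "real (2 * s) * (real (2 * s) - 1) * sin_moment (n - 2 * s - 1) (2 * s - 2)
      / (fact (n - 2 * s - 1) * fact (2 * s))
      = (if s = 0 then 0 else B_ext (n - 2) (s - 1))"
  proof (cases s)
    case (Suc t)
    have "B_ext (n - 2) t = sin_moment (n - 2 * s - 1) (2 * s - 2) / (fact (n - 2 * s - 1) * fact (2 * s - 2))"
      using le_Suc_ex[OF assms] Suc by (auto simp: B_ext_def B_num_eq_sin_moment)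
    then show ?thesis using f2[of "2 * s" "sin_moment (n - 2 * s - 1) (2 * s - 2) / fact (n - 2 * s - 1)"] Suc
      by (simp add: mult_ac)
  qed simp
  have B: "B_ext n s = sin_moment (n - 2 * s - 1) (2 * s) / (fact (n - 2 * s - 1) * fact (2 * s))"
    using assms by (simp add: B_ext_def B_num_eq_sin_moment)
  show ?thesis
  proof (cases "n = 2 * s + 2")
    case True
    have "B_ext (n - 2) s = (pi ^ (2 * s) + (if 2 * s = 0 then 1 else 0)) / fact (2 * s)"
      using True by (simp add: B_ext_def add_divide_distrib)
    moreover have "(real n - 2 * real s - 1) ^ 2 * B_ext n s = sin_moment 1 (2 * s) / fact (2 * s)"
      using B True by simp
    moreover have "\<dots> = (pi ^ (2 * s) + (if 2 * s = 0 then 1 else 0)) / fact (2 * s)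
        - real (2 * s) * (real (2 * s) - 1) * sin_moment 1 (2 * s - 2) / fact (2 * s)"
      by (subst sin_moment_1) (simp add: diff_divide_distrib)
    ultimately show ?thesis using second True by simp
  next
    case False
    then obtain p where p: "n - 2 * s - 1 = Suc (Suc p)" and n: "n = p + 3 + 2 * s"
      using assms that[of "n - 2 * s - 3"] by simp
    have "B_ext (n - 2) s = sin_moment p (2 * s) / (fact p * fact (2 * s))"
      using n by (simp add: B_ext_def B_num_eq_sin_moment)
    also have "\<dots> = (real p + 2) * (real p + 1) * sin_moment p (2 * s) / (fact (Suc (Suc p)) * fact (2 * s))"
      by (simp add: divide_simps add.commute)
    finally have C: "B_ext (n - 2) s = (real p + 2) * (real p + 1) * sin_moment p (2 * s) / (fact (Suc (Suc p)) * fact (2 * s))" .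
    have "real n - 2 * real s - 1 = real p + 2" using n by simp
    then have "(real n - 2 * real s - 1) ^ 2 * B_ext n s =
        ((real p + 2) ^ 2 * sin_moment (Suc (Suc p)) (2 * s)) / (fact (Suc (Suc p)) * fact (2 * s))"
      using B p by simp
    then show ?thesis
      unfolding sin_moment_Suc_Suc diff_divide_distrib second[symmetric] C p by simp
  qed
qed

section \<open>Recurrence and Laurent kernels of the numbers A[n,k]\<close>

lemma Q_poly_0: "Q_poly 0 x = 1" and Q_poly_1: "Q_poly (Suc 0) x = 1"
  by (simp_all add: Q_poly_def)

lemma Q_poly_Suc_Suc: "Q_poly (Suc (Suc n)) x = Q_poly n x * (1 + of_nat (Suc n ^ 2) * x ^ 2)"
proof -
  have "{j. j \<in> {1..<Suc (Suc n)} \<and> j mod 2 \<noteq> Suc (Suc n) mod 2} =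
      insert (Suc n) {j. j \<in> {1..<n} \<and> j mod 2 \<noteq> n mod 2}"
    by (auto simp: less_Suc_eq; presburger)
  then show ?thesis
    unfolding Q_poly_def by (simp only: ) (subst prod.insert, auto simp: mult.commute)
qed

text \<open>The three cases of \<open>A_num\<close> differ only in this factor. It depends on the
  parities of n and k alone, so steps by 2 in either argument leave it unchanged.\<close>

definition A_kernel :: "nat \<Rightarrow> int \<Rightarrow> real fls" where
  "A_kernel n k = (if even k then 1 else if even n then fls_tanh (pi / 2) else fls_coth (pi / 2))"

lemma A_num_altdef: "A_num n k = fls_nth (A_kernel n k * Q_poly n fls_X_inv) (- k)"
  by (simp add: A_num_def A_kernel_def coeff_x_def)

text \<open>Raising n by 2 multiplies \<open>Q_poly\<close> by 1 + (n + 1)^2 x^2, and the factor x^2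
  shifts the index k by 2 under the same kernel.\<close>

lemma A_num_Suc_Suc: "A_num (Suc (Suc n)) k = A_num n k + real (Suc n) ^ 2 * A_num n (k - 2)"
proof -
  have "A_kernel (Suc (Suc n)) k * Q_poly (Suc (Suc n)) fls_X_inv =
      A_kernel n k * Q_poly n fls_X_inv
      + fls_const (real (Suc n ^ 2)) * (A_kernel n (k - 2) * Q_poly n fls_X_inv * fls_X_inv ^ 2)"
    by (simp add: Q_poly_Suc_Suc A_kernel_def algebra_simps fls_of_nat)
  then show ?thesis
    unfolding A_num_altdef
    by (simp add: fls_X_inv_power_times_conv_shift  del: of_nat_Suc)
qed

lemma A_num_0: "A_num 0 k = fls_nth (A_kernel 0 k) (- k)"
  and A_num_1: "A_num (Suc 0) k = fls_nth (A_kernel 1 k) (- k)"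
  by (simp_all add: A_num_altdef Q_poly_0 Q_poly_1 A_kernel_def)

lemma fps_exp_minus_subdegree:
  fixes c :: "'a::field_char_0"
  assumes "c \<noteq> 0"
  shows "subdegree (fps_exp c - fps_exp (- c)) = 1"
  using assms by (intro subdegreeI) auto

lemma fps_exp_plus_subdegree:
  fixes c :: "'a::field_char_0"
  shows "subdegree (fps_exp c + fps_exp (- c)) = 0"
  by (intro subdegreeI) auto

lemma fls_subdegree_tanh: "c \<noteq> 0 \<Longrightarrow> fls_subdegree (fls_tanh c :: real fls) = 1"
proof -
  assume "c \<noteq> 0"
  then have "fps_exp c - fps_exp (- c) \<noteq> 0"
    by (metis fps_exp_minus_subdegree subdegree_0 zero_neq_one)
  moreover have "fps_exp c + fps_exp (- c) \<noteq> 0"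
    by (auto simp: fps_eq_iff intro!: exI[of _ 0])
  ultimately show ?thesis
    using \<open>c \<noteq> 0\<close> unfolding fls_tanh_def
    by (subst fls_divide_subdegree)
      (simp_all only: fps_to_fls_eq_0_iff fls_subdegree_fls_to_fps fps_exp_minus_subdegree
        fps_exp_plus_subdegree not_False_eq_True of_nat_0 of_nat_1 diff_0_right diff_0)
qed

lemma fls_subdegree_coth: "c \<noteq> 0 \<Longrightarrow> fls_subdegree (fls_coth c :: real fls) = - 1"
proof -
  assume "c \<noteq> 0"
  then have "fps_exp c - fps_exp (- c) \<noteq> 0"
    by (metis fps_exp_minus_subdegree subdegree_0 zero_neq_one)
  moreover have "fps_exp c + fps_exp (- c) \<noteq> 0"
    by (auto simp: fps_eq_iff intro!: exI[of _ 0])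
  ultimately show ?thesis
    using \<open>c \<noteq> 0\<close> unfolding fls_coth_def
    by (subst fls_divide_subdegree)
      (simp_all only: fps_to_fls_eq_0_iff fls_subdegree_fls_to_fps fps_exp_minus_subdegree
        fps_exp_plus_subdegree not_False_eq_True of_nat_0 of_nat_1 diff_0_right diff_0)
qed

text \<open>A Cauchy product in which the second factor may have a simple pole, as coth has; hence
  one summand more than for two power series. A shift by one index reduces it to that case.\<close>

lemma fls_nth_times_fps_left:
  fixes g :: "'a::comm_ring_1 fls"
  assumes "fls_subdegree g \<ge> - 1 \<or> g = 0"
  shows "fls_nth (fps_to_fls f * g) (int N) = (\<Sum>i\<le>Suc N. fps_nth f i * fls_nth g (int N - int i))"
proof -
  have g: "g = fps_to_fls (fls_regpart (fls_shift (- 1) g)) * fls_X_inv"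
  proof (rule fls_eqI)
    fix k
    show "fls_nth g k = fls_nth (fps_to_fls (fls_regpart (fls_shift (- 1) g)) * fls_X_inv) k"
      using assms by (auto simp: fls_X_inv_times_conv_shift fls_eq0_below_subdegree)
  qed
  define h where "h = fls_regpart (fls_shift (- 1) g)"
  have [simp]: "nat (1 + int N) = Suc N" by simp
  have "fls_nth (fps_to_fls f * g) (int N) = fls_nth (fps_to_fls (f * h)) (int (Suc N))"
    by (subst g) (simp add: fls_X_inv_times_conv_shift fls_times_fps_to_fls h_def fls_shifted_times_simps add.commute flip: mult.assoc of_nat_Suc)
  also have "\<dots> = (\<Sum>i\<le>Suc N. fps_nth f i * fps_nth h (Suc N - i))"
    by (simp add: fps_mult_nth atLeast0AtMost)
  also have "\<dots> = (\<Sum>i\<le>Suc N. fps_nth f i * fls_nth g (int N - int i))"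
    by (intro sum.cong) (auto simp: h_def of_nat_diff)
  finally show ?thesis .
qed

text \<open>The coefficients of exp(pi x) + 1. They are the values of \<open>B_ext\<close> at the
  end of its range and also the values of the complete sums in \<open>A_num_sum_eq\<close>.\<close>

definition boundary_coeff :: "nat \<Rightarrow> real" where
  "boundary_coeff n = pi ^ n / fact n + (if n = 0 then 1 else 0)"

text \<open>Unlike the sum in the theorem, it leaves out the term with A[-1,-1] and imposes no bound
  by k, so that it can be summed by parts. The difference is accounted for by
  \<open>A_num_eq_0\<close> and by the convention 2/pi.\<close>

definition BA_sum :: "nat \<Rightarrow> int \<Rightarrow> real" where
  "BA_sum n k = (\<Sum>s | 2 * s + 2 \<le> n.
     B_num n (n - 2 * s) * ((real n - 2 * real s - 1) ^ 2 * A_num (n - 2 * s - 2) (k - 1)))"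

lemma finite_double_le [simp]: "finite {s::nat. 2 * s + a \<le> n}" "finite {s::nat. 2 * s \<le> n}"
   by (rule finite_subset[of _ "{..n}"]; auto)+

text \<open>Summation by parts. The recurrence of \<open>B_ext\<close> turns the products with the
  squares into differences of \<open>B_ext\<close> in s; moved to the other factor, the differences
  become products with squares again by \<open>A_num_Suc_Suc\<close>. Both n and k have then dropped
  by 2, and the last index leaves the boundary term.\<close>

lemma BA_sum_recurrence:
  "BA_sum (Suc (Suc n)) k = BA_sum n (k - 2) + boundary_coeff n * A_num (n mod 2) (k - 1)"
proof -
  define b where "b = n div 2"
  have set1: "{s. 2 * s + 2 \<le> Suc (Suc n)} = {..b}" by (auto simp: b_def)
  have set2: "{s. 2 * s + 2 \<le> n} = {..<b}" by (auto simp: b_def)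
  have "BA_sum (Suc (Suc n)) k = (\<Sum>s\<le>b. (B_ext n s - (if s = 0 then 0 else B_ext n (s - 1))) * A_num (n - 2 * s) (k - 1))"
    unfolding BA_sum_def set1
  proof (rule sum.cong)
    fix s assume "s \<in> {..b}"
    then have s: "2 * s + 2 \<le> Suc (Suc n)" by (auto simp: b_def)
    show "B_num (Suc (Suc n)) (Suc (Suc n) - 2 * s) * ((real (Suc (Suc n)) - 2 * real s - 1) ^ 2 * A_num (Suc (Suc n) - 2 * s - 2) (k - 1))
       = (B_ext n s - (if s = 0 then 0 else B_ext n (s - 1))) * A_num (n - 2 * s) (k - 1)"
      using B_ext_recurrence[OF s] s
      by (simp add: B_ext_def[of "Suc (Suc n)"] mult_ac del: of_nat_Suc)
  qed simp
  also have "\<dots> = (\<Sum>s\<le>b. B_ext n s * A_num (n - 2 * s) (k - 1)) - (\<Sum>s<b. B_ext n s * A_num (n - 2 * s - 2) (k - 1))"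
  proof -
    have "(\<Sum>s\<le>b. (if s = 0 then 0 else B_ext n (s - 1)) * A_num (n - 2 * s) (k - 1))
       = (\<Sum>s<b. B_ext n s * A_num (n - 2 * s - 2) (k - 1))"
      by (simp add: sum.atMost_shift)
    then show ?thesis by (simp add: left_diff_distrib sum_subtractf)
  qed
  also have "\<dots> = B_ext n b * A_num (n - 2 * b) (k - 1)
      + (\<Sum>s<b. B_ext n s * (A_num (n - 2 * s) (k - 1) - A_num (n - 2 * s - 2) (k - 1)))"
    by (simp add: right_diff_distrib sum_subtractf flip: lessThan_Suc_atMost)
  also have "(\<Sum>s<b. B_ext n s * (A_num (n - 2 * s) (k - 1) - A_num (n - 2 * s - 2) (k - 1))) = BA_sum n (k - 2)"
    unfolding BA_sum_def set2
  proof (rule sum.cong)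
    fix s assume "s \<in> {..<b}"
    then have s: "2 * s + 2 \<le> n" by (auto simp: b_def)
    define m where "m = n - 2 * s - 2"
    have n: "n = Suc (Suc m) + 2 * s" using s by (simp add: m_def)
    show "B_ext n s * (A_num (n - 2 * s) (k - 1) - A_num (n - 2 * s - 2) (k - 1))
      = B_num n (n - 2 * s) * ((real n - 2 * real s - 1) ^ 2 * A_num (n - 2 * s - 2) (k - 2 - 1))"
      using A_num_Suc_Suc[of m "k - 1"] n by (simp add: B_ext_def)
  qed simp
  also have "B_ext n b = boundary_coeff n"
    using B_ext_last[of n b] by (cases "n = 0") (auto simp: boundary_coeff_def b_def B_ext_def)
  also have "n - 2 * b = n mod 2" by (simp add: b_def minus_mult_div_eq_mod)
  finally show ?thesis by simp
qed

lemma BA_sum_eq: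
  "BA_sum n k = (\<Sum>j\<in>{1..n div 2}. boundary_coeff (n - 2 * j) * A_num (n mod 2) (k + 1 - 2 * int j))"
proof (induction n arbitrary: k rule: less_induct)
  case (less n)
  show ?case
  proof (cases "n < 2")
    case True
    then show ?thesis by (auto simp: BA_sum_def)
  next
    case False
    then obtain m where n: "n = Suc (Suc m)" by (metis add_2_eq_Suc le_Suc_ex not_less)
    have "BA_sum n k = (\<Sum>j\<in>{1..m div 2}. boundary_coeff (m - 2 * j) * A_num (m mod 2) (k - 2 + 1 - 2 * int j))
       + boundary_coeff m * A_num (m mod 2) (k - 1)"
      using BA_sum_recurrence[of m k] less.IH[of m "k - 2"] n by simp
    also have "(\<Sum>j\<in>{1..m div 2}. boundary_coeff (m - 2 * j) * A_num (m mod 2) (k - 2 + 1 - 2 * int j))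
      = (\<Sum>j\<in>{Suc 1..Suc (m div 2)}. boundary_coeff (n - 2 * j) * A_num (n mod 2) (k + 1 - 2 * int j))"
      unfolding sum.shift_bounds_cl_Suc_ivl by (rule sum.cong) (auto simp: n algebra_simps)
    also have "\<dots> + boundary_coeff m * A_num (m mod 2) (k - 1)
       = (\<Sum>j\<in>{1..Suc (m div 2)}. boundary_coeff (n - 2 * j) * A_num (n mod 2) (k + 1 - 2 * int j))"
      by (subst (2) sum.atLeast_Suc_atMost) (auto simp: n)
    finally show ?thesis by (simp add: n)
  qed
qed

text \<open>The degree of Q_n is n for even n and n - 1 for odd n. In powers of 1/x the series of
  tanh starts with order 1 and that of coth with order -1, so nothing beyond x^n arises.\<close>

lemma A_num_eq_0: "int n < k \<Longrightarrow> A_num n k = 0"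
proof (induction n arbitrary: k rule: less_induct)
  case (less n)
  consider "n = 0" | "n = 1" | m where "n = Suc (Suc m)" by (metis One_nat_def not0_implies_Suc)
  then show ?case
  proof cases
    case 1
    then show ?thesis using less.prems
      by (auto simp: A_num_0 A_kernel_def fls_subdegree_tanh fls_eq0_below_subdegree)
  next
    case 2
    then show ?thesis using less.prems
      by (auto simp: A_num_1 A_kernel_def fls_subdegree_coth fls_eq0_below_subdegree)
  next
    case 3
    then show ?thesis using less.prems less.IH[of m k] less.IH[of m "k - 2"]
      by (simp add: A_num_Suc_Suc)
  qed
qed

text \<open>The even and the odd part of exp(pi x) + 1, namely 2 cosh(pi x/2)^2 and 2 sinh(pi x/2)
  cosh(pi x/2). By these factorisations tanh and coth exchange the two parts, which is why these
  kernels lead to a closed form.\<close>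

definition boundary_fps :: "nat \<Rightarrow> real fps" where
  "boundary_fps e = Abs_fps (\<lambda>n. if n mod 2 = e then boundary_coeff n else 0)"

lemma boundary_fps_even:
  "boundary_fps 0 = fps_const (1 / 2) * ((fps_exp (pi / 2) + fps_exp (- (pi / 2))) * (fps_exp (pi / 2) + fps_exp (- (pi / 2))))"
  and boundary_fps_odd:
  "boundary_fps 1 = fps_const (1 / 2) * ((fps_exp (pi / 2) + fps_exp (- (pi / 2))) * (fps_exp (pi / 2) - fps_exp (- (pi / 2))))"
proof -
  have a: "fps_exp (pi / 2) * fps_exp (pi / 2) = fps_exp pi"
    "fps_exp (- (pi / 2)) * fps_exp (- (pi / 2)) = fps_exp (- pi)"
    "fps_exp (pi / 2) * fps_exp (- (pi / 2)) = 1" "fps_exp (- (pi / 2)) * fps_exp (pi / 2) = 1"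
    by (simp_all flip: fps_exp_add_mult)
  have 1: "(fps_exp (pi / 2) + fps_exp (- (pi / 2))) * (fps_exp (pi / 2) + fps_exp (- (pi / 2)))
      = fps_exp pi + fps_exp (- pi) + 2"
    "(fps_exp (pi / 2) + fps_exp (- (pi / 2))) * (fps_exp (pi / 2) - fps_exp (- (pi / 2)))
      = fps_exp pi - fps_exp (- pi)"
    by (simp_all add: algebra_simps a)
  have 2: "fps_nth (2 :: real fps) n = (if n = 0 then 2 else 0)" for n
    by (simp add: numeral_fps_const)
  have 3: "(- pi) ^ n = (if n mod 2 = 0 then pi ^ n else - (pi ^ n))" for n
    by (cases "even n") (auto simp: even_iff_mod_2_eq_zero)
  show "boundary_fps 0 = fps_const (1 / 2) * ((fps_exp (pi / 2) + fps_exp (- (pi / 2))) * (fps_exp (pi / 2) + fps_exp (- (pi / 2))))"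
    unfolding 1 by (rule fps_ext) (auto simp: boundary_fps_def boundary_coeff_def 2 3)
  show "boundary_fps 1 = fps_const (1 / 2) * ((fps_exp (pi / 2) + fps_exp (- (pi / 2))) * (fps_exp (pi / 2) - fps_exp (- (pi / 2))))"
    unfolding 1 by (rule fps_ext) (auto simp: boundary_fps_def boundary_coeff_def 2 3 dest: odd_pos)
qed

lemma boundary_fps_times_kernel:
  assumes "odd k"
  shows "fps_to_fls (boundary_fps 0) * A_kernel 0 k = fps_to_fls (boundary_fps 1)"
    and "fps_to_fls (boundary_fps 1) * A_kernel 1 k = fps_to_fls (boundary_fps 0)"
    and "fps_to_fls (fps_exp (pi / 2) - fps_exp (- (pi / 2))) * A_kernel 1 k = fps_to_fls (fps_exp (pi / 2) + fps_exp (- (pi / 2)))"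
proof -
  have nz: "fps_to_fls (fps_exp (pi / 2) - fps_exp (- (pi / 2))) \<noteq> 0"
    "fps_to_fls (fps_exp (pi / 2) + fps_exp (- (pi / 2))) \<noteq> 0"
  proof -
    have "fps_exp (pi / 2) - fps_exp (- (pi / 2)) \<noteq> 0"
      by (metis fps_exp_minus_subdegree subdegree_0 zero_neq_one pi_half_neq_zero)
    then show "fps_to_fls (fps_exp (pi / 2) - fps_exp (- (pi / 2))) \<noteq> 0"
      by (simp only: fps_to_fls_eq_0_iff not_False_eq_True)
    have "fps_exp (pi / 2) + fps_exp (- (pi / 2)) \<noteq> 0"
      by (auto simp: fps_eq_iff intro!: exI[of _ 0])
    then show "fps_to_fls (fps_exp (pi / 2) + fps_exp (- (pi / 2))) \<noteq> 0"
      by (simp only: fps_to_fls_eq_0_iff not_False_eq_True)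
  qed
  have c: "c * (p * p) * (m / p) = c * (p * m)" "c * (p * m) * (p / m) = c * (p * p)" "m * (p / m) = p"
    if "m \<noteq> 0" "p \<noteq> 0" for c p m :: "real fls"
    using that by simp_all
  show "fps_to_fls (boundary_fps 0) * A_kernel 0 k = fps_to_fls (boundary_fps 1)"
    unfolding boundary_fps_even boundary_fps_odd fls_times_fps_to_fls A_kernel_def fls_tanh_def
    using assms c(1)[OF nz] by simp
  show "fps_to_fls (boundary_fps 1) * A_kernel 1 k = fps_to_fls (boundary_fps 0)"
    unfolding boundary_fps_even boundary_fps_odd fls_times_fps_to_fls A_kernel_def fls_coth_def
    using assms c(2)[OF nz] by simp
  show "fps_to_fls (fps_exp (pi / 2) - fps_exp (- (pi / 2))) * A_kernel 1 k = fps_to_fls (fps_exp (pi / 2) + fps_exp (- (pi / 2)))"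
    unfolding A_kernel_def fls_coth_def using assms c(3)[OF nz] by simp
qed

lemma A_kernel_subdegree: "fls_subdegree (A_kernel n k) \<ge> - 1"
  by (simp add: A_kernel_def fls_subdegree_tanh fls_subdegree_coth)

text \<open>Constant terms are compared in sinh times coth = cosh. The residue is the value that the
  convention assigns to the term with A[-1,-1].\<close>

lemma A_kernel_1_pole: "odd k \<Longrightarrow> fls_nth (A_kernel 1 k) (- 1) = 2 / pi"
proof -
  assume k: "odd k"
  have "fls_nth (fps_to_fls (fps_exp (pi / 2) - fps_exp (- (pi / 2))) * A_kernel 1 k) (int 0) = 2"
    unfolding boundary_fps_times_kernel(3)[OF k] by simp
  then show ?thesis
    using A_kernel_subdegree by (subst (asm) fls_nth_times_fps_left) (auto simp: field_simps)
qed

text \<open>By \<open>BA_sum_eq\<close> the sum is a convolution of \<open>boundary_coeff\<close>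
  with the coefficients of a kernel. For odd k the kernel is 1 and a single term survives. For even
  k the kernel is tanh or coth, which carries the part of exp(pi x) + 1 with the parity of n to the
  other part, and the sum is a coefficient of the latter.\<close>

lemma A_num_sum_eq:
  assumes n: "n \<ge> k + 1"
  shows "(\<Sum>s | n - 2 * s \<ge> k + 1. B_num n (n - 2 * s) * A_factor (n - 2 * s) k) =
    boundary_coeff (n - k - 1)"
proof -
  define S where "S = {s. n - 2 * s \<ge> k + 1}"
  have finS: "finite S" unfolding S_def by (rule finite_subset[of _ "{..n}"]) auto
  have finS2: "finite {s. 2 * s + 2 \<le> n}" by (rule finite_double_le)
  have "(\<Sum>s\<in>S. B_num n (n - 2 * s) * A_factor (n - 2 * s) k) =
     (\<Sum>s\<in>S. (if 2 * s + 2 \<le> n then B_num n (n - 2 * s) * ((real n - 2 * real s - 1) ^ 2 * A_num (n - 2 * s - 2) (int k - 1)) else 0)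
         + (if n = Suc (2 * s) then B_num n 1 * (2 / pi) else 0))"
    by (rule sum.cong) (auto simp: S_def A_factor_def)
  also have "\<dots> = (\<Sum>s\<in>S. if 2 * s + 2 \<le> n then B_num n (n - 2 * s) * ((real n - 2 * real s - 1) ^ 2 * A_num (n - 2 * s - 2) (int k - 1)) else 0)
      + (\<Sum>s\<in>S. if n = Suc (2 * s) then B_num n 1 * (2 / pi) else 0)"
    by (rule sum.distrib)
  also have "(\<Sum>s\<in>S. if 2 * s + 2 \<le> n then B_num n (n - 2 * s) * ((real n - 2 * real s - 1) ^ 2 * A_num (n - 2 * s - 2) (int k - 1)) else 0) = BA_sum n (int k)"
    unfolding BA_sum_def
  proof (rule sum.mono_neutral_cong[OF finS2 finS])
    fix s assume "s \<in> {s. 2 * s + 2 \<le> n} - S"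
    then have "int (n - 2 * s - 2) < int k - 1" by (auto simp: S_def)
    then show "B_num n (n - 2 * s) * ((real n - 2 * real s - 1) ^ 2 * A_num (n - 2 * s - 2) (int k - 1)) = 0"
      by (simp add: A_num_eq_0)
  qed auto
  also have "(\<Sum>s\<in>S. if n = Suc (2 * s) then B_num n 1 * (2 / pi) else 0) =
      (if k = 0 \<and> odd n then pi ^ n / fact n * (2 / pi) else 0)"
  proof (cases "odd n")
    case True
    have Bn: "B_num n 1 = pi ^ n / fact n"
      using B_ext_last[of n "n div 2"] True by (auto simp: B_ext_def elim!: oddE)
    have "(\<Sum>s\<in>S. if n = Suc (2 * s) then B_num n 1 * (2 / pi) else 0)
      = (\<Sum>s\<in>S. if (n - 1) div 2 = s then B_num n 1 * (2 / pi) else 0)"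
      using True by (intro sum.cong) (auto elim!: oddE)
    also have "\<dots> = (if k = 0 then B_num n 1 * (2 / pi) else 0)"
      using True finS by (auto simp: S_def elim!: oddE)
    finally show ?thesis using True by (simp only: Bn simp_thms)
  qed (auto intro!: sum.neutral)
  also have "BA_sum n (int k) + (if k = 0 \<and> odd n then pi ^ n / fact n * (2 / pi) else 0) = boundary_coeff (n - k - 1)"
  proof (cases "odd k")
    case True
    then obtain h where k: "k = 2 * h + 1" by (auto elim: oddE)
    have A: "A_num (n mod 2) (int k + 1 - 2 * int j) = (if h + 1 = j then 1 else 0)" for j
      using k by (cases "even n") (auto simp: odd_iff_mod_2_eq_one A_num_0 A_num_1[unfolded One_nat_def] A_kernel_def)
    have "BA_sum n (int k) = (\<Sum>j\<in>{1..n div 2}. boundary_coeff (n - 2 * j) * (if h + 1 = j then 1 else 0))"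
      by (simp only: BA_sum_eq A)
    also have "\<dots> = (\<Sum>j\<in>{1..n div 2}. if h + 1 = j then boundary_coeff (n - 2 * j) else 0)"
      by (rule sum.cong) auto
    also have "\<dots> = boundary_coeff (n - k - 1)"
      using n k by (subst sum.delta') auto
    finally show ?thesis using k by simp
  next
    case False
    \<comment> \<open>The index -1 stands for any odd one, since the kernel sees only
      parities.\<close>
    define T where "T = A_kernel (n mod 2) (- 1)"
    have T: "A_num (n mod 2) (int k + 1 - 2 * int j) = fls_nth T (2 * int j - int k - 1)" for j
      using False by (cases "even n") (auto simp: odd_iff_mod_2_eq_one A_num_0 A_num_1[unfolded One_nat_def] A_kernel_def T_def algebra_simps)
    have "boundary_coeff (n - k - 1) = fls_nth (fps_to_fls (boundary_fps (n mod 2)) * T) (int (n - k - 1))"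
    proof -
      define N where "N = n - k - 1"
      have N: "Suc N mod 2 = n mod 2" 
      proof -
        obtain h where "k = 2 * h" using False by (auto elim: evenE)
        then have "n = Suc N + 2 * h" using n by (simp add: N_def)
        then show ?thesis by simp
      qed
      have "fls_nth (fps_to_fls (boundary_fps (n mod 2)) * T) (int N) = boundary_coeff N"
      proof (cases "even n")
        case True
        then have "odd N" using N by (metis even_Suc even_iff_mod_2_eq_zero)
          then have "N mod 2 = 1" by (simp only: odd_iff_mod_2_eq_one)
        with True show ?thesis
          by (simp add: T_def boundary_fps_times_kernel(1) boundary_fps_def[of "Suc 0"] even_iff_mod_2_eq_zero)
      next
        case odd: False
        then have "even N" using N by (metis even_Suc even_iff_mod_2_eq_zero)
          then have "N mod 2 = 0" by (simp only: even_iff_mod_2_eq_zero)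
        with odd show ?thesis
          by (simp add: odd_iff_mod_2_eq_one T_def boundary_fps_times_kernel(2)[unfolded One_nat_def] boundary_fps_def[of 0])
      qed
      then show ?thesis by (simp only: N_def)
    qed
    also have "\<dots> = (\<Sum>i\<le>Suc (n - k - 1). fps_nth (boundary_fps (n mod 2)) i * fls_nth T (int (n - k - 1) - int i))"
      by (rule fls_nth_times_fps_left) (auto simp: T_def A_kernel_subdegree)
    \<comment> \<open>Only indices i with the parity of n contribute; for i = n - 2 j the bound i <=
      n - k reads k <= 2 j.\<close>
    also have "\<dots> = (\<Sum>i\<in>(\<lambda>j. n - 2 * j) ` {j. k \<le> 2 * j \<and> 2 * j \<le> n}. fps_nth (boundary_fps (n mod 2)) i * fls_nth T (int (n - k - 1) - int i))"
    proof (rule sum.mono_neutral_right)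
      show "\<forall>i\<in>{..Suc (n - k - 1)} - (\<lambda>j. n - 2 * j) ` {j. k \<le> 2 * j \<and> 2 * j \<le> n}.
          fps_nth (boundary_fps (n mod 2)) i * fls_nth T (int (n - k - 1) - int i) = 0"
      proof
        fix i assume i: "i \<in> {..Suc (n - k - 1)} - (\<lambda>j. n - 2 * j) ` {j. k \<le> 2 * j \<and> 2 * j \<le> n}"
        have "i mod 2 \<noteq> n mod 2"
        proof
          assume im: "i mod 2 = n mod 2"
          have "i \<le> n - k" using i n by auto
          then have "i \<le> n" by simp
          then have "2 * ((n - i) div 2) = n - i" using im by (metis mod_eq_dvd_iff_nat dvd_mult_div_cancel)
          then have "i = n - 2 * ((n - i) div 2)" "k \<le> 2 * ((n - i) div 2)" "2 * ((n - i) div 2) \<le> n"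
            using \<open>i \<le> n - k\<close> \<open>i \<le> n\<close> n by simp_all
          with i show False by blast
        qed
        then show "fps_nth (boundary_fps (n mod 2)) i * fls_nth T (int (n - k - 1) - int i) = 0"
          by (simp add: boundary_fps_def)
      qed
    qed (use n in auto)
    also have "\<dots> = (\<Sum>j | k \<le> 2 * j \<and> 2 * j \<le> n. fps_nth (boundary_fps (n mod 2)) (n - 2 * j) * fls_nth T (int (n - k - 1) - int (n - 2 * j)))"
      by (subst sum.reindex) (auto simp: inj_on_def)
    also have "\<dots> = (\<Sum>j | k \<le> 2 * j \<and> 2 * j \<le> n. boundary_coeff (n - 2 * j) * fls_nth T (2 * int j - int k - 1))"
    proof (rule sum.cong)
      fix j assume "j \<in> {j. k \<le> 2 * j \<and> 2 * j \<le> n}"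
      then have j: "k \<le> 2 * j" "2 * j \<le> n" by auto
      have "(n - 2 * j) mod 2 = n mod 2"
        using j mod_eq_dvd_iff_nat[of "n - 2 * j" n 2] by simp
      moreover have "int (n - k - 1) - int (n - 2 * j) = 2 * int j - int k - 1" using j n by simp
      ultimately show "fps_nth (boundary_fps (n mod 2)) (n - 2 * j) * fls_nth T (int (n - k - 1) - int (n - 2 * j))
          = boundary_coeff (n - 2 * j) * fls_nth T (2 * int j - int k - 1)"
        by (simp only:) (simp add: boundary_fps_def)
    qed simp
    finally have eq: "boundary_coeff (n - k - 1) =
        (\<Sum>j | k \<le> 2 * j \<and> 2 * j \<le> n. boundary_coeff (n - 2 * j) * fls_nth T (2 * int j - int k - 1))" .
    have T0: "fls_nth T i = 0" if "i < - 1" for i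
      using that A_kernel_subdegree[of "n mod 2" "- 1"] by (simp add: T_def fls_eq0_below_subdegree)
    have BA: "BA_sum n (int k) = (\<Sum>j\<in>{1..n div 2}. boundary_coeff (n - 2 * j) * fls_nth T (2 * int j - int k - 1))"
      by (simp only: BA_sum_eq T)
    show ?thesis
    proof (cases "k = 0")
      case True
      \<comment> \<open>The index j = 0 belongs to the convolution but not to \<open>BA_sum\<close>.
        For odd n its summand is the pole term supplied by the convention; for even n the kernel has
        no pole and the summand is 0.\<close>
      have "{j. k \<le> 2 * j \<and> 2 * j \<le> n} = insert 0 {1..n div 2}" using True by auto
      moreover have "boundary_coeff n * fls_nth T (- 1) = (if odd n then pi ^ n / fact n * (2 / pi) else 0)"
        using n A_kernel_1_pole[of "- 1"]
        by (auto simp: T_def boundary_coeff_def odd_iff_mod_2_eq_one A_kernel_def[of 0] fls_subdegree_tanh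
            fls_eq0_below_subdegree)
      ultimately show ?thesis using True unfolding eq BA by simp
    next
      case k0: False
      have "BA_sum n (int k) = (\<Sum>j | k \<le> 2 * j \<and> 2 * j \<le> n. boundary_coeff (n - 2 * j) * fls_nth T (2 * int j - int k - 1))"
        unfolding BA
      proof (rule sum.mono_neutral_right)
        show "\<forall>i\<in>{1..n div 2} - {j. k \<le> 2 * j \<and> 2 * j \<le> n}. boundary_coeff (n - 2 * i) * fls_nth T (2 * int i - int k - 1) = 0"
          using k0 by (auto intro!: T0)
      qed (use k0 False in \<open>auto elim!: evenE\<close>)
      then show ?thesis using k0 eq by simp
    qed
  qed
  finally show ?thesis by (simp add: S_def)
qed

subsection \<open>Exposing vectors and boundary rays of a wedge\<close>

text \<open>Only the projections of the rows to S matter: y is normal to the face generated by the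
  rows of R in the cone of the projected rows. For S = UNIV these are faces of the cone
  itself.\<close>

definition exposes :: "'e::euclidean_space set \<Rightarrow> (nat \<Rightarrow> 'e) \<Rightarrow> nat set \<Rightarrow> nat set \<Rightarrow> bool" where
  "exposes S x I R \<longleftrightarrow> (\<exists>y\<in>S. (\<forall>i\<in>R. x i \<bullet> y = 0) \<and> (\<forall>i\<in>I - R. 0 < x i \<bullet> y))"

text \<open>Any dim S of the rows are independent as functionals on S. The condition is void if I
  has fewer than dim S elements, which is why it is accompanied by \<open>dim S \<le> card I\<close>
  below.\<close>

definition generic :: "'e::euclidean_space set \<Rightarrow> (nat \<Rightarrow> 'e) \<Rightarrow> nat set \<Rightarrow> bool" where
  "generic S x I \<longleftrightarrow> (\<forall>J\<subseteq>I. card J = dim S \<longrightarrow> (\<forall>y\<in>S. (\<forall>i\<in>J. x i \<bullet> y = 0) \<longrightarrow> y = 0))"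

text \<open>If G - R is nonempty, this is a certificate against \<open>exposes S x G R\<close>:
  evaluated at an exposing vector, the relation would be a sum of positive terms. The signs on R are
  free because those rows vanish there.\<close>

definition balanced :: "'e::euclidean_space set \<Rightarrow> (nat \<Rightarrow> 'e) \<Rightarrow> nat set \<Rightarrow> nat set \<Rightarrow> bool" where
  "balanced S x G R \<longleftrightarrow>
     (\<exists>c::nat \<Rightarrow> real. (\<forall>i\<in>G - R. 0 < c i) \<and> (\<forall>y\<in>S. (\<Sum>i\<in>G. c i * (x i \<bullet> y)) = 0))"

text \<open>The rows are projected to S. Triviality of the common kernel says that the projections
  span S; being no more than dim S many, they form a basis, and prescribed values on a basis come
  from a linear functional, represented by its adjoint.\<close>

lemma square_system_solvable:
  fixes S :: "'e::euclidean_space set" and g :: "nat \<Rightarrow> real"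
  assumes S: "subspace S" and J: "finite J" "card J = dim S"
    and inj: "\<And>y. y \<in> S \<Longrightarrow> (\<forall>i\<in>J. x i \<bullet> y = 0) \<Longrightarrow> y = 0"
  shows "\<exists>z\<in>S. \<forall>i\<in>J. x i \<bullet> z = g i"
proof -
  have spanS: "span S = S" using S by (simp add: span_eq_iff)
  have "\<exists>p\<in>S. \<forall>y\<in>S. v \<bullet> y = p \<bullet> y" for v
  proof -
    obtain a b where ab: "a \<in> span S" "\<And>w. w \<in> span S \<Longrightarrow> orthogonal b w" "v = a + b"
      using orthogonal_subspace_decomp_exists[of S v] by metis
    then show ?thesis
      unfolding spanS by (intro bexI[of _ a]) (auto simp: inner_add_left orthogonal_def)
  qed
  then have "\<exists>p. \<forall>v. p v \<in> S \<and> (\<forall>y\<in>S. v \<bullet> y = p v \<bullet> y)" by metis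
  then obtain p where p: "\<And>v. p v \<in> S" "\<And>v y. y \<in> S \<Longrightarrow> v \<bullet> y = p v \<bullet> y" by blast
  define P where "P = (\<lambda>i. p (x i)) ` J"
  have PS: "P \<subseteq> S" by (auto simp: P_def p)
  have sub: "S \<subseteq> span P"
  proof
    fix v assume v: "v \<in> S"
    obtain a b where ab: "a \<in> span P" "\<And>w. w \<in> span P \<Longrightarrow> orthogonal b w" "v = a + b"
      using orthogonal_subspace_decomp_exists[of P v] by metis
    have "a \<in> S" using ab(1) PS S span_minimal by blast
    then have "b \<in> S" using v ab(3) S by (metis add_diff_cancel_left' subspace_diff)
    moreover have "x i \<bullet> b = 0" if "i \<in> J" for i
    proof -
      have "p (x i) \<in> span P" using that by (auto simp: P_def intro: span_base)
      then have "p (x i) \<bullet> b = 0" using ab(2) by (metis orthogonal_def inner_commute)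
      then show ?thesis using p(2)[OF \<open>b \<in> S\<close>] by metis
    qed
    ultimately have "b = 0" using inj by blast
    then show "v \<in> span P" using ab by simp
  qed
  have cP: "card P \<le> card J" unfolding P_def using J(1) by (rule card_image_le)
  have finP: "finite P" unfolding P_def using J(1) by simp
  have "dim S \<le> card P" using sub finP by (rule dim_le_card)
  then have cardP: "card P = card J" using cP J by simp
  have indep: "independent P"
    using card_le_dim_spanning[of P S] PS sub finP cardP J by simp
  have injp: "inj_on (\<lambda>i. p (x i)) J"
    using cardP J(1) unfolding P_def by (rule eq_card_imp_inj_on[rotated])
  obtain h :: "'e \<Rightarrow> real" where h: "linear h"
    "\<And>v. v \<in> P \<Longrightarrow> h v = g (the_inv_into J (\<lambda>i. p (x i)) v)"
    using linear_independent_extend[OF indep, of "\<lambda>v. g (the_inv_into J (\<lambda>i. p (x i)) v)"] by blast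
  have h1: "h (p (x i)) = g i" if "i \<in> J" for i
    using h(2)[of "p (x i)"] that the_inv_into_f_f[OF injp that] by (auto simp: P_def)
  define z where "z = adjoint h 1"
  have "p (x i) \<bullet> z = h (p (x i))" for i
    using adjoint_works[OF h(1), of "p (x i)" 1] by (simp add: z_def inner_commute)
  moreover have "x i \<bullet> p z = p (x i) \<bullet> z" for i
    by (metis inner_commute p)
  ultimately show ?thesis using h1 p(1) by (intro bexI[of _ "p z"]) auto
qed

lemma generic_solvable:
  fixes S :: "'e::euclidean_space set" and g :: "nat \<Rightarrow> real"
  assumes gen: "generic S x I" and S: "subspace S" and I: "finite I" "dim S \<le> card I"
    and K: "K \<subseteq> I" "card K \<le> dim S"
  shows "\<exists>z\<in>S. \<forall>i\<in>K. x i \<bullet> z = g i"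
proof -
  obtain J where J: "K \<subseteq> J" "J \<subseteq> I" "card J = dim S"
    using exists_subset_between[of K "dim S" I] K I by (metis finite_subset)
  have "\<exists>z\<in>S. \<forall>i\<in>J. x i \<bullet> z = g i"
    using gen J I(1) by (intro square_system_solvable[OF S]) (auto simp: generic_def intro: finite_subset)
  then show ?thesis using J(1) by blast
qed

lemma generic_independent:
  fixes S :: "'e::euclidean_space set" and c :: "nat \<Rightarrow> real"
  assumes gen: "generic S x I" and S: "subspace S" and I: "finite I" "dim S \<le> card I"
    and K: "K \<subseteq> I" "card K \<le> dim S"
    and c: "\<And>y. y \<in> S \<Longrightarrow> (\<Sum>i\<in>K. c i * (x i \<bullet> y)) = 0" and i: "i \<in> K"
  shows "c i = 0"
proof -
  obtain z where z: "z \<in> S" "\<forall>j\<in>K. x j \<bullet> z = (if j = i then 1 else 0)"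
    using generic_solvable[OF gen S I K, of "\<lambda>j. if j = i then 1 else 0"] by blast
  have "(\<Sum>j\<in>K. c j * (x j \<bullet> z)) = (\<Sum>j\<in>K. if j = i then c j else 0)"
    by (rule sum.cong) (use z in auto)
  also have "\<dots> = c i" using i K(1) I(1) by (simp add: finite_subset)
  finally show ?thesis using c[OF z(1)] by simp
qed

text \<open>A Farkas lemma for independent rows. With vectors \<open>d i\<close> dual to the rows in
  K, the functional q has the coefficients \<open>q \<bullet> d i\<close>, since on the common
  kernel it is nonnegative in both directions and so vanishes. For i outside R the vector
  \<open>d i\<close> satisfies the sign conditions itself, so its coefficient is nonnegative. The
  dual vectors lie in S although the identity holds on the larger T.\<close>

lemma generic_dual_span:
  fixes S :: "'e::euclidean_space set"
  assumes gen: "generic S x I" and S: "subspace S" and I: "finite I" "dim S \<le> card I"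
    and K: "K \<subseteq> I" "card K \<le> dim S" and T: "subspace T" "S \<subseteq> T"
    and nonneg: "\<And>z. z \<in> T \<Longrightarrow> (\<forall>i\<in>R. x i \<bullet> z = 0) \<Longrightarrow> (\<forall>i\<in>K. 0 \<le> x i \<bullet> z) \<Longrightarrow> 0 \<le> q \<bullet> z"
    and R: "R \<subseteq> K"
  obtains c :: "nat \<Rightarrow> real" where "\<And>z. z \<in> T \<Longrightarrow> q \<bullet> z = (\<Sum>i\<in>K. c i * (x i \<bullet> z))"
    and "\<And>i. i \<in> K - R \<Longrightarrow> 0 \<le> c i"
proof -
  have finK: "finite K" using K I finite_subset by blast
  have "\<exists>z\<in>S. \<forall>j\<in>K. x j \<bullet> z = (if j = i then 1 else 0)" for i
    by (rule generic_solvable[OF gen S I K])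
  then obtain d where d: "\<And>i. d i \<in> S" "\<And>i j. j \<in> K \<Longrightarrow> x j \<bullet> d i = (if j = i then 1 else 0)" by metis
  have ker: "q \<bullet> z = 0" if z: "z \<in> T" "\<forall>i\<in>K. x i \<bullet> z = 0" for z
  proof -
    have "0 \<le> q \<bullet> z" using z R by (intro nonneg) auto
    moreover have "0 \<le> q \<bullet> (- z)" using z R T(1) by (intro nonneg) (auto simp: subspace_neg)
    ultimately show ?thesis by simp
  qed
  show ?thesis
  proof (rule that[of "\<lambda>i. q \<bullet> d i"])
    fix z assume z: "z \<in> T"
    define w where "w = z - (\<Sum>i\<in>K. (x i \<bullet> z) *\<^sub>R d i)"
    have "w \<in> T" unfolding w_def using z d T
      by (intro subspace_diff subspace_sum subspace_scale) auto
    moreover have "x j \<bullet> w = 0" if j: "j \<in> K" for j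
    proof -
      have "(\<Sum>i\<in>K. x i \<bullet> z * (x j \<bullet> d i)) = (\<Sum>i\<in>K. if j = i then x i \<bullet> z else 0)"
        by (rule sum.cong) (use d j in auto)
      then show ?thesis using j finK by (simp add: w_def inner_diff_right inner_sum_right)
    qed
    ultimately have "q \<bullet> w = 0" using ker by blast
    then show "q \<bullet> z = (\<Sum>i\<in>K. q \<bullet> d i * (x i \<bullet> z))"
      by (simp add: w_def inner_diff_right inner_sum_right mult.commute)
  next
    fix i assume "i \<in> K - R"
    then show "0 \<le> q \<bullet> d i" using d T R by (intro nonneg) (auto split: if_splits)
  qed
qed

lemma small_perturbation_pos:
  fixes x :: "nat \<Rightarrow> 'e::euclidean_space"
  assumes "\<And>i. i \<in> J \<Longrightarrow> 0 < x i \<bullet> y" and "finite J"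
  obtains \<epsilon> where "0 < \<epsilon>" "\<And>i. i \<in> J \<Longrightarrow> 0 < x i \<bullet> (y + \<epsilon> *\<^sub>R z)"
proof -
  define \<delta> where "\<delta> i = (x i \<bullet> y) / (1 + \<bar>x i \<bullet> z\<bar>)" for i
  define \<epsilon> where "\<epsilon> = Min (insert 1 (\<delta> ` J))"
  have fin: "finite (insert 1 (\<delta> ` J))" using assms by simp
  have eps: "0 < \<epsilon>" unfolding \<epsilon>_def using fin assms
    by (subst Min_gr_iff) (auto simp: \<delta>_def intro!: divide_pos_pos add_pos_nonneg)
  show ?thesis
  proof (rule that[OF eps])
    fix i assume i: "i \<in> J"
    then have "\<epsilon> \<le> \<delta> i" unfolding \<epsilon>_def using fin by (intro Min_le) auto
    then have "\<epsilon> * (1 + \<bar>x i \<bullet> z\<bar>) \<le> x i \<bullet> y" by (simp add: \<delta>_def pos_le_divide_eq add_pos_nonneg)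
    moreover have "\<epsilon> * - (x i \<bullet> z) \<le> \<epsilon> * \<bar>x i \<bullet> z\<bar>" using eps by (intro mult_left_mono) auto
    ultimately show "0 < x i \<bullet> (y + \<epsilon> *\<^sub>R z)" using eps by (simp add: inner_add_right algebra_simps)
  qed
qed

text \<open>The vector y is moved by a small multiple of one that is zero on R and positive on the
  rest of T. The latter is found in S', where T is small enough for its rows to be independent,
  whereas y may lie in the larger S.\<close>

lemma exposes_subset_if_face:
  fixes S :: "'e::euclidean_space set"
  assumes S: "subspace S" "subspace S'" "S' \<subseteq> S" and gen: "generic S' x I" "finite I" "dim S' \<le> card I"
    and T: "R \<subseteq> T" "T \<subseteq> I" "card T \<le> dim S'"
    and y: "y \<in> S" "\<And>i. i \<in> T \<Longrightarrow> x i \<bullet> y = 0" "\<And>i. i \<in> I - T \<Longrightarrow> 0 < x i \<bullet> y"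
  shows "exposes S x I R"
proof -
  obtain z where z: "z \<in> S'" "\<forall>i\<in>T. x i \<bullet> z = (if i \<in> R then 0 else 1)"
    using generic_solvable[OF gen(1) S(2) gen(2,3) T(2,3), of "\<lambda>i. if i \<in> R then 0 else 1"] by auto
  obtain \<epsilon> where eps: "0 < \<epsilon>" "\<And>i. i \<in> I - T \<Longrightarrow> 0 < x i \<bullet> (y + \<epsilon> *\<^sub>R z)"
    using small_perturbation_pos[of "I - T" x y z] y(3) gen(2) by blast
  show ?thesis unfolding exposes_def
  proof (intro bexI[of _ "y + \<epsilon> *\<^sub>R z"] conjI ballI)
    show "y + \<epsilon> *\<^sub>R z \<in> S" using y(1) z(1) S by (intro subspace_add subspace_scale) auto
    fix i assume "i \<in> R" then show "x i \<bullet> (y + \<epsilon> *\<^sub>R z) = 0" using T(1) y(2) z(2) by (auto simp: inner_add_right)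
  next
    fix i assume "i \<in> I - R"
    then show "0 < x i \<bullet> (y + \<epsilon> *\<^sub>R z)" using eps y(2) z(2) by (cases "i \<in> T") (auto simp: inner_add_right)
  qed
qed

text \<open>On the upper half of a circle a smaller first coordinate means a larger angle, so the
  determinant of the pair is nonnegative.\<close>

lemma half_circle_order:
  fixes p1 p2 q1 q2 :: real
  assumes "p1\<^sup>2 + p2\<^sup>2 = N" "q1\<^sup>2 + q2\<^sup>2 = N" "0 \<le> p2" "0 \<le> q2" "q1 \<le> p1"
  shows "p2 * q1 \<le> p1 * q2"
proof -
  have m: "a * b \<le> c * d" if "0 \<le> a" "0 \<le> b" "a \<le> c" "b \<le> d" for a b c d :: real
    using that by (intro mult_mono) auto
  consider "0 \<le> p1" "q1 \<le> 0" | "0 \<le> q1" | "p1 \<le> 0" by linarith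
  then show ?thesis
  proof cases
    case 1
    then have "p2 * q1 \<le> 0" "0 \<le> p1 * q2" using assms by (auto simp: mult_nonneg_nonpos)
    then show ?thesis by linarith
  next
    case 2
    then have "q1\<^sup>2 \<le> p1\<^sup>2" using assms by (intro power_mono) auto
    then have "p2\<^sup>2 \<le> q2\<^sup>2" using assms by linarith
    then have "p2 \<le> q2" by (rule power2_le_imp_le) (use assms in auto)
    then show ?thesis using m[of q1 p2 p1 q2] assms 2 by (simp add: mult.commute)
  next
    case 3
    then have "(- p1)\<^sup>2 \<le> (- q1)\<^sup>2" using assms by (intro power_mono) auto
    then have "p1\<^sup>2 \<le> q1\<^sup>2" by simp
    then have "q2\<^sup>2 \<le> p2\<^sup>2" using assms by linarith
    then have "q2 \<le> p2" by (rule power2_le_imp_le) (use assms in auto)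
    then show ?thesis using m[of "- p1" q2 "- q1" p2] assms 3 by (simp add: mult.commute)
  qed
qed

text \<open>
  $S_0\subset S_1\subset S$ is a flag with $S_1=S\cap f^\perp$, $S_0=S_1\cap e^\perp$. The cone of
  all $y\in S$ exposing $R$ is projected to the plane along $S_0$. If its image is neither empty nor
  the whole plane, it is a wedge, and a boundary ray of the wedge is the image of a unique ray
  of the cone, which is spanned by a vector exposing some $G\supseteq R$ with $|G|=\dim S-1$.
\<close>

locale wedge =
  fixes S :: "'e::euclidean_space set" and e f :: 'e and x :: "nat \<Rightarrow> 'e" and I R :: "nat set" and m :: nat
  fixes S0 S1
  defines "S1 \<equiv> {y \<in> S. f \<bullet> y = 0}"
  defines "S0 \<equiv> {y \<in> S. f \<bullet> y = 0 \<and> e \<bullet> y = 0}"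
  assumes S: "subspace S" and ef: "e \<in> S" "f \<in> S" "e \<bullet> f = 0" "e \<bullet> e = 1" "f \<bullet> f = 1"
    and dims: "dim S0 = m - 1" "dim S1 = m" "dim S = Suc m"
    and I: "finite I" "m \<le> card I" and R: "R \<subseteq> I" "card R < m"
    and gen0: "generic S0 x I" and gen1: "generic S1 x I" and gen2: "generic S x I"
begin

lemma subspaces: "subspace S0" "subspace S1" "S0 \<subseteq> S1" "S1 \<subseteq> S" "S0 \<subseteq> S"
  using S by (auto simp: S0_def S1_def subspace_def inner_add_right)

lemma finR: "finite R" using R(1) I(1) finite_subset by blast

text \<open>\<open>det_vec y \<bullet> z\<close> is the determinant of the plane vectors (e.y, f.y)
  and (e.z, f.z). Its sign tells on which side of the projected ray of y the projection of z
  lies.\<close>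

definition det_vec :: "'e \<Rightarrow> 'e" where
  "det_vec y = (e \<bullet> y) *\<^sub>R f - (f \<bullet> y) *\<^sub>R e"

lemma det_vec_S0: "z \<in> S0 \<Longrightarrow> det_vec y \<bullet> z = 0"
  by (simp add: det_vec_def S0_def inner_diff_left)

lemma det_vec_commute: "det_vec y \<bullet> z = - (det_vec z \<bullet> y)"
  by (simp add: det_vec_def inner_diff_left)

lemma det_vec_self: "det_vec y \<bullet> y = 0"
  by (simp add: det_vec_def inner_diff_left)

text \<open>Says that y exposes G and spans a boundary ray of the wedge. The coefficients c certify
  the latter: on the cone, the combination of the rows in G is nonnegative, so the projected cone
  stays on one side of the ray. The sign \<sigma> distinguishes the two boundary rays.\<close>

definition boundary_facet :: "real \<Rightarrow> nat set \<Rightarrow> 'e \<Rightarrow> (nat \<Rightarrow> real) \<Rightarrow> bool" where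
  "boundary_facet \<sigma> G y c \<longleftrightarrow> y \<in> S \<and> (\<forall>i\<in>G. x i \<bullet> y = 0) \<and> (\<forall>i\<in>I - G. 0 < x i \<bullet> y) \<and>
     (\<forall>i\<in>G - R. 0 < c i) \<and> (\<forall>z\<in>S. (\<Sum>i\<in>G. c i * (x i \<bullet> z)) = \<sigma> * (det_vec y \<bullet> z))"

definition facets :: "nat set set" where
  "facets = {G. R \<subseteq> G \<and> G \<subseteq> I \<and> card G = m}"

lemma finite_facets: "finite facets"
  using I(1) by (auto simp: facets_def intro: finite_subset[of _ "Pow I"])

lemma facet_finite: "G \<in> facets \<Longrightarrow> finite G"
  using I(1) by (auto simp: facets_def intro: finite_subset)

lemma facet_Diff_nonempty: "G \<in> facets \<Longrightarrow> G - R \<noteq> {}"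
  using R(2) by (auto simp: facets_def)

lemma exposes_if_boundary_facet:
  assumes G: "G \<in> facets" and b: "boundary_facet \<sigma> G y c"
  shows "exposes S x I R"
  by (rule exposes_subset_if_face[OF S subspaces(2,4) gen1 I(1), of R G y])
    (use G b dims I in \<open>auto simp: facets_def boundary_facet_def\<close>)

text \<open>The functional \<open>det_vec y\<close> is zero on S0, whereas a vector of S0 exposing R
  would make the certificate a sum of positive terms.\<close>

lemma not_exposes_if_boundary_facet:
  assumes G: "G \<in> facets" and b: "boundary_facet \<sigma> G y c"
  shows "\<not> exposes S0 x I R"
proof
  assume "exposes S0 x I R"
  then obtain z where z: "z \<in> S0" "\<And>i. i \<in> R \<Longrightarrow> x i \<bullet> z = 0" "\<And>i. i \<in> I - R \<Longrightarrow> 0 < x i \<bullet> z"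
    by (auto simp: exposes_def)
  have "(\<Sum>i\<in>G. c i * (x i \<bullet> z)) = \<sigma> * (det_vec y \<bullet> z)"
    using b z(1) subspaces by (auto simp: boundary_facet_def)
  also have "\<dots> = 0" using z(1) by (simp add: det_vec_S0)
  finally have 0: "(\<Sum>i\<in>G. c i * (x i \<bullet> z)) = 0" .
  have "(\<Sum>i\<in>G. c i * (x i \<bullet> z)) = (\<Sum>i\<in>G - R. c i * (x i \<bullet> z))"
    using G z(2) facet_finite[OF G] by (intro sum.mono_neutral_right) auto
  also have "\<dots> > 0"
  proof (rule sum_pos)
    fix i assume i: "i \<in> G - R"
    then have "i \<in> I - R" using G by (auto simp: facets_def)
    then have "0 < x i \<bullet> z" "0 < c i" using b i z(3) by (auto simp: boundary_facet_def)
    then show "0 < c i * (x i \<bullet> z)" by simp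
  qed (use facet_finite[OF G] facet_Diff_nonempty[OF G] in auto)
  finally show False using 0 by simp
qed

lemma boundary_facet_nonneg:
  assumes G: "G \<in> facets" and b: "boundary_facet \<sigma> G y c" and z: "z \<in> S" "\<And>i. i \<in> R \<Longrightarrow> x i \<bullet> z = 0"
      "\<And>i. i \<in> I \<Longrightarrow> 0 \<le> x i \<bullet> z"
  shows "0 \<le> \<sigma> * (det_vec y \<bullet> z)" and "\<sigma> * (det_vec y \<bullet> z) = 0 \<Longrightarrow> i \<in> G \<Longrightarrow> x i \<bullet> z = 0"
proof -
  have eq: "\<sigma> * (det_vec y \<bullet> z) = (\<Sum>i\<in>G - R. c i * (x i \<bullet> z))"
  proof -
    have "\<sigma> * (det_vec y \<bullet> z) = (\<Sum>i\<in>G. c i * (x i \<bullet> z))"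
      using b z(1) by (auto simp: boundary_facet_def)
    also have "\<dots> = (\<Sum>i\<in>G - R. c i * (x i \<bullet> z))"
      using z(2) facet_finite[OF G] by (intro sum.mono_neutral_right) auto
    finally show ?thesis .
  qed
  have nn: "0 \<le> c i * (x i \<bullet> z)" "0 < c i" if "i \<in> G - R" for i
  proof -
    have "i \<in> I" using that G by (auto simp: facets_def)
    then have "0 \<le> x i \<bullet> z" using z(3) by blast
    moreover show "0 < c i" using that b by (auto simp: boundary_facet_def)
    ultimately show "0 \<le> c i * (x i \<bullet> z)" by simp
  qed
  show "0 \<le> \<sigma> * (det_vec y \<bullet> z)" unfolding eq using nn by (intro sum_nonneg) auto
  assume "\<sigma> * (det_vec y \<bullet> z) = 0" and i: "i \<in> G"
  then have "\<forall>i\<in>G - R. c i * (x i \<bullet> z) = 0"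
    unfolding eq using nn facet_finite[OF G] by (subst (asm) sum_nonneg_eq_0_iff) auto
  then show "x i \<bullet> z = 0" using i z(2) nn(2) by (cases "i \<in> R") (auto simp: less_le)
qed

text \<open>Each of y and y' lies on the nonnegative side of the other and the determinant is
  antisymmetric, so it is zero. By \<open>boundary_facet_nonneg\<close> the rows of G then vanish on
  y', which puts G inside G'; the cardinalities agree.\<close>

lemma boundary_facet_unique:
  assumes G: "G \<in> facets" "G' \<in> facets" and b: "boundary_facet \<sigma> G y c" "boundary_facet \<sigma> G' y' c'"
  shows "G = G'"
proof -
  have nn: "0 \<le> x i \<bullet> w" if "boundary_facet \<sigma> H w d" "i \<in> I" for H w d i
    using that by (cases "i \<in> H") (auto simp: boundary_facet_def less_imp_le)
  have RG: "R \<subseteq> G" "R \<subseteq> G'" "G \<subseteq> I" using G by (auto simp: facets_def)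
  have yy: "y \<in> S" "y' \<in> S" "\<And>i. i \<in> R \<Longrightarrow> x i \<bullet> y = 0" "\<And>i. i \<in> R \<Longrightarrow> x i \<bullet> y' = 0"
    using b RG by (auto simp: boundary_facet_def)
  have "0 \<le> \<sigma> * (det_vec y \<bullet> y')" "0 \<le> \<sigma> * (det_vec y' \<bullet> y)"
    by (rule boundary_facet_nonneg(1)[OF G(1) b(1) yy(2,4) nn[OF b(2)]]
        boundary_facet_nonneg(1)[OF G(2) b(2) yy(1,3) nn[OF b(1)]]; assumption)+
  then have 0: "\<sigma> * (det_vec y \<bullet> y') = 0" using det_vec_commute[of y y'] by simp
  have "G \<subseteq> G'"
  proof
    fix i assume i: "i \<in> G"
    have "x i \<bullet> y' = 0"
      by (rule boundary_facet_nonneg(2)[OF G(1) b(1) yy(2,4) nn[OF b(2)] 0 i])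
    moreover have "0 < x i \<bullet> y'" if "i \<notin> G'"
      using b(2) i RG(3) that unfolding boundary_facet_def by blast
    ultimately show "i \<in> G'" by force
  qed
  moreover have "card G = card G'" using G by (simp add: facets_def)
  ultimately show ?thesis using card_subset_eq facet_finite[OF G(2)] by blast
qed

text \<open>The m rows of G are independent on S1, a hyperplane of S, so their kernel in S is a line
  that meets S1 only in 0. It is spanned by f minus the vector of S1 on which these rows take the
  same values as on f.\<close>

lemma kernel_vector:
  assumes G: "G \<in> facets"
  obtains y where "y \<in> S" "f \<bullet> y = 1" "\<And>i. i \<in> G \<Longrightarrow> x i \<bullet> y = 0"
    "\<And>w. w \<in> S \<Longrightarrow> (\<And>i. i \<in> G \<Longrightarrow> x i \<bullet> w = 0) \<Longrightarrow> w = (f \<bullet> w) *\<^sub>R y"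
proof -
  have G': "G \<subseteq> I" "card G \<le> dim S1" "dim S1 \<le> card I" "card G = dim S1" using G dims I by (auto simp: facets_def)
  obtain z where z: "z \<in> S1" "\<forall>i\<in>G. x i \<bullet> z = x i \<bullet> f"
    using generic_solvable[OF gen1 subspaces(2) I(1) G'(3,1,2), of "\<lambda>i. x i \<bullet> f"] by blast
  have y: "f - z \<in> S" "f \<bullet> (f - z) = 1" "\<And>i. i \<in> G \<Longrightarrow> x i \<bullet> (f - z) = 0"
    using z ef S by (auto simp: S1_def inner_diff_right intro: subspace_diff)
  show ?thesis
  proof (rule that[OF y])
    fix w assume w: "w \<in> S" "\<And>i. i \<in> G \<Longrightarrow> x i \<bullet> w = 0"
    have "w - (f \<bullet> w) *\<^sub>R (f - z) \<in> S1"
      using w(1) y S unfolding S1_def by (auto intro!: subspace_diff subspace_scale simp: inner_diff_right[of f w])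
    moreover have "x i \<bullet> (w - (f \<bullet> w) *\<^sub>R (f - z)) = 0" if "i \<in> G" for i
      using w(2) y(3) that by (simp add: inner_diff_right[of "x i" w])
    ultimately have "w - (f \<bullet> w) *\<^sub>R (f - z) = 0"
      using gen1 G'(1,4) unfolding generic_def by blast
    then show "w = (f \<bullet> w) *\<^sub>R (f - z)" by simp
  qed
qed

text \<open>The balanced combination vanishes on S0 and on y. Together with e these span S, so it is
  a multiple of the determinant with y, and rescaling y leaves only the sign of the factor.\<close>

lemma boundary_facet_if_balanced:
  assumes G: "G \<in> facets" and bal: "balanced S0 x G R"
    and y: "y \<in> S" "y \<noteq> 0" "\<And>i. i \<in> G \<Longrightarrow> x i \<bullet> y = 0" "\<And>i. i \<in> I - G \<Longrightarrow> 0 < x i \<bullet> y"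
  shows "\<exists>\<sigma>\<in>{1, -1}. \<exists>y c. boundary_facet \<sigma> G y c"
proof -
  obtain c where c: "\<And>i. i \<in> G - R \<Longrightarrow> 0 < c i" "\<And>z. z \<in> S0 \<Longrightarrow> (\<Sum>i\<in>G. c i * (x i \<bullet> z)) = 0"
    using bal by (auto simp: balanced_def)
  define l where "l z = (\<Sum>i\<in>G. c i * (x i \<bullet> z))" for z
  have l_add: "l (u + v) = l u + l v" and l_scale: "l (t *\<^sub>R u) = t * l u" for u v t
    by (simp_all add: l_def inner_add_right algebra_simps sum.distrib sum_distrib_left)
  obtain y0 where y0: "\<And>w. w \<in> S \<Longrightarrow> (\<And>i. i \<in> G \<Longrightarrow> x i \<bullet> w = 0) \<Longrightarrow> w = (f \<bullet> w) *\<^sub>R y0"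
    using kernel_vector[OF G] by blast
  have fy: "f \<bullet> y \<noteq> 0" using y0[OF y(1,3)] y(2) by force
  have ly: "l y = 0" unfolding l_def using y(3) by simp
  \<comment> \<open>Forced by evaluation at e, where the determinant with y is
    \<open>- (f \<bullet> y)\<close>.\<close>
  define \<kappa> where "\<kappa> = - l e / (f \<bullet> y)"
  have l_eq: "l z = \<kappa> * (det_vec y \<bullet> z)" if z: "z \<in> S" for z
  proof -
    define z' where "z' = z - (f \<bullet> z / (f \<bullet> y)) *\<^sub>R y"
    define z'' where "z'' = z' - (e \<bullet> z') *\<^sub>R e"
    have z'S: "z' \<in> S" unfolding z'_def using z y(1) S by (intro subspace_diff subspace_scale)
    have "f \<bullet> z' = 0" using fy by (simp add: z'_def inner_diff_right)
    then have "z'' \<in> S0" using z'S ef S unfolding S0_def z''_def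
      by (auto intro!: subspace_diff subspace_scale simp: inner_diff_right inner_commute[of f e])
    then have "l z'' = 0" using c(2) by (simp add: l_def)
    moreover have "z = z'' + (e \<bullet> z') *\<^sub>R e + (f \<bullet> z / (f \<bullet> y)) *\<^sub>R y" by (simp add: z''_def z'_def)
    then have "l z = l z'' + (e \<bullet> z') * l e + (f \<bullet> z / (f \<bullet> y)) * l y"
      by (simp only: l_add[symmetric] l_scale[symmetric])
    ultimately have "l z = (e \<bullet> z') * l e" using ly by simp
    also have "e \<bullet> z' = e \<bullet> z - (f \<bullet> z / (f \<bullet> y)) * (e \<bullet> y)" by (simp add: z'_def inner_diff_right)
    finally show ?thesis using fy by (simp add: \<kappa>_def det_vec_def inner_diff_left field_simps)
  qed
  \<comment> \<open>Otherwise the combination would be a nontrivial relation between the rows of G,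
    which are independent on S1.\<close>
  have "\<kappa> \<noteq> 0"
  proof
    assume "\<kappa> = 0"
    obtain i where i: "i \<in> G - R" using facet_Diff_nonempty[OF G] by blast
    have "c i = 0"
      using l_eq \<open>\<kappa> = 0\<close> subspaces G dims I i
      by (intro generic_independent[OF gen1 subspaces(2) I(1), of G c i]) (auto simp: facets_def l_def)
    then show False using c(1)[OF i] by simp
  qed
  have "boundary_facet (sgn \<kappa>) G (\<bar>\<kappa>\<bar> *\<^sub>R y) c"
    unfolding boundary_facet_def
  proof (intro conjI ballI)
    fix z assume "z \<in> S"
    have "det_vec (\<bar>\<kappa>\<bar> *\<^sub>R y) \<bullet> z = \<bar>\<kappa>\<bar> * (det_vec y \<bullet> z)"
      by (simp add: det_vec_def inner_diff_left algebra_simps)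
    then have "sgn \<kappa> * (det_vec (\<bar>\<kappa>\<bar> *\<^sub>R y) \<bullet> z) = \<kappa> * (det_vec y \<bullet> z)"
      by (simp add: sgn_mult_abs flip: mult.assoc)
    then show "(\<Sum>i\<in>G. c i * (x i \<bullet> z)) = sgn \<kappa> * (det_vec (\<bar>\<kappa>\<bar> *\<^sub>R y) \<bullet> z)"
      using l_eq[OF \<open>z \<in> S\<close>] by (simp add: l_def)
  qed (use y c(1) S \<open>\<kappa> \<noteq> 0\<close> in \<open>auto intro: subspace_scale\<close>)
  moreover have "sgn \<kappa> \<in> {1, -1}" using \<open>\<kappa> \<noteq> 0\<close> by (auto simp: sgn_if)
  ultimately show ?thesis by blast
qed

lemma boundary_facet_flip: "boundary_facet \<sigma> I y c \<Longrightarrow> boundary_facet (- \<sigma>) I (- y) c"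
  using S by (auto simp: boundary_facet_def det_vec_def inner_diff_left algebra_simps intro: subspace_neg)

text \<open>A row outside G fixes the direction on the kernel line of G, so y' is a positive
  multiple of y. Certificates for opposite signs then add up to a vanishing combination of the rows
  of G with positive coefficients outside R.\<close>

lemma boundary_facet_orientation:
  assumes G: "G \<in> facets" "G \<noteq> I" and b: "boundary_facet 1 G y c" "boundary_facet (- 1) G y' c'"
  shows False
proof -
  obtain i where i: "i \<in> I - G" using G by (auto simp: facets_def)
  obtain j where j: "j \<in> G - R" using facet_Diff_nonempty[OF G(1)] by blast
  obtain y0 where y0: "\<And>w. w \<in> S \<Longrightarrow> (\<And>i. i \<in> G \<Longrightarrow> x i \<bullet> w = 0) \<Longrightarrow> w = (f \<bullet> w) *\<^sub>R y0"
    using kernel_vector[OF G(1)] by blast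
  define a a' where "a = f \<bullet> y" "a' = f \<bullet> y'"
  have y: "y = a *\<^sub>R y0" "y' = a' *\<^sub>R y0" unfolding a_a'_def using b by (auto simp: boundary_facet_def intro!: y0)
  have "0 < a * (x i \<bullet> y0)" "0 < a' * (x i \<bullet> y0)" using b i unfolding y by (auto simp: boundary_facet_def)
  then have t: "0 < a' / a" and a: "a \<noteq> 0" by (auto simp: zero_less_mult_iff zero_less_divide_iff)
  have y': "y' = (a' / a) *\<^sub>R y" using a by (simp add: y)
  have d: "det_vec y' = (a' / a) *\<^sub>R det_vec y" unfolding y' by (simp add: det_vec_def algebra_simps)
  have "(a' / a) * c j + c' j = 0"
  proof (rule generic_independent[OF gen1 subspaces(2) I(1), of G "\<lambda>j. (a' / a) * c j + c' j"])
    fix z assume "z \<in> S1"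
    then have z: "z \<in> S" using subspaces by auto
    have "(\<Sum>i\<in>G. c i * (x i \<bullet> z)) = det_vec y \<bullet> z" "(\<Sum>i\<in>G. c' i * (x i \<bullet> z)) = - ((a' / a) * (det_vec y \<bullet> z))"
      using b z by (auto simp: boundary_facet_def d)
    moreover have "(\<Sum>i\<in>G. ((a' / a) * c i + c' i) * (x i \<bullet> z)) = (a' / a) * (\<Sum>i\<in>G. c i * (x i \<bullet> z)) + (\<Sum>i\<in>G. c' i * (x i \<bullet> z))"
      by (simp add: distrib_right sum.distrib sum_distrib_left mult.assoc)
    ultimately show "(\<Sum>i\<in>G. ((a' / a) * c i + c' i) * (x i \<bullet> z)) = 0" by simp
  qed (use G I dims j in \<open>auto simp: facets_def\<close>)
  moreover have "0 < c j" "0 < c' j" using b j by (auto simp: boundary_facet_def)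
  moreover from this(1) have "0 < (a' / a) * c j" using t by (rule mult_pos_pos[rotated])
  ultimately show False by linarith
qed

text \<open>A balanced and exposed G yields a boundary ray for one sign only if some row lies
  outside G. For G = I nothing fixes the direction of y, both signs occur, and this is the origin of
  the weight 2.\<close>

lemma boundary_facet_count:
  assumes G: "G \<in> facets"
  shows "of_bool (\<exists>y c. boundary_facet 1 G y c) + of_bool (\<exists>y c. boundary_facet (- 1) G y c) =
    (of_bool (balanced S0 x G R) * (if G = I then 2 else of_bool (exposes S x I G)) :: real)"
proof -
  have bal: "balanced S0 x G R" "exposes S x I G" if "boundary_facet \<sigma> G y c" for \<sigma> y c
  proof -
    have "(\<Sum>i\<in>G. c i * (x i \<bullet> z)) = 0" if "z \<in> S0" for z
      using \<open>boundary_facet \<sigma> G y c\<close> that subspaces(5) by (auto simp: boundary_facet_def det_vec_S0)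
    then show "balanced S0 x G R" using that unfolding balanced_def boundary_facet_def by blast
    show "exposes S x I G" using that unfolding exposes_def boundary_facet_def by auto
  qed
  show ?thesis
  proof (cases "balanced S0 x G R \<and> (G \<noteq> I \<longrightarrow> exposes S x I G)")
    case False
    then have "\<not> boundary_facet \<sigma> G y c" for \<sigma> y c using bal[of \<sigma> y c] by blast
    then show ?thesis using False by (cases "G = I") auto
  next
    case True
    have "\<exists>y. y \<in> S \<and> y \<noteq> 0 \<and> (\<forall>i\<in>G. x i \<bullet> y = 0) \<and> (\<forall>i\<in>I - G. 0 < x i \<bullet> y)"
    proof (cases "G = I")
      case True
      obtain y where y: "y \<in> S" "f \<bullet> y = 1" "\<And>i. i \<in> G \<Longrightarrow> x i \<bullet> y = 0"
        using kernel_vector[OF G] by metis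
      then have "y \<noteq> 0" by auto
      with y show ?thesis using True by blast
    next
      case False
      then obtain i where "i \<in> I - G" using G by (auto simp: facets_def)
      moreover obtain y where y: "y \<in> S" "\<forall>i\<in>G. x i \<bullet> y = 0" "\<forall>i\<in>I - G. 0 < x i \<bullet> y"
        using True False unfolding exposes_def by blast
      ultimately have "0 < x i \<bullet> y" by blast
      then have "y \<noteq> 0" by auto
      with y show ?thesis by blast
    qed
    then obtain \<sigma> y c where b: "\<sigma> \<in> {1, -1}" "boundary_facet \<sigma> G y c"
      using boundary_facet_if_balanced[OF G] True by blast
    show ?thesis
    proof (cases "G = I")
      case GI: True
      have "boundary_facet (- \<sigma>) G (- y) c" using boundary_facet_flip b(2) GI by simp
      moreover have "\<sigma> = 1 \<and> - \<sigma> = - 1 \<or> \<sigma> = - 1 \<and> - \<sigma> = 1" using b(1) by auto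
      ultimately have "\<exists>y c. boundary_facet 1 G y c" "\<exists>y c. boundary_facet (- 1) G y c"
        using b(2) by metis+
      then show ?thesis using True GI by simp
    next
      case GI: False
      have ex: "exposes S x I G" "balanced S0 x G R" using True GI by auto
      from b(1) consider "\<sigma> = 1" | "\<sigma> = -1" by blast
      then show ?thesis
      proof cases
        case 1
        then have "\<exists>y c. boundary_facet 1 G y c" "\<not> (\<exists>y c. boundary_facet (- 1) G y c)"
          using b(2) boundary_facet_orientation[OF G GI] by blast+
        then show ?thesis using ex GI by simp
      next
        case 2
        then have "\<exists>y c. boundary_facet (- 1) G y c" "\<not> (\<exists>y c. boundary_facet 1 G y c)"
          using b(2) boundary_facet_orientation[OF G GI] by blast+
        then show ?thesis using ex GI by simp
      qed
    qed
  qed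
qed

section \<open>The cone of weakly exposing vectors and its projection to the plane\<close>

definition cone :: "'e set" where
  "cone = {y \<in> S. (\<forall>i\<in>R. x i \<bullet> y = 0) \<and> (\<forall>i\<in>I. 0 \<le> x i \<bullet> y)}"

lemma closed_cone: "closed cone"
proof -
  have "cone = S \<inter> (\<Inter>i\<in>R. {y. x i \<bullet> y = 0}) \<inter> (\<Inter>i\<in>I. {y. 0 \<le> x i \<bullet> y})"
    by (auto simp: cone_def)
  also have "closed \<dots>"
    using closed_subspace[OF S] by (intro closed_Int closed_INT ballI closed_Collect_eq closed_Collect_le) (auto intro!: continuous_intros)
  finally show ?thesis .
qed

lemma cone_scale: "y \<in> cone \<Longrightarrow> 0 \<le> t \<Longrightarrow> t *\<^sub>R y \<in> cone"
  using S by (auto simp: cone_def subspace_scale)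

lemma dim_S0_card: "dim S0 \<le> card I" using dims I by simp

text \<open>By genericity on S0 fewer than dim S0 rows vanish on a nonzero y of S0, and then y could
  be moved inside S0 to a vector exposing R. Hence the projection of the cone to the plane maps only
  0 to the origin.\<close>

lemma cone_Int_S0:
  assumes not: "\<not> exposes S0 x I R" and y: "y \<in> cone" "e \<bullet> y = 0" "f \<bullet> y = 0"
  shows "y = 0"
proof (rule ccontr)
  assume y0: "y \<noteq> 0"
  have yS: "y \<in> S0" using y by (auto simp: cone_def S0_def)
  define T where "T = {i \<in> I. x i \<bullet> y = 0}"
  have RT: "R \<subseteq> T" using y R by (auto simp: cone_def T_def)
  have TI: "T \<subseteq> I" by (auto simp: T_def)
  have cardT: "card T < dim S0"
  proof (rule ccontr)
    assume "\<not> card T < dim S0"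
    then obtain J where "J \<subseteq> T" "card J = dim S0" by (metis obtain_subset_with_card_n not_less)
    then show False using gen0 yS y0 unfolding generic_def by (auto simp: T_def subset_iff)
  qed
  have posT: "0 < x i \<bullet> y" if "i \<in> I - T" for i using y(1) that by (auto simp: cone_def T_def less_le)
  have "exposes S0 x I R"
    by (rule exposes_subset_if_face[OF subspaces(1,1) order_refl gen0 I(1) dim_S0_card RT TI less_imp_le[OF cardT] yS _ posT])
      (simp_all add: T_def)
  then show False using not by simp
qed

definition slice :: "'e set" where
  "slice = {y \<in> cone. (e \<bullet> y)\<^sup>2 + (f \<bullet> y)\<^sup>2 = 1}"

lemma slice_normalize:
  assumes not: "\<not> exposes S0 x I R" and y: "y \<in> cone" "y \<noteq> 0"
  obtains t where "0 < t" "t *\<^sub>R y \<in> slice"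
proof -
  define h where "h = (e \<bullet> y)\<^sup>2 + (f \<bullet> y)\<^sup>2"
  have "h \<noteq> 0" using cone_Int_S0[OF not y(1)] y(2) by (auto simp: h_def add_nonneg_eq_0_iff)
  then have h: "0 < h" by (simp add: h_def less_le)
  have "(e \<bullet> (1 / sqrt h) *\<^sub>R y)\<^sup>2 + (f \<bullet> (1 / sqrt h) *\<^sub>R y)\<^sup>2 = ((e \<bullet> y)\<^sup>2 + (f \<bullet> y)\<^sup>2) / h"
    using h by (simp add: power_mult_distrib power_divide add_divide_distrib)
  also have "\<dots> = 1" using h by (simp flip: h_def)
  finally show ?thesis using h y(1) by (intro that[of "1 / sqrt h"]) (auto simp: slice_def intro: cone_scale)
qed

text \<open>The squared projected length \<open>h\<close> is positive on the unit vectors of the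
  cone by \<open>cone_Int_S0\<close>, hence bounded below there by compactness. By homogeneity this
  bounds the norm on the slice.\<close>

lemma compact_slice:
  assumes not: "\<not> exposes S0 x I R"
  shows "compact slice"
proof -
  define h where "h y = (e \<bullet> y)\<^sup>2 + (f \<bullet> y)\<^sup>2" for y
  have cont: "continuous_on A h" for A unfolding h_def by (intro continuous_intros)
  have "closed slice"
  proof -
    have "slice = cone \<inter> {y. h y = 1}" by (auto simp: slice_def h_def)
    also have "closed \<dots>" using closed_cone cont by (intro closed_Int closed_Collect_eq continuous_on_const)
    finally show ?thesis .
  qed
  moreover have "bounded slice"
  proof (cases "slice = {}")
    case False
    then obtain y0 where y0: "y0 \<in> slice" by blast
    define C where "C = cone \<inter> sphere 0 1"
    have "compact C" unfolding C_def using closed_cone by (intro closed_Int_compact compact_sphere)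
    have norm_C: "(1 / norm y) *\<^sub>R y \<in> C" if "y \<in> slice" for y
      using that by (auto simp: C_def slice_def intro: cone_scale)
    then have "C \<noteq> {}" using y0 by blast
    then obtain w where w: "w \<in> C" "\<And>z. z \<in> C \<Longrightarrow> h w \<le> h z"
      using continuous_attains_inf[OF \<open>compact C\<close> _ cont] by blast
    have "h w \<noteq> 0" using cone_Int_S0[OF not, of w] w(1) by (auto simp: h_def C_def add_nonneg_eq_0_iff)
    then have hw: "0 < h w" by (simp add: h_def less_le)
    have "norm y \<le> 1 / sqrt (h w)" if y: "y \<in> slice" for y
    proof -
      have n: "0 < norm y" using y by (auto simp: slice_def)
      have "h w \<le> h ((1 / norm y) *\<^sub>R y)" using w norm_C[OF y] by blast
      also have "\<dots> = h y / (norm y)\<^sup>2" by (simp add: h_def power_divide add_divide_distrib)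
      also have "h y = 1" using y by (simp add: slice_def h_def)
      finally have "(norm y)\<^sup>2 \<le> 1 / h w" using n hw by (simp add: field_simps)
      then have "norm y \<le> sqrt (1 / h w)" by (rule real_le_rsqrt)
      then show ?thesis by (simp add: real_sqrt_divide)
    qed
    then show ?thesis by (auto simp: bounded_iff)
  qed auto
  ultimately show ?thesis by (simp add: compact_eq_bounded_closed)
qed

text \<open>The projection of the vectors exposing R is convex and misses the origin, so it lies on
  one side of a line through the origin. The projected unit directions of the cone thus lie on a
  half-circle, and compactness of \<open>slice\<close> provides an extreme one.\<close>

lemma boundary_ray_exists:
  assumes ex: "exposes S x I R" and not: "\<not> exposes S0 x I R" and \<sigma>: "\<sigma> \<in> {1, - 1}"
  obtains y where "y \<in> slice" "\<And>z. z \<in> cone \<Longrightarrow> 0 \<le> \<sigma> * (det_vec y \<bullet> z)"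
proof -
  define N where "N = {y \<in> S. (\<forall>i\<in>R. x i \<bullet> y = 0) \<and> (\<forall>i\<in>I - R. 0 < x i \<bullet> y)}"
  define u where "u y = (e \<bullet> y, f \<bullet> y)" for y
  obtain y0 where y0: "y0 \<in> N" using ex by (auto simp: exposes_def N_def)
  have NK: "y \<in> cone" if "y \<in> N" for y
  proof -
    have "0 \<le> x i \<bullet> y" if "i \<in> I" for i using that \<open>y \<in> N\<close> by (cases "i \<in> R") (auto simp: N_def intro: less_imp_le)
    then show ?thesis using that by (auto simp: N_def cone_def)
  qed
  have IR: "I - R \<noteq> {}" using R I by auto
  have "convex N"
  proof (rule convexI)
    fix y z and s t :: real assume yz: "y \<in> N" "z \<in> N" and st: "0 \<le> s" "0 \<le> t" "s + t = 1"
    have "0 < s * (x i \<bullet> y) + t * (x i \<bullet> z)" if "i \<in> I - R" for i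
    proof (cases "s = 0")
      case True
      then show ?thesis using yz that st by (auto simp: N_def)
    next
      case False
      then show ?thesis using yz that st by (intro add_pos_nonneg mult_pos_pos mult_nonneg_nonneg) (auto simp: N_def less_imp_le)
    qed
    then show "s *\<^sub>R y + t *\<^sub>R z \<in> N" using yz S
      by (auto simp: N_def inner_add_right intro!: subspace_add subspace_scale)
  qed
  moreover have "linear u" unfolding u_def
    by (auto simp: linear_iff inner_add_right)
  ultimately have cv: "convex (u ` N)" by (simp add: convex_linear_image)
  have "0 \<notin> u ` N"
  proof
    assume "0 \<in> u ` N"
    then obtain y where y: "y \<in> N" "e \<bullet> y = 0" "f \<bullet> y = 0" by (auto simp: u_def zero_prod_def)
    then have "y = 0" using cone_Int_S0[OF not NK] by blast
    then show False using y(1) IR by (auto simp: N_def)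
  qed
  then obtain w :: "real \<times> real" where w: "w \<noteq> 0" "\<And>y. y \<in> N \<Longrightarrow> 0 \<le> w \<bullet> u y"
    using separating_hyperplane_set_0[OF cv] by blast
  obtain w1 w2 where w12: "w = (w1, w2)" by (cases w)
  have pos: "0 < w1\<^sup>2 + w2\<^sup>2" using w(1) by (auto simp: w12 sum_power2_gt_zero_iff zero_prod_def)
  \<comment> \<open>Coordinates along the separating line and normal to it. The sign \<sigma>
    decides which of the two ends of the wedge is found by maximising \<open>p\<close>.\<close>
  define p where "p y = \<sigma> * (w2 * (e \<bullet> y) - w1 * (f \<bullet> y))" for y
  define q where "q y = w1 * (e \<bullet> y) + w2 * (f \<bullet> y)" for y
  have q_nonneg: "0 \<le> q y" if y: "y \<in> cone" for y
  proof -
    \<comment> \<open>Adding a small positive multiple of the exposing vector \<open>y0\<close>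
      makes any vector of the cone exposing, so the separation extends to the whole cone.\<close>
    have key: "0 \<le> q y + \<epsilon> * q y0" if "0 < \<epsilon>" for \<epsilon>
    proof -
      have "y + \<epsilon> *\<^sub>R y0 \<in> N" using y y0 that S
        by (auto simp: N_def cone_def inner_add_right intro!: subspace_add subspace_scale add_nonneg_pos)
      from w(2)[OF this] show ?thesis by (simp add: w12 u_def q_def inner_add_right algebra_simps)
    qed
    have "0 \<le> q y + \<epsilon>" if "0 < \<epsilon>" for \<epsilon>
    proof -
      have q0: "0 \<le> q y0" using w(2)[OF y0] by (simp add: w12 u_def q_def)
      have "0 \<le> q y + (\<epsilon> / (1 + q y0)) * q y0" using that q0 by (intro key divide_pos_pos add_pos_nonneg) auto
      also have "(\<epsilon> / (1 + q y0)) * q y0 \<le> \<epsilon>" using that q0 by (simp add: field_simps add_pos_nonneg)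
      finally show ?thesis by simp
    qed
    then show ?thesis by (rule field_le_epsilon)
  qed
  have "y0 \<noteq> 0" using y0 IR by (auto simp: N_def)
  then have "slice \<noteq> {}" using slice_normalize[OF not NK[OF y0]] by blast
  moreover have "continuous_on slice p" unfolding p_def by (intro continuous_intros)
  ultimately obtain y where y: "y \<in> slice" "\<And>z. z \<in> slice \<Longrightarrow> p z \<le> p y"
    using continuous_attains_sup[OF compact_slice[OF not]] by blast
  have pq: "(p z)\<^sup>2 + (q z)\<^sup>2 = w1\<^sup>2 + w2\<^sup>2" if "z \<in> slice" for z
  proof -
    have "(p z)\<^sup>2 + (q z)\<^sup>2 = (w1\<^sup>2 + w2\<^sup>2) * ((e \<bullet> z)\<^sup>2 + (f \<bullet> z)\<^sup>2)"
      using \<sigma> by (auto simp: p_def q_def power2_eq_square algebra_simps)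
    then show ?thesis using that by (simp add: slice_def)
  qed
  have slice: "0 \<le> \<sigma> * (det_vec y \<bullet> z)" if z: "z \<in> slice" for z
  proof -
    have "q y * p z \<le> p y * q z"
      using y z pq q_nonneg by (intro half_circle_order[OF pq[OF y(1)] pq[OF z]]) (auto simp: slice_def)
    moreover have "p y * q z - q y * p z = (w1\<^sup>2 + w2\<^sup>2) * (\<sigma> * (det_vec y \<bullet> z))"
      by (simp add: p_def q_def det_vec_def inner_diff_left power2_eq_square algebra_simps)
    ultimately have "0 \<le> (w1\<^sup>2 + w2\<^sup>2) * (\<sigma> * (det_vec y \<bullet> z))" by simp
    then show ?thesis using pos by (simp add: zero_le_mult_iff)
  qed
  show ?thesis
  proof (rule that[OF y(1)])
    fix z assume z: "z \<in> cone"
    show "0 \<le> \<sigma> * (det_vec y \<bullet> z)"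
    proof (cases "z = 0")
      case False
      obtain t where t: "0 < t" "t *\<^sub>R z \<in> slice" using slice_normalize[OF not z False] by blast
      have "0 \<le> t * (\<sigma> * (det_vec y \<bullet> z))" using slice[OF t(2)] by (simp add: algebra_simps)
      then show ?thesis using t(1) by (simp add: zero_le_mult_iff)
    qed simp
  qed
qed

text \<open>T collects all rows that vanish on a boundary ray y; genericity on S gives |T| <= m. The
  signed determinant with y is nonnegative on the tangent cone at y, so it is a combination of the
  rows in T with nonnegative coefficients outside R. It vanishes on S0, where fewer than m rows are
  always independent; so at least m coefficients are nonzero, which forces |T| = m.\<close>

lemma boundary_facet_exists:
  assumes ex: "exposes S x I R" and not: "\<not> exposes S0 x I R" and \<sigma>: "\<sigma> \<in> {1, - 1}"
  shows "\<exists>G\<in>facets. \<exists>y c. boundary_facet \<sigma> G y c"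
proof -
  obtain y where y: "y \<in> slice" "\<And>z. z \<in> cone \<Longrightarrow> 0 \<le> \<sigma> * (det_vec y \<bullet> z)"
    using boundary_ray_exists[OF assms] by blast
  have yc: "y \<in> cone" "y \<in> S" "y \<noteq> 0" using y(1) by (auto simp: slice_def cone_def)
  define T where "T = {i \<in> I. x i \<bullet> y = 0}"
  have RT: "R \<subseteq> T" and TI: "T \<subseteq> I" using yc R by (auto simp: cone_def T_def)
  have finT: "finite T" using TI I finite_subset by blast
  have posT: "0 < x i \<bullet> y" if "i \<in> I - T" for i using yc(1) that by (auto simp: cone_def T_def less_le)
  have cardT: "card T \<le> m"
  proof (rule ccontr)
    assume "\<not> card T \<le> m"
    then obtain J where "J \<subseteq> T" "card J = dim S" using dims obtain_subset_with_card_n[of "Suc m" T] by auto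
    then show False using gen2 yc TI unfolding generic_def by (auto simp: T_def subset_iff)
  qed
  have nonneg: "0 \<le> (\<sigma> *\<^sub>R det_vec y) \<bullet> z"
    if z: "z \<in> S" "\<forall>i\<in>R. x i \<bullet> z = 0" "\<forall>i\<in>T. 0 \<le> x i \<bullet> z" for z
  proof -
    obtain \<epsilon> where eps: "0 < \<epsilon>" "\<And>i. i \<in> I - T \<Longrightarrow> 0 < x i \<bullet> (y + \<epsilon> *\<^sub>R z)"
      using small_perturbation_pos[of "I - T" x y z] posT I(1) by blast
    have "y + \<epsilon> *\<^sub>R z \<in> cone"
      unfolding cone_def
    proof (intro CollectI conjI ballI)
      show "y + \<epsilon> *\<^sub>R z \<in> S" using yc z S by (intro subspace_add subspace_scale)
      fix i assume "i \<in> R" then show "x i \<bullet> (y + \<epsilon> *\<^sub>R z) = 0" using RT z by (auto simp: inner_add_right T_def)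
    next
      fix i assume "i \<in> I"
      then show "0 \<le> x i \<bullet> (y + \<epsilon> *\<^sub>R z)" using eps z by (cases "i \<in> T") (auto simp: inner_add_right T_def intro: less_imp_le)
    qed
    from y(2)[OF this] have "0 \<le> \<epsilon> * (\<sigma> * (det_vec y \<bullet> z))"
      using det_vec_self[of y] by (simp add: inner_add_right algebra_simps)
    then show ?thesis using eps(1) by (simp add: zero_le_mult_iff)
  qed
  obtain c where c: "\<And>z. z \<in> S \<Longrightarrow> (\<sigma> *\<^sub>R det_vec y) \<bullet> z = (\<Sum>i\<in>T. c i * (x i \<bullet> z))"
    "\<And>i. i \<in> T - R \<Longrightarrow> 0 \<le> c i"
    by (rule generic_dual_span[OF gen1 subspaces(2) I(1) _ TI _ S subspaces(4) nonneg RT]) (use dims I cardT in auto)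
  have supp: "m \<le> card {i \<in> T. c i \<noteq> 0}"
  proof (rule ccontr)
    assume small: "\<not> m \<le> card {i \<in> T. c i \<noteq> 0}"
    have "c i = 0" if "i \<in> {i \<in> T. c i \<noteq> 0}" for i
    proof (rule generic_independent[OF gen0 subspaces(1) I(1) dim_S0_card _ _ _ that])
      fix z assume z: "z \<in> S0"
      have "(\<Sum>i\<in>{i \<in> T. c i \<noteq> 0}. c i * (x i \<bullet> z)) = (\<Sum>i\<in>T. c i * (x i \<bullet> z))"
        using finT by (intro sum.mono_neutral_left) auto
      also have "\<dots> = (\<sigma> *\<^sub>R det_vec y) \<bullet> z" using c(1)[of z] z subspaces by auto
      also have "\<dots> = 0" using z by (simp add: det_vec_S0)
      finally show "(\<Sum>i\<in>{i \<in> T. c i \<noteq> 0}. c i * (x i \<bullet> z)) = 0" .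
    qed (use TI small dims in auto)
    then have "c i = 0" if "i \<in> T" for i using that by blast
    then have "(\<sigma> *\<^sub>R det_vec y) \<bullet> z = 0" if "z \<in> S" for z unfolding c(1)[OF that] by simp
    from this[of e] this[of f] have "f \<bullet> y = 0" "e \<bullet> y = 0"
      using ef \<sigma> by (auto simp: det_vec_def inner_diff_left inner_commute[of f e])
    then show False using y(1) by (simp add: slice_def)
  qed
  have "card {i \<in> T. c i \<noteq> 0} \<le> card T" using finT by (intro card_mono) auto
  then have "card T = m" "card {i \<in> T. c i \<noteq> 0} = card T" using supp cardT by simp_all
  moreover from this(2) have "{i \<in> T. c i \<noteq> 0} = T" using finT by (intro card_subset_eq) auto
  ultimately have "T \<in> facets" "\<And>i. i \<in> T \<Longrightarrow> c i \<noteq> 0" using RT TI by (auto simp: facets_def)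
  moreover have "boundary_facet \<sigma> T y c"
    unfolding boundary_facet_def
    using yc posT c calculation(2) by (auto simp: T_def less_le)
  ultimately show ?thesis by blast
qed

lemma exposes_mono: "exposes S0 x I R \<Longrightarrow> exposes S x I R"
  using subspaces by (auto simp: exposes_def)

lemma exposes_diff:
  assumes \<sigma>: "\<sigma> \<in> {1, - 1}"
  shows "of_bool (exposes S x I R) - of_bool (exposes S0 x I R) =
    (\<Sum>G\<in>facets. of_bool (\<exists>y c. boundary_facet \<sigma> G y c) :: real)"
proof (cases "exposes S x I R \<and> \<not> exposes S0 x I R")
  case True
  then obtain G y c where G: "G \<in> facets" "boundary_facet \<sigma> G y c"
    using boundary_facet_exists[OF _ _ \<sigma>] by blast
  have "(\<exists>y c. boundary_facet \<sigma> H y c) \<longleftrightarrow> H = G" if "H \<in> facets" for H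
    using boundary_facet_unique[OF that G(1) _ G(2)] G(2) by blast
  then have "(\<Sum>H\<in>facets. of_bool (\<exists>y c. boundary_facet \<sigma> H y c) :: real) = (\<Sum>H\<in>facets. if H = G then 1 else 0)"
    by (intro sum.cong) auto
  also have "\<dots> = 1" using G(1) finite_facets by simp
  finally show ?thesis using True by simp
next
  case False
  then have "\<not> (\<exists>y c. boundary_facet \<sigma> G y c)" if "G \<in> facets" for G
    using that exposes_if_boundary_facet not_exposes_if_boundary_facet by blast
  then have "(\<Sum>G\<in>facets. of_bool (\<exists>y c. boundary_facet \<sigma> G y c) :: real) = 0"
    by (intro sum.neutral) auto
  then show ?thesis using False exposes_mono by auto
qed

text \<open>Adding the identities for both signs leaves conditions on G in which no orientation
  occurs, so that their probabilities can be computed.\<close>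

theorem exposes_difference:
  "2 * (of_bool (exposes S x I R) - of_bool (exposes S0 x I R)) =
    (\<Sum>G\<in>facets. of_bool (balanced S0 x G R) * (if G = I then 2 else of_bool (exposes S x I G)) :: real)"
proof -
  have "2 * (of_bool (exposes S x I R) - of_bool (exposes S0 x I R) :: real) =
    (\<Sum>G\<in>facets. of_bool (\<exists>y c. boundary_facet 1 G y c) + of_bool (\<exists>y c. boundary_facet (- 1) G y c))"
    using exposes_diff[of 1] exposes_diff[of "- 1"] by (simp add: sum.distrib)
  also have "\<dots> = (\<Sum>G\<in>facets. of_bool (balanced S0 x G R) * (if G = I then 2 else of_bool (exposes S x I G)))"
    by (rule sum.cong[OF refl boundary_facet_count])
  finally show ?thesis .
qed

end

subsection \<open>Gaussian vectors\<close>

definition gauss_density :: "'b::euclidean_space \<Rightarrow> real" where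
  "gauss_density x = exp (- (norm x)\<^sup>2 / 2) / sqrt (2 * pi) ^ DIM('b)"

definition gauss :: "'b::euclidean_space measure" where
  "gauss = density lborel (\<lambda>x. ennreal (gauss_density x))"

lemma sets_gauss [simp, measurable_cong]: "sets gauss = sets borel"
  and space_gauss [simp]: "space gauss = UNIV"
  by (simp_all add: gauss_def)

lemma gauss_density_pos: "0 < gauss_density x"
  by (simp add: gauss_density_def)

lemma measurable_gauss_density [measurable]: "gauss_density \<in> borel_measurable borel"
  unfolding gauss_density_def by measurable

lemma gauss_density_prod: "gauss_density (x::'b::euclidean_space) = (\<Prod>b\<in>Basis. std_normal_density (x \<bullet> b))"
proof -
  have "(norm x)\<^sup>2 = (\<Sum>b\<in>Basis. (x \<bullet> b)\<^sup>2)"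
    unfolding power2_norm_eq_inner by (subst euclidean_inner) (simp add: power2_eq_square)
  then have "exp (- (norm x)\<^sup>2 / 2) = exp (\<Sum>b\<in>Basis. - (x \<bullet> b)\<^sup>2 / 2)"
    by (simp only: sum_negf[symmetric] sum_divide_distrib)
  also have "\<dots> = (\<Prod>b\<in>Basis. exp (- (x \<bullet> b)\<^sup>2 / 2))" by (rule exp_sum) simp
  finally have eq: "exp (- (norm x)\<^sup>2 / 2) = (\<Prod>b\<in>Basis. exp (- (x \<bullet> b)\<^sup>2 / 2))" .
  have "std_normal_density y = exp (- y\<^sup>2 / 2) / sqrt (2 * pi)" for y
    by (simp add: std_normal_density_def)
  then show ?thesis
    by (simp only: gauss_density_def eq prod_dividef prod_constant)
qed

lemma nn_integral_std_normal_density: "(\<integral>\<^sup>+x. ennreal (std_normal_density x) \<partial>lborel) = 1"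
  using prob_space.emeasure_space_1[OF prob_space_normal_density[of 1 0]]
  by (simp add: emeasure_density)

lemma prob_space_gauss: "prob_space (gauss :: 'b::euclidean_space measure)"
proof
  have "emeasure (gauss :: 'b measure) (space gauss) = (\<integral>\<^sup>+x. ennreal (\<Prod>b\<in>Basis. std_normal_density ((x::'b) \<bullet> b)) \<partial>lborel)"
    by (simp add: gauss_def emeasure_density gauss_density_prod)
  also have "\<dots> = (\<integral>\<^sup>+x. (\<Prod>b\<in>Basis. ennreal (std_normal_density ((x::'b) \<bullet> b))) \<partial>lborel)"
    by (intro nn_integral_cong) (simp add: prod_ennreal)
  also have "\<dots> = (\<Prod>b\<in>(Basis::'b set). \<integral>\<^sup>+x. ennreal (std_normal_density x) \<partial>lborel)"
    by (rule nn_integral_lborel_prod) auto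
  also have "\<dots> = 1" by (simp add: nn_integral_std_normal_density)
  finally show "emeasure (gauss :: 'b measure) (space gauss) = 1" .
qed

lemma nn_integral_gauss:
  "f \<in> borel_measurable borel \<Longrightarrow> (\<integral>\<^sup>+x. f x \<partial>gauss) = (\<integral>\<^sup>+x. ennreal (gauss_density x) * f x \<partial>lborel)"
  by (simp add: gauss_def nn_integral_density)

section \<open>Rotation invariance and resampling of one Gaussian component\<close>

lemma nn_integral_lborel_affine:
  fixes f :: "'b::euclidean_space \<Rightarrow> ennreal"
  assumes [measurable]: "f \<in> borel_measurable borel" and c: "c \<noteq> 0"
  shows "(\<integral>\<^sup>+x. f x \<partial>lborel) = ennreal (\<bar>c\<bar> ^ DIM('b)) * (\<integral>\<^sup>+x. f (t + c *\<^sub>R x) \<partial>lborel)"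
  by (subst lborel_affine[OF c, of t])
    (simp add: nn_integral_density nn_integral_distr nn_integral_cmult)

text \<open>For fixed y put u = c x + s y, then for fixed u put v = (y - s u)/c. The Jacobians of
  the two substitutions cancel, and the product of the densities depends only on the sum of the
  squared norms, which the rotation preserves.\<close>

lemma nn_integral_gauss_rotation:
  fixes F :: "'b::euclidean_space \<Rightarrow> 'b \<Rightarrow> ennreal"
  assumes F [measurable]: "case_prod F \<in> borel_measurable (borel \<Otimes>\<^sub>M borel)"
    and cs: "c\<^sup>2 + s\<^sup>2 = 1" "c \<noteq> 0"
  shows "(\<integral>\<^sup>+y. \<integral>\<^sup>+x. F (c *\<^sub>R x + s *\<^sub>R y) (c *\<^sub>R y - s *\<^sub>R x) \<partial>gauss \<partial>gauss) = (\<integral>\<^sup>+x. \<integral>\<^sup>+y. F x y \<partial>gauss \<partial>gauss)"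
proof -
  define \<Phi> where "\<Phi> u v = ennreal (gauss_density u) * ennreal (gauss_density v) * F u v" for u v
  have [measurable]: "case_prod \<Phi> \<in> borel_measurable (borel \<Otimes>\<^sub>M borel)" unfolding \<Phi>_def by measurable
  have dens: "gauss_density x * gauss_density y = gauss_density (c *\<^sub>R x + s *\<^sub>R y) * gauss_density (c *\<^sub>R y - s *\<^sub>R x)" for x y :: 'b
  proof -
    have "(norm (c *\<^sub>R x + s *\<^sub>R y))\<^sup>2 + (norm (c *\<^sub>R y - s *\<^sub>R x))\<^sup>2 = (c\<^sup>2 + s\<^sup>2) * ((norm x)\<^sup>2 + (norm y)\<^sup>2)"
      unfolding power2_norm_eq_inner by (simp add: inner_add inner_diff inner_commute algebra_simps power2_eq_square)
    then have "- (norm x)\<^sup>2 / 2 + - (norm y)\<^sup>2 / 2 = - (norm (c *\<^sub>R x + s *\<^sub>R y))\<^sup>2 / 2 + - (norm (c *\<^sub>R y - s *\<^sub>R x))\<^sup>2 / 2"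
      using cs by simp
    then show ?thesis by (simp add: gauss_density_def exp_add[symmetric] del: minus_divide_left)
  qed
  have "(\<integral>\<^sup>+y. \<integral>\<^sup>+x. F (c *\<^sub>R x + s *\<^sub>R y) (c *\<^sub>R y - s *\<^sub>R x) \<partial>gauss \<partial>gauss)
      = (\<integral>\<^sup>+y. \<integral>\<^sup>+x. \<Phi> (c *\<^sub>R x + s *\<^sub>R y) (c *\<^sub>R y - s *\<^sub>R x) \<partial>lborel \<partial>lborel)"
  proof -
    have "ennreal (gauss_density y) * (ennreal (gauss_density x) * F (c *\<^sub>R x + s *\<^sub>R y) (c *\<^sub>R y - s *\<^sub>R x))
        = \<Phi> (c *\<^sub>R x + s *\<^sub>R y) (c *\<^sub>R y - s *\<^sub>R x)" for x y :: 'b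
    proof -
      have "ennreal (gauss_density y) * ennreal (gauss_density x) =
          ennreal (gauss_density (c *\<^sub>R x + s *\<^sub>R y)) * ennreal (gauss_density (c *\<^sub>R y - s *\<^sub>R x))"
        using dens[of x y] by (simp add: gauss_density_pos less_imp_le mult.commute flip: ennreal_mult)
      then show ?thesis by (simp add: \<Phi>_def flip: mult.assoc)
    qed
    then show ?thesis by (simp add: nn_integral_gauss flip: nn_integral_cmult)
  qed
  also have "\<dots> = (\<integral>\<^sup>+y. ennreal (inverse (\<bar>c\<bar> ^ DIM('b))) * (\<integral>\<^sup>+u. \<Phi> u ((1 / c) *\<^sub>R (y - s *\<^sub>R u)) \<partial>lborel) \<partial>lborel)"
  proof (intro nn_integral_cong)
    fix y :: 'b
    have eq: "(1 / c) *\<^sub>R (y - s *\<^sub>R (s *\<^sub>R y + c *\<^sub>R x)) = c *\<^sub>R y - s *\<^sub>R x" for x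
    proof -
      have "y - s *\<^sub>R (s *\<^sub>R y + c *\<^sub>R x) = (1 - s\<^sup>2) *\<^sub>R y - (s * c) *\<^sub>R x"
        by (simp add: algebra_simps power2_eq_square)
      also have "1 - s\<^sup>2 = c * c" using cs by (simp add: power2_eq_square)
      finally show ?thesis using cs by (simp add: scaleR_diff_right)
    qed
    have "(\<integral>\<^sup>+u. \<Phi> u ((1 / c) *\<^sub>R (y - s *\<^sub>R u)) \<partial>lborel) = ennreal (\<bar>c\<bar> ^ DIM('b)) * (\<integral>\<^sup>+x. \<Phi> (s *\<^sub>R y + c *\<^sub>R x) ((1 / c) *\<^sub>R (y - s *\<^sub>R (s *\<^sub>R y + c *\<^sub>R x))) \<partial>lborel)"
      by (rule nn_integral_lborel_affine) (use cs in auto)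
    also have "\<dots> = ennreal (\<bar>c\<bar> ^ DIM('b)) * (\<integral>\<^sup>+x. \<Phi> (c *\<^sub>R x + s *\<^sub>R y) (c *\<^sub>R y - s *\<^sub>R x) \<partial>lborel)"
      unfolding eq by (simp add: add.commute)
    finally show "(\<integral>\<^sup>+x. \<Phi> (c *\<^sub>R x + s *\<^sub>R y) (c *\<^sub>R y - s *\<^sub>R x) \<partial>lborel) =
        ennreal (inverse (\<bar>c\<bar> ^ DIM('b))) * (\<integral>\<^sup>+u. \<Phi> u ((1 / c) *\<^sub>R (y - s *\<^sub>R u)) \<partial>lborel)"
      using cs by (simp flip: mult.assoc ennreal_mult)
  qed
  also have "\<dots> = ennreal (inverse (\<bar>c\<bar> ^ DIM('b))) * (\<integral>\<^sup>+y. \<integral>\<^sup>+u. \<Phi> u ((1 / c) *\<^sub>R (y - s *\<^sub>R u)) \<partial>lborel \<partial>lborel)"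
    by (rule nn_integral_cmult) measurable
  also have "(\<integral>\<^sup>+y. \<integral>\<^sup>+u. \<Phi> u ((1 / c) *\<^sub>R (y - s *\<^sub>R u)) \<partial>lborel \<partial>lborel) = (\<integral>\<^sup>+u. \<integral>\<^sup>+y. \<Phi> u ((1 / c) *\<^sub>R (y - s *\<^sub>R u)) \<partial>lborel \<partial>lborel)"
    by (rule lborel_pair.Fubini') measurable
  also have "\<dots> = (\<integral>\<^sup>+u. ennreal (\<bar>c\<bar> ^ DIM('b)) * (\<integral>\<^sup>+v. \<Phi> u v \<partial>lborel) \<partial>lborel)"
  proof (intro nn_integral_cong)
    fix u :: 'b
    have "(\<integral>\<^sup>+y. \<Phi> u ((1 / c) *\<^sub>R (y - s *\<^sub>R u)) \<partial>lborel) = ennreal (\<bar>c\<bar> ^ DIM('b)) * (\<integral>\<^sup>+v. \<Phi> u ((1 / c) *\<^sub>R (s *\<^sub>R u + c *\<^sub>R v - s *\<^sub>R u)) \<partial>lborel)"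
      by (rule nn_integral_lborel_affine) (use cs in auto)
    then show "(\<integral>\<^sup>+y. \<Phi> u ((1 / c) *\<^sub>R (y - s *\<^sub>R u)) \<partial>lborel) = ennreal (\<bar>c\<bar> ^ DIM('b)) * (\<integral>\<^sup>+v. \<Phi> u v \<partial>lborel)"
      using cs by simp
  qed
  also have "\<dots> = ennreal (\<bar>c\<bar> ^ DIM('b)) * (\<integral>\<^sup>+u. \<integral>\<^sup>+v. \<Phi> u v \<partial>lborel \<partial>lborel)"
    by (rule nn_integral_cmult) measurable
  also have "ennreal (inverse (\<bar>c\<bar> ^ DIM('b))) * \<dots> = (\<integral>\<^sup>+u. \<integral>\<^sup>+v. \<Phi> u v \<partial>lborel \<partial>lborel)"
    using cs by (simp flip: mult.assoc ennreal_mult)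
  also have "\<dots> = (\<integral>\<^sup>+x. \<integral>\<^sup>+y. F x y \<partial>gauss \<partial>gauss)"
    by (simp add: nn_integral_gauss flip: nn_integral_cmult) (simp add: \<Phi>_def mult.assoc)
  finally show ?thesis .
qed

interpretation gauss: prob_space "gauss :: 'b::euclidean_space measure" by (rule prob_space_gauss)

lemma product_prob_space_gauss: "product_prob_space (\<lambda>_. gauss :: 'b::euclidean_space measure)"
  by standard

lemma gauss_Fubini:
  assumes [measurable]: "case_prod f \<in> borel_measurable (gauss \<Otimes>\<^sub>M M)" and "sigma_finite_measure M"
  shows "(\<integral>\<^sup>+y. \<integral>\<^sup>+x. f x y \<partial>gauss \<partial>M) = (\<integral>\<^sup>+x. \<integral>\<^sup>+y. f x y \<partial>M \<partial>gauss)"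
proof -
  interpret M: sigma_finite_measure M by fact
  interpret pair_sigma_finite gauss M by standard
  show ?thesis by (rule Fubini') measurable
qed

text \<open>The family v is regarded as a vector indexed by J with entries in 'b. Its component
  along the unit vector a/|a| is replaced by \<xi> and the orthogonal part is kept.\<close>

definition mix :: "nat set \<Rightarrow> (nat \<Rightarrow> real) \<Rightarrow> (nat \<Rightarrow> 'b::euclidean_space) \<Rightarrow> 'b \<Rightarrow> nat \<Rightarrow> 'b" where
  "mix J a v \<xi> = (\<lambda>i\<in>J. v i + (a i / L2_set a J) *\<^sub>R (\<xi> - (\<Sum>l\<in>J. (a l / L2_set a J) *\<^sub>R v l)))"

lemma measurable_mix [measurable]:
  "(\<lambda>(v, \<xi>). mix J a v \<xi>) \<in> (Pi\<^sub>M J (\<lambda>_. gauss) \<Otimes>\<^sub>M gauss) \<rightarrow>\<^sub>M Pi\<^sub>M J (\<lambda>_. gauss :: 'b::euclidean_space measure)"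
  unfolding mix_def case_prod_beta by measurable

lemma L2_set_pos: "finite J \<Longrightarrow> J \<noteq> {} \<Longrightarrow> (\<And>i. i \<in> J \<Longrightarrow> 0 < a i) \<Longrightarrow> 0 < L2_set a J"
  unfolding L2_set_def by (intro real_sqrt_gt_zero sum_pos zero_less_power)

text \<open>The component of a standard Gaussian family along a fixed unit vector is independent of
  the orthogonal part, so replacing it by a fresh Gaussian keeps the law. The induction splits off
  one index i and rotates its entry against the component along the remaining indices.\<close>

lemma nn_integral_gauss_mix:
  fixes F :: "(nat \<Rightarrow> 'b::euclidean_space) \<Rightarrow> ennreal"
  assumes "finite J" "J \<noteq> {}" "\<And>i. i \<in> J \<Longrightarrow> 0 < a i"
    and "F \<in> borel_measurable (Pi\<^sub>M J (\<lambda>_. gauss))"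
  shows "(\<integral>\<^sup>+\<xi>. \<integral>\<^sup>+v. F (mix J a v \<xi>) \<partial>Pi\<^sub>M J (\<lambda>_. gauss) \<partial>gauss) = (\<integral>\<^sup>+v. F v \<partial>Pi\<^sub>M J (\<lambda>_. gauss))"
  using assms
proof (induction J arbitrary: F rule: finite_ne_induct)
  case (singleton i)
  interpret product_prob_space "\<lambda>_. gauss :: 'b measure" "{i}" by (rule product_prob_space_gauss)
  have [measurable]: "F \<in> borel_measurable (Pi\<^sub>M {i} (\<lambda>_. gauss))" by fact
  have ai: "0 < a i" using singleton by simp
  have mix: "mix {i} a v \<xi> = (\<lambda>_\<in>{i}. \<xi>)" for v \<xi>
    using ai by (auto simp: mix_def)
  interpret P: prob_space "Pi\<^sub>M {i} (\<lambda>_. gauss :: 'b measure)" by (rule prob_space_PiM) (rule prob_space_gauss)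
  have 1: "(\<integral>\<^sup>+v. c \<partial>Pi\<^sub>M {i} (\<lambda>_. gauss :: 'b measure)) = c" for c
    by (simp add: P.emeasure_space_1)
  have "(\<integral>\<^sup>+\<xi>. F (\<lambda>_\<in>{i}. \<xi>) \<partial>gauss) = (\<integral>\<^sup>+v. F (\<lambda>_\<in>{i}. v i) \<partial>Pi\<^sub>M {i} (\<lambda>_. gauss))"
    by (rule product_nn_integral_singleton[symmetric]) measurable
  also have "\<dots> = (\<integral>\<^sup>+v. F v \<partial>Pi\<^sub>M {i} (\<lambda>_. gauss))"
    by (intro nn_integral_cong arg_cong[where f = F]) (auto simp: space_PiM PiE_def extensional_def restrict_def fun_eq_iff)
  finally show ?case by (simp only: mix 1)
next
  case (insert i J)
  interpret product_sigma_finite "\<lambda>_::nat. gauss :: 'b measure" by standard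
  have sf: "sigma_finite_measure (Pi\<^sub>M J (\<lambda>_. gauss :: 'b measure))"
    by (rule sigma_finite) (use insert.hyps in auto)
  have F [measurable]: "F \<in> borel_measurable (Pi\<^sub>M (insert i J) (\<lambda>_. gauss))" by fact
  have pos: "0 < a i" "\<And>j. j \<in> J \<Longrightarrow> 0 < a j" using insert.prems by auto
  define A where "A = L2_set a J"
  define B where "B = L2_set a (insert i J)"
  have A: "0 < A" unfolding A_def using insert pos by (intro L2_set_pos) auto
  have B: "0 < B" unfolding B_def using insert pos by (intro L2_set_pos) auto
  have BA: "B\<^sup>2 = (a i)\<^sup>2 + A\<^sup>2" using insert by (simp add: A_def B_def)
  define c where "c = A / B"
  define s where "s = a i / B"
  have cs: "s\<^sup>2 + c\<^sup>2 = 1" "s \<noteq> 0" "c \<noteq> 0"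
    using A B BA pos by (auto simp: c_def s_def power_divide simp flip: add_divide_distrib)
  define M where "M v = (\<Sum>l\<in>J. (a l / A) *\<^sub>R v l)" for v :: "nat \<Rightarrow> 'b"
  have M_mix: "M (mix J a v \<eta>) = \<eta>" for v and \<eta> :: 'b
  proof -
    have "M (mix J a v \<eta>) = M v + (\<Sum>l\<in>J. (a l / A)\<^sup>2) *\<^sub>R (\<eta> - M v)"
      by (simp add: M_def mix_def A_def[symmetric] scaleR_add_right sum.distrib scaleR_sum_left power2_eq_square)
    also have "(\<Sum>l\<in>J. (a l / A)\<^sup>2) = (L2_set a J)\<^sup>2 / A\<^sup>2"
      by (simp add: power_divide L2_set_def sum_nonneg flip: sum_divide_distrib)
    finally show ?thesis using A by (simp add: A_def)
  qed
  have mix_insert: "mix (insert i J) a (v(i := y)) \<xi> =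
      (\<lambda>l\<in>J. v l + ((a l / A) * c) *\<^sub>R (\<xi> - c *\<^sub>R M v - s *\<^sub>R y))(i := y + s *\<^sub>R (\<xi> - c *\<^sub>R M v - s *\<^sub>R y))" for v and y \<xi> :: 'b
  proof -
    have "(\<Sum>l\<in>J. (a l / B) *\<^sub>R (v(i := y)) l) = c *\<^sub>R M v"
      unfolding M_def scaleR_sum_right using insert A by (intro sum.cong) (auto simp: c_def)
    then have "(\<Sum>l\<in>insert i J. (a l / B) *\<^sub>R (v(i := y)) l) = s *\<^sub>R y + c *\<^sub>R M v"
      using insert by (simp add: s_def)
    then show ?thesis
      using insert A unfolding mix_def B_def[symmetric]
      by (auto simp: fun_eq_iff c_def s_def diff_diff_eq add.commute)
  qed
  \<comment> \<open>If the entries in J have component \<eta>, the result depends on \<eta> and y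
    only through s \<eta> - c y, the coordinate orthogonal to the one that \<xi> replaces.\<close>
  have mix_mix: "mix (insert i J) a ((mix J a v \<eta>)(i := y)) \<xi> =
      (mix J a v (s *\<^sub>R (s *\<^sub>R \<eta> - c *\<^sub>R y) + c *\<^sub>R \<xi>))(i := s *\<^sub>R \<xi> - c *\<^sub>R (s *\<^sub>R \<eta> - c *\<^sub>R y))" for v and \<eta> y \<xi> :: 'b
  proof -
    have ss: "s * s = 1 - c * c" using cs by (simp add: power2_eq_square algebra_simps)
    have 1: "y + s *\<^sub>R (\<xi> - c *\<^sub>R \<eta> - s *\<^sub>R y) = s *\<^sub>R \<xi> - c *\<^sub>R (s *\<^sub>R \<eta> - c *\<^sub>R y)"
      by (simp add: algebra_simps ss)
    have 2: "s *\<^sub>R (s *\<^sub>R \<eta> - c *\<^sub>R y) + c *\<^sub>R \<xi> = \<eta> + c *\<^sub>R (\<xi> - c *\<^sub>R \<eta> - s *\<^sub>R y)"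
      by (simp add: algebra_simps ss)
    define W where "W = \<xi> - c *\<^sub>R \<eta> - s *\<^sub>R y"
    have "(\<lambda>l\<in>J. mix J a v \<eta> l + ((a l / A) * c) *\<^sub>R W) = mix J a v (\<eta> + c *\<^sub>R W)"
      by (auto simp: fun_eq_iff mix_def A_def[symmetric] algebra_simps)
    then show ?thesis
      using mix_insert[of "mix J a v \<eta>" y \<xi>] unfolding M_mix W_def[symmetric] 1[folded W_def] 2[folded W_def]
      by simp
  qed
  define \<Psi> where "\<Psi> \<eta> y = (\<integral>\<^sup>+v. F ((mix J a v \<eta>)(i := y)) \<partial>Pi\<^sub>M J (\<lambda>_. gauss))" for \<eta> y
  have m1 [measurable]: "(\<lambda>(v, \<eta>, y). F ((mix J a v \<eta>)(i := y))) \<in> borel_measurable (Pi\<^sub>M J (\<lambda>_. gauss) \<Otimes>\<^sub>M gauss \<Otimes>\<^sub>M gauss)"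
    unfolding case_prod_beta
    by (rule measurable_compose[OF _ F], rule measurable_fun_upd[of _ J]) (auto intro!: measurable_compose_rev[OF measurable_mix, unfolded case_prod_beta] )
  have "(\<lambda>((\<eta>, y), v). F ((mix J a v \<eta>)(i := y))) \<in> borel_measurable ((borel \<Otimes>\<^sub>M borel) \<Otimes>\<^sub>M Pi\<^sub>M J (\<lambda>_. gauss))"
    using measurable_compose[OF _ m1, of "\<lambda>((\<eta>, y), v). (v, \<eta>, y)" "(borel \<Otimes>\<^sub>M borel) \<Otimes>\<^sub>M Pi\<^sub>M J (\<lambda>_. gauss)"]
    by (simp add: case_prod_beta')
  then have [measurable]: "case_prod \<Psi> \<in> borel_measurable (borel \<Otimes>\<^sub>M borel)"
    unfolding \<Psi>_def case_prod_beta' by (intro sigma_finite_measure.borel_measurable_nn_integral[OF sf]) (simp add: case_prod_beta')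
  have [measurable]: "(\<lambda>(v, y, \<xi>). F (mix (insert i J) a (v(i := y)) \<xi>)) \<in> borel_measurable (Pi\<^sub>M J (\<lambda>_. gauss) \<Otimes>\<^sub>M gauss \<Otimes>\<^sub>M gauss)"
    unfolding case_prod_beta mix_insert
    by (rule measurable_compose[OF _ F], rule measurable_fun_upd[of _ J]) (auto simp: M_def)
  have "(\<integral>\<^sup>+\<xi>. \<integral>\<^sup>+v. F (mix (insert i J) a v \<xi>) \<partial>Pi\<^sub>M (insert i J) (\<lambda>_. gauss) \<partial>gauss)
      = (\<integral>\<^sup>+\<xi>. \<integral>\<^sup>+y. \<integral>\<^sup>+v. F (mix (insert i J) a (v(i := y)) \<xi>) \<partial>Pi\<^sub>M J (\<lambda>_. gauss) \<partial>gauss \<partial>gauss)"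
    using insert by (intro nn_integral_cong product_nn_integral_insert_rev) measurable
  also have "\<dots> = (\<integral>\<^sup>+\<xi>. \<integral>\<^sup>+y. \<integral>\<^sup>+\<eta>. \<integral>\<^sup>+v. F (mix (insert i J) a ((mix J a v \<eta>)(i := y)) \<xi>) \<partial>Pi\<^sub>M J (\<lambda>_. gauss) \<partial>gauss \<partial>gauss \<partial>gauss)"
    by (intro nn_integral_cong insert.IH[symmetric] pos) measurable
  also have "\<dots> = (\<integral>\<^sup>+\<xi>. \<integral>\<^sup>+y. \<integral>\<^sup>+\<eta>. \<Psi> (s *\<^sub>R (s *\<^sub>R \<eta> - c *\<^sub>R y) + c *\<^sub>R \<xi>) (s *\<^sub>R \<xi> - c *\<^sub>R (s *\<^sub>R \<eta> - c *\<^sub>R y)) \<partial>gauss \<partial>gauss \<partial>gauss)"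
    by (simp add: mix_mix \<Psi>_def)
  \<comment> \<open>One rotation turns s \<eta> - c y into a single Gaussian variable \<zeta>; the
    next one turns the pair of \<zeta> and \<xi> back into independent arguments of
    \<open>\<Psi>\<close>.\<close>
  also have "\<dots> = (\<integral>\<^sup>+\<xi>. \<integral>\<^sup>+\<zeta>. \<Psi> (s *\<^sub>R \<zeta> + c *\<^sub>R \<xi>) (s *\<^sub>R \<xi> - c *\<^sub>R \<zeta>) \<partial>gauss \<partial>gauss)"
  proof (rule nn_integral_cong)
    fix \<xi> :: 'b
    have "(\<integral>\<^sup>+y. \<integral>\<^sup>+\<eta>. (\<lambda>\<zeta> _. \<Psi> (s *\<^sub>R \<zeta> + c *\<^sub>R \<xi>) (s *\<^sub>R \<xi> - c *\<^sub>R \<zeta>)) (s *\<^sub>R \<eta> + (- c) *\<^sub>R y) (s *\<^sub>R y - (- c) *\<^sub>R \<eta>) \<partial>gauss \<partial>gauss)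
       = (\<integral>\<^sup>+\<zeta>. \<integral>\<^sup>+y. \<Psi> (s *\<^sub>R \<zeta> + c *\<^sub>R \<xi>) (s *\<^sub>R \<xi> - c *\<^sub>R \<zeta>) \<partial>(gauss :: 'b measure) \<partial>gauss)"
      by (rule nn_integral_gauss_rotation[where c = s and s = "- c" and
            F = "\<lambda>\<zeta> _. \<Psi> (s *\<^sub>R \<zeta> + c *\<^sub>R \<xi>) (s *\<^sub>R \<xi> - c *\<^sub>R \<zeta>)"])
        (use cs in auto)
    then show "(\<integral>\<^sup>+y. \<integral>\<^sup>+\<eta>. \<Psi> (s *\<^sub>R (s *\<^sub>R \<eta> - c *\<^sub>R y) + c *\<^sub>R \<xi>) (s *\<^sub>R \<xi> - c *\<^sub>R (s *\<^sub>R \<eta> - c *\<^sub>R y)) \<partial>gauss \<partial>gauss)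
       = (\<integral>\<^sup>+\<zeta>. \<Psi> (s *\<^sub>R \<zeta> + c *\<^sub>R \<xi>) (s *\<^sub>R \<xi> - c *\<^sub>R \<zeta>) \<partial>gauss)"
      using gauss.emeasure_space_1[where 'b = 'b] by simp
  qed
  also have "\<dots> = (\<integral>\<^sup>+\<eta>. \<integral>\<^sup>+y. \<Psi> \<eta> y \<partial>gauss \<partial>gauss)"
    by (rule nn_integral_gauss_rotation) (use cs in auto)
  also have "\<dots> = (\<integral>\<^sup>+y. \<integral>\<^sup>+\<eta>. \<Psi> \<eta> y \<partial>gauss \<partial>gauss)"
    by (rule gauss_Fubini[symmetric]) (measurable, standard)
  also have "\<dots> = (\<integral>\<^sup>+y. \<integral>\<^sup>+v. F (v(i := y)) \<partial>Pi\<^sub>M J (\<lambda>_. gauss) \<partial>gauss)"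
    unfolding \<Psi>_def by (intro nn_integral_cong insert.IH pos) measurable
  also have "\<dots> = (\<integral>\<^sup>+v. F v \<partial>Pi\<^sub>M (insert i J) (\<lambda>_. gauss))"
    using insert by (intro product_nn_integral_insert_rev[symmetric]) measurable
  finally show ?case .
qed

section \<open>One-dimensional marginals\<close>

abbreviation std_normal :: "real measure" where
  "std_normal \<equiv> density lborel (\<lambda>x. ennreal (std_normal_density x))"

lemma emeasure_gauss_box:
  assumes [measurable]: "\<And>b. b \<in> Basis \<Longrightarrow> A b \<in> sets borel"
  shows "emeasure gauss {x::'b::euclidean_space. \<forall>b\<in>Basis. x \<bullet> b \<in> A b} = (\<Prod>b\<in>(Basis::'b set). emeasure std_normal (A b))"
proof -
  have "emeasure gauss {x::'b. \<forall>b\<in>Basis. x \<bullet> b \<in> A b}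
      = (\<integral>\<^sup>+x. ennreal (gauss_density x) * indicator {x. \<forall>b\<in>Basis. x \<bullet> b \<in> A b} (x::'b) \<partial>lborel)"
    unfolding gauss_def by (rule emeasure_density) auto
  also have "\<dots> = (\<integral>\<^sup>+x. (\<Prod>b\<in>Basis. ennreal (std_normal_density ((x::'b) \<bullet> b)) * indicator (A b) (x \<bullet> b)) \<partial>lborel)"
  proof (intro nn_integral_cong)
    fix x :: 'b
    have "(\<Prod>b\<in>Basis. indicator (A b) (x \<bullet> b) :: ennreal) = indicator {x. \<forall>b\<in>Basis. x \<bullet> b \<in> A b} x"
      by (auto simp: indicator_def)
    then show "ennreal (gauss_density x) * indicator {x. \<forall>b\<in>Basis. x \<bullet> b \<in> A b} x
        = (\<Prod>b\<in>Basis. ennreal (std_normal_density (x \<bullet> b)) * indicator (A b) (x \<bullet> b))"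
      by (simp add: prod.distrib gauss_density_prod prod_ennreal)
  qed
  also have "\<dots> = (\<Prod>b\<in>(Basis::'b set). \<integral>\<^sup>+z. ennreal (std_normal_density z) * indicator (A b) z \<partial>lborel)"
    by (rule nn_integral_lborel_prod) auto
  also have "\<dots> = (\<Prod>b\<in>(Basis::'b set). emeasure std_normal (A b))"
    by (intro prod.cong) (auto simp: emeasure_density)
  finally show ?thesis .
qed

lemma distr_gauss_coordinates:
  "distr gauss (Pi\<^sub>M Basis (\<lambda>_. borel)) (\<lambda>x::'b::euclidean_space. \<lambda>b\<in>Basis. x \<bullet> b) = Pi\<^sub>M (Basis :: 'b set) (\<lambda>_. std_normal)"
proof -
  interpret N: prob_space std_normal by (rule prob_space_normal_density) simp
  interpret product_sigma_finite "\<lambda>_::'b. std_normal" by standard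
  show ?thesis
  proof (rule PiM_eqI)
    fix A :: "'b \<Rightarrow> real set" assume A: "\<And>b. b \<in> Basis \<Longrightarrow> A b \<in> sets std_normal"
    then have A': "\<And>b. b \<in> Basis \<Longrightarrow> A b \<in> sets borel" by simp
    have "emeasure (distr gauss (Pi\<^sub>M Basis (\<lambda>_. borel)) (\<lambda>x::'b. \<lambda>b\<in>Basis. x \<bullet> b)) (Pi\<^sub>E Basis A)
      = emeasure gauss ((\<lambda>x::'b. \<lambda>b\<in>Basis. x \<bullet> b) -` Pi\<^sub>E Basis A \<inter> space gauss)"
      using A' by (intro emeasure_distr sets_PiM_I_finite) auto
    also have "(\<lambda>x::'b. \<lambda>b\<in>Basis. x \<bullet> b) -` Pi\<^sub>E Basis A \<inter> space gauss = {x. \<forall>b\<in>Basis. x \<bullet> b \<in> A b}"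
      by (auto simp: PiE_iff)
    also have "emeasure gauss {x. \<forall>b\<in>Basis. x \<bullet> b \<in> A b} = (\<Prod>b\<in>Basis. emeasure std_normal (A b))"
      by (rule emeasure_gauss_box) (use A' in auto)
    finally show "emeasure (distr gauss (Pi\<^sub>M Basis (\<lambda>_. borel)) (\<lambda>x::'b. \<lambda>b\<in>Basis. x \<bullet> b)) (Pi\<^sub>E Basis A) = (\<Prod>b\<in>Basis. emeasure std_normal (A b))" .
  qed (auto intro!: sets_PiM_cong)
qed

lemma gauss_coordinates:
  shows distributed_gauss_coordinate: "b \<in> Basis \<Longrightarrow> distributed gauss lborel (\<lambda>x::'b::euclidean_space. x \<bullet> b) (\<lambda>x. ennreal (std_normal_density x))"
    and indep_gauss_coordinates: "gauss.indep_vars (\<lambda>_. borel) (\<lambda>b (x::'b). x \<bullet> b) Basis"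
proof -
  interpret N: prob_space std_normal by (rule prob_space_normal_density) simp
  have coord: "distr gauss borel (\<lambda>x::'b. x \<bullet> b) = std_normal" if b: "b \<in> Basis" for b
  proof -
    have "distr gauss borel (\<lambda>x::'b. x \<bullet> b) = distr (distr gauss (Pi\<^sub>M Basis (\<lambda>_. borel)) (\<lambda>x::'b. \<lambda>b\<in>Basis. x \<bullet> b)) borel (\<lambda>w. w b)"
      using b by (subst distr_distr) (auto simp: comp_def)
    also have "\<dots> = distr (Pi\<^sub>M (Basis :: 'b set) (\<lambda>_. std_normal)) std_normal (\<lambda>w. w b)"
      unfolding distr_gauss_coordinates by (rule distr_cong) auto
    also have "\<dots> = std_normal"
      using b by (intro distr_PiM_component N.prob_space_axioms)
    finally show ?thesis .
  qed
  show "distributed gauss lborel (\<lambda>x::'b. x \<bullet> b) (\<lambda>x. ennreal (std_normal_density x))" if "b \<in> Basis"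
    unfolding distributed_def using coord[OF that] by (auto cong: distr_cong)
  show "gauss.indep_vars (\<lambda>_. borel) (\<lambda>b (x::'b). x \<bullet> b) Basis"
    by (subst gauss.indep_vars_iff_distr_eq_PiM)
      (auto simp: distr_gauss_coordinates coord intro!: PiM_cong)
qed

lemma distributed_gauss_inner:
  fixes u :: "'b::euclidean_space"
  assumes u: "norm u = 1"
  shows "distributed gauss lborel (\<lambda>x. x \<bullet> u) (\<lambda>x. ennreal (std_normal_density x))"
proof -
  \<comment> \<open>A coordinate with coefficient 0 would contribute a normal variable of variance 0
    and is left out of the sum.\<close>
  define I where "I = {b \<in> (Basis :: 'b set). u \<bullet> b \<noteq> 0}"
  have "u \<noteq> 0" using u by auto
  then have I: "I \<noteq> {}" "finite I" "I \<subseteq> Basis"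
    using euclidean_all_zero_iff[of u] by (auto simp: I_def)
  have sumI: "(\<Sum>b\<in>I. f b * (u \<bullet> b)) = (\<Sum>b\<in>Basis. f b * (u \<bullet> b))" for f
    using I by (intro sum.mono_neutral_left) (auto simp: I_def)
  have ind: "gauss.indep_vars (\<lambda>_. borel) (\<lambda>b (x::'b). (\<lambda>z. 0 + (u \<bullet> b) * z) (x \<bullet> b)) I"
    by (rule gauss.indep_vars_compose2[OF gauss.indep_vars_subset[OF indep_gauss_coordinates I(3)]]) auto
  have dist: "distributed gauss lborel (\<lambda>x::'b. 0 + (u \<bullet> b) * (x \<bullet> b)) (\<lambda>x. ennreal (normal_density (0 + (u \<bullet> b) * 0) (\<bar>u \<bullet> b\<bar> * 1) x))"
    if "b \<in> I" for b
    using that by (intro gauss.normal_density_affine distributed_gauss_coordinate) (auto simp: I_def)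
  have "distributed gauss lborel (\<lambda>x. \<Sum>b\<in>I. 0 + (u \<bullet> b) * (x \<bullet> b))
      (\<lambda>x. ennreal (normal_density (\<Sum>b\<in>I. 0 + (u \<bullet> b) * 0) (sqrt (\<Sum>b\<in>I. (\<bar>u \<bullet> b\<bar> * 1)\<^sup>2)) x))"
    using I ind dist by (intro gauss.sum_indep_normal) (auto simp: I_def)
  moreover have "(\<Sum>b\<in>I. 0 + (u \<bullet> b) * (x \<bullet> b)) = x \<bullet> u" for x
    using sumI[of "\<lambda>b. x \<bullet> b"] by (simp add: euclidean_inner[of x u] mult.commute)
  moreover have "(\<Sum>b\<in>I. (\<bar>u \<bullet> b\<bar> * 1)\<^sup>2) = 1"
  proof -
    have "(\<Sum>b\<in>I. (\<bar>u \<bullet> b\<bar> * 1)\<^sup>2) = u \<bullet> u"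
      using sumI[of "\<lambda>b. u \<bullet> b"] by (simp add: euclidean_inner[of u u] power2_eq_square)
    then show ?thesis using u by (simp add: norm_eq_1)
  qed
  ultimately show ?thesis by simp
qed

lemma nn_integral_gauss_inner:
  fixes u :: "'b::euclidean_space"
  assumes "norm u = 1" and [measurable]: "f \<in> borel_measurable borel"
  shows "(\<integral>\<^sup>+x. f (x \<bullet> u) \<partial>gauss) = (\<integral>\<^sup>+z. ennreal (std_normal_density z) * f z \<partial>lborel)"
  using distributed_nn_integral[OF distributed_gauss_inner[OF assms(1)], of f] by simp

lemma nn_integral_std_normal_scale:
  assumes [measurable]: "f \<in> borel_measurable borel" and r: "0 < r"
  shows "(\<integral>\<^sup>+z. ennreal (std_normal_density z) * f (z / r) \<partial>lborel) =
    (\<integral>\<^sup>+t. ennreal (r * std_normal_density (r * t)) * f t \<partial>lborel)"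
proof -
  have "(\<integral>\<^sup>+z. ennreal (std_normal_density z) * f (z / r) \<partial>lborel) =
     ennreal \<bar>r\<bar> * (\<integral>\<^sup>+t. ennreal (std_normal_density (0 + r * t)) * f ((0 + r * t) / r) \<partial>lborel)"
    using r by (intro nn_integral_real_affine) auto
  also have "\<dots> = (\<integral>\<^sup>+t. ennreal r * (ennreal (std_normal_density (0 + r * t)) * f ((0 + r * t) / r)) \<partial>lborel)"
    using r by (subst nn_integral_cmult) auto
  also have "\<dots> = (\<integral>\<^sup>+t. ennreal (r * std_normal_density (r * t)) * f t \<partial>lborel)"
    using r by (intro nn_integral_cong) (simp add: ennreal_mult mult.assoc)
  finally show ?thesis .
qed

section \<open>The half-normal distribution\<close>

definition half_normal :: "real measure" where
  "half_normal = density lborel (\<lambda>x. ennreal (2 * std_normal_density x * indicator {0<..} x))"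

lemma sets_half_normal [simp, measurable_cong]: "sets half_normal = sets borel"
  and space_half_normal [simp]: "space half_normal = UNIV"
  by (simp_all add: half_normal_def)

lemma nn_integral_half_normal:
  "f \<in> borel_measurable borel \<Longrightarrow>
    (\<integral>\<^sup>+x. f x \<partial>half_normal) = (\<integral>\<^sup>+x. ennreal (2 * std_normal_density x) * f x * indicator {0<..} x \<partial>lborel)"
  unfolding half_normal_def
  by (subst nn_integral_density) (auto intro!: nn_integral_cong simp: indicator_def)

lemma AE_half_normal_pos: "AE x in half_normal. 0 < x"
  unfolding half_normal_def by (subst AE_density) (auto simp: indicator_def)

lemma prob_space_half_normal: "prob_space half_normal"
proof
  have refl: "(\<integral>\<^sup>+x. ennreal (std_normal_density x) * indicator {..<0} x \<partial>lborel) =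
      (\<integral>\<^sup>+x. ennreal (std_normal_density x) * indicator {0<..} x \<partial>lborel)"
    by (subst nn_integral_real_affine[where c = "- 1" and t = 0])
      (auto simp: indicator_def std_normal_density_def intro!: nn_integral_cong)
  have "1 = (\<integral>\<^sup>+x. ennreal (std_normal_density x) \<partial>lborel)" by (rule nn_integral_std_normal_density[symmetric])
  also have "\<dots> = (\<integral>\<^sup>+x. ennreal (std_normal_density x) * indicator {0<..} x + ennreal (std_normal_density x) * indicator {..<0} x \<partial>lborel)"
    by (intro nn_integral_cong_AE eventually_mono[OF AE_lborel_singleton[of 0]]) (auto simp: indicator_def)
  also have "\<dots> = (\<integral>\<^sup>+x. ennreal (std_normal_density x) * indicator {0<..} x \<partial>lborel) + (\<integral>\<^sup>+x. ennreal (std_normal_density x) * indicator {0<..} x \<partial>lborel)"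
    by (subst nn_integral_add) (auto simp: refl)
  also have "\<dots> = 2 * (\<integral>\<^sup>+x. ennreal (std_normal_density x) * indicator {0<..} x \<partial>lborel)"
    by (simp add: mult_2)
  also have "\<dots> = (\<integral>\<^sup>+x. 2 * (ennreal (std_normal_density x) * indicator {0<..} x) \<partial>lborel)"
    by (rule nn_integral_cmult[symmetric]) auto
  also have "\<dots> = emeasure half_normal (space half_normal)"
    unfolding half_normal_def by (subst emeasure_density) (auto intro!: nn_integral_cong simp: indicator_def ennreal_mult')
  finally show "emeasure half_normal (space half_normal) = 1" by simp
qed

interpretation half_normal: prob_space half_normal by (rule prob_space_half_normal)

text \<open>The weight changes the exponent x^2 of the density into (1 + t^2) x^2, which amounts to
  a rescaling of x.\<close>

lemma half_normal_scale:
  assumes [measurable]: "f \<in> borel_measurable borel"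
  shows "(\<integral>\<^sup>+x. f x * ennreal (exp (- (t\<^sup>2 * x\<^sup>2 / 2))) \<partial>half_normal) =
    ennreal (1 / sqrt (1 + t\<^sup>2)) * (\<integral>\<^sup>+x. f (x / sqrt (1 + t\<^sup>2)) \<partial>half_normal)"
proof -
  define r where "r = sqrt (1 + t\<^sup>2)"
  have r: "0 < r" "r\<^sup>2 = 1 + t\<^sup>2" by (auto simp: r_def add_pos_nonneg)
  have "(\<integral>\<^sup>+x. f x * ennreal (exp (- (t\<^sup>2 * x\<^sup>2 / 2))) \<partial>half_normal)
     = (\<integral>\<^sup>+x. ennreal (2 * std_normal_density x) * (f x * ennreal (exp (- (t\<^sup>2 * x\<^sup>2 / 2)))) * indicator {0<..} x \<partial>lborel)"
    by (rule nn_integral_half_normal) measurable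
  also have "\<dots> = ennreal (1 / r) * (\<integral>\<^sup>+x. ennreal (2 * std_normal_density (0 + 1 / r * x)) * (f (0 + 1 / r * x) * ennreal (exp (- (t\<^sup>2 * (0 + 1 / r * x)\<^sup>2 / 2)))) * indicator {0<..} (0 + 1 / r * x) \<partial>lborel)"
    using r by (subst nn_integral_real_affine[where c = "1 / r" and t = 0]) auto
  also have "(\<integral>\<^sup>+x. ennreal (2 * std_normal_density (0 + 1 / r * x)) * (f (0 + 1 / r * x) * ennreal (exp (- (t\<^sup>2 * (0 + 1 / r * x)\<^sup>2 / 2)))) * indicator {0<..} (0 + 1 / r * x) \<partial>lborel)
     = (\<integral>\<^sup>+x. ennreal (2 * std_normal_density x) * f (x / r) * indicator {0<..} x \<partial>lborel)"
  proof (intro nn_integral_cong)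
    fix x :: real
    have "x\<^sup>2 / r\<^sup>2 + t\<^sup>2 * (x\<^sup>2 / r\<^sup>2) = x\<^sup>2 * (1 + t\<^sup>2) / r\<^sup>2" by (simp add: add_divide_distrib algebra_simps)
    also have "\<dots> = x\<^sup>2" using r by (simp add: add_pos_nonneg flip: r(2))
    finally have "x\<^sup>2 / r\<^sup>2 + t\<^sup>2 * (x\<^sup>2 / r\<^sup>2) = x\<^sup>2" .
    then have e: "- ((x / r)\<^sup>2 / 2) - t\<^sup>2 * (x / r)\<^sup>2 / 2 = - (x\<^sup>2 / 2)" 
    proof -
      have "(x / r)\<^sup>2 + t\<^sup>2 * (x / r)\<^sup>2 = x\<^sup>2" using \<open>x\<^sup>2 / r\<^sup>2 + t\<^sup>2 * (x\<^sup>2 / r\<^sup>2) = x\<^sup>2\<close> by (simp only: power_divide)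
      then show ?thesis by linarith
    qed
    have "std_normal_density (x / r) * exp (- (t\<^sup>2 * (x / r)\<^sup>2 / 2)) = std_normal_density x"
      by (simp add: std_normal_density_def e flip: exp_add)
    then have "ennreal (2 * std_normal_density (x / r)) * ennreal (exp (- (t\<^sup>2 * (x / r)\<^sup>2 / 2))) = ennreal (2 * std_normal_density x)"
      by (simp flip: ennreal_mult)
    then show "ennreal (2 * std_normal_density (0 + 1 / r * x)) * (f (0 + 1 / r * x) * ennreal (exp (- (t\<^sup>2 * (0 + 1 / r * x)\<^sup>2 / 2)))) * indicator {0<..} (0 + 1 / r * x)
      = ennreal (2 * std_normal_density x) * f (x / r) * indicator {0<..} x"
      using r by (simp add: indicator_def zero_less_divide_iff mult_ac)
  qed
  also have "\<dots> = (\<integral>\<^sup>+x. f (x / r) \<partial>half_normal)"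
    by (rule nn_integral_half_normal[symmetric]) measurable
  finally show ?thesis by (simp add: r_def)
qed

text \<open>Every coordinate contributes a factor 1/sqrt(1 + t^2). These factors become powers of
  sin in \<open>nn_integral_arctan_power\<close>.\<close>

lemma half_normal_PiM_scale:
  fixes F :: "(nat \<Rightarrow> real) \<Rightarrow> ennreal"
  assumes "finite J" "F \<in> borel_measurable (Pi\<^sub>M J (\<lambda>_. half_normal))"
  shows "(\<integral>\<^sup>+a. F a * ennreal (exp (- (t\<^sup>2 * (\<Sum>i\<in>J. (a i)\<^sup>2) / 2))) \<partial>Pi\<^sub>M J (\<lambda>_. half_normal)) =
    ennreal ((1 / sqrt (1 + t\<^sup>2)) ^ card J) * (\<integral>\<^sup>+a. F (\<lambda>i\<in>J. a i / sqrt (1 + t\<^sup>2)) \<partial>Pi\<^sub>M J (\<lambda>_. half_normal))"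
  using assms
proof (induction J arbitrary: F rule: finite_induct)
  case empty
  then show ?case by (simp add: PiM_empty nn_integral_count_space_finite restrict_def)
next
  case (insert i J)
  interpret product_sigma_finite "\<lambda>_::nat. half_normal" by standard
  have F [measurable]: "F \<in> borel_measurable (Pi\<^sub>M (insert i J) (\<lambda>_. half_normal))" by fact
  define r where "r = sqrt (1 + t\<^sup>2)"
  have [measurable]: "(\<lambda>(a, y). F (a(i := y))) \<in> borel_measurable (Pi\<^sub>M J (\<lambda>_. half_normal) \<Otimes>\<^sub>M half_normal)"
    unfolding case_prod_beta by (rule measurable_compose[OF _ F], rule measurable_fun_upd[of _ J]) auto
  interpret PJ: sigma_finite_measure "Pi\<^sub>M J (\<lambda>_::nat. half_normal)"
    using insert.hyps by (intro sigma_finite) auto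
  interpret pair_sigma_finite "Pi\<^sub>M J (\<lambda>_::nat. half_normal)" half_normal by standard
  have "(\<integral>\<^sup>+a. F a * ennreal (exp (- (t\<^sup>2 * (\<Sum>i\<in>insert i J. (a i)\<^sup>2) / 2))) \<partial>Pi\<^sub>M (insert i J) (\<lambda>_. half_normal))
     = (\<integral>\<^sup>+y. \<integral>\<^sup>+a. F (a(i := y)) * ennreal (exp (- (t\<^sup>2 * (\<Sum>l\<in>insert i J. ((a(i := y)) l)\<^sup>2) / 2))) \<partial>Pi\<^sub>M J (\<lambda>_. half_normal) \<partial>half_normal)"
    using insert.hyps by (intro product_nn_integral_insert_rev) measurable
  also have "\<dots> = (\<integral>\<^sup>+y. (\<integral>\<^sup>+a. F (a(i := y)) * ennreal (exp (- (t\<^sup>2 * (\<Sum>l\<in>J. (a l)\<^sup>2) / 2))) \<partial>Pi\<^sub>M J (\<lambda>_. half_normal)) * ennreal (exp (- (t\<^sup>2 * y\<^sup>2 / 2))) \<partial>half_normal)"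
  proof (intro nn_integral_cong)
    fix y :: real
    have "(\<Sum>l\<in>J. ((a(i := y)) l)\<^sup>2) = (\<Sum>l\<in>J. (a l)\<^sup>2)" for a
      using insert.hyps by (intro sum.cong) auto
    then have s: "(\<Sum>l\<in>insert i J. ((a(i := y)) l)\<^sup>2) = y\<^sup>2 + (\<Sum>l\<in>J. (a l)\<^sup>2)" for a
      using insert.hyps by simp
    have e: "ennreal (exp (- (t\<^sup>2 * (y\<^sup>2 + S) / 2))) = ennreal (exp (- (t\<^sup>2 * S / 2))) * ennreal (exp (- (t\<^sup>2 * y\<^sup>2 / 2)))" for S
      by (simp add: exp_add[symmetric] algebra_simps add_divide_distrib flip: ennreal_mult)
    have "(\<integral>\<^sup>+a. F (a(i := y)) * ennreal (exp (- (t\<^sup>2 * (\<Sum>l\<in>insert i J. ((a(i := y)) l)\<^sup>2) / 2))) \<partial>Pi\<^sub>M J (\<lambda>_. half_normal)) =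
      (\<integral>\<^sup>+a. (F (a(i := y)) * ennreal (exp (- (t\<^sup>2 * (\<Sum>l\<in>J. (a l)\<^sup>2) / 2)))) * ennreal (exp (- (t\<^sup>2 * y\<^sup>2 / 2))) \<partial>Pi\<^sub>M J (\<lambda>_. half_normal))"
      unfolding s e by (simp add: mult.assoc)
    also have "\<dots> = (\<integral>\<^sup>+a. F (a(i := y)) * ennreal (exp (- (t\<^sup>2 * (\<Sum>l\<in>J. (a l)\<^sup>2) / 2))) \<partial>Pi\<^sub>M J (\<lambda>_. half_normal)) * ennreal (exp (- (t\<^sup>2 * y\<^sup>2 / 2)))"
      by (rule nn_integral_multc) measurable
    finally show "(\<integral>\<^sup>+a. F (a(i := y)) * ennreal (exp (- (t\<^sup>2 * (\<Sum>l\<in>insert i J. ((a(i := y)) l)\<^sup>2) / 2))) \<partial>Pi\<^sub>M J (\<lambda>_. half_normal)) =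
      (\<integral>\<^sup>+a. F (a(i := y)) * ennreal (exp (- (t\<^sup>2 * (\<Sum>l\<in>J. (a l)\<^sup>2) / 2))) \<partial>Pi\<^sub>M J (\<lambda>_. half_normal)) * ennreal (exp (- (t\<^sup>2 * y\<^sup>2 / 2)))" .
  qed
  also have "\<dots> = (\<integral>\<^sup>+y. (ennreal ((1 / r) ^ card J) * (\<integral>\<^sup>+a. F ((\<lambda>i\<in>J. a i / r)(i := y)) \<partial>Pi\<^sub>M J (\<lambda>_. half_normal))) * ennreal (exp (- (t\<^sup>2 * y\<^sup>2 / 2))) \<partial>half_normal)"
    unfolding r_def by (intro nn_integral_cong arg_cong2[where f = times] insert.IH refl) measurable
  also have "\<dots> = ennreal (1 / r) * (\<integral>\<^sup>+y. ennreal ((1 / r) ^ card J) * (\<integral>\<^sup>+a. F ((\<lambda>i\<in>J. a i / r)(i := y / r)) \<partial>Pi\<^sub>M J (\<lambda>_. half_normal)) \<partial>half_normal)"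
  proof -
    have "(\<lambda>(y, a). F ((\<lambda>i\<in>J. a i / r)(i := y))) \<in> borel_measurable (borel \<Otimes>\<^sub>M Pi\<^sub>M J (\<lambda>_. half_normal))"
      unfolding case_prod_beta by (rule measurable_compose[OF _ F], rule measurable_fun_upd[of _ J]) auto
    then have [measurable]: "(\<lambda>y. \<integral>\<^sup>+a. F ((\<lambda>i\<in>J. a i / r)(i := y)) \<partial>Pi\<^sub>M J (\<lambda>_. half_normal)) \<in> borel_measurable borel"
      by (rule PJ.borel_measurable_nn_integral)
    show ?thesis unfolding r_def by (rule half_normal_scale) (unfold r_def[symmetric], measurable)
  qed
  also have "\<dots> = ennreal (1 / r) * (ennreal ((1 / r) ^ card J) * (\<integral>\<^sup>+y. (\<integral>\<^sup>+a. F ((\<lambda>i\<in>J. a i / r)(i := y / r)) \<partial>Pi\<^sub>M J (\<lambda>_. half_normal)) \<partial>half_normal))"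
  proof -
    have "(\<lambda>(y, a). F ((\<lambda>i\<in>J. a i / r)(i := y / r))) \<in> borel_measurable (half_normal \<Otimes>\<^sub>M Pi\<^sub>M J (\<lambda>_. half_normal))"
      unfolding case_prod_beta by (rule measurable_compose[OF _ F], rule measurable_fun_upd[of _ J]) auto
    then have [measurable]: "(\<lambda>y. \<integral>\<^sup>+a. F ((\<lambda>i\<in>J. a i / r)(i := y / r)) \<partial>Pi\<^sub>M J (\<lambda>_. half_normal)) \<in> borel_measurable half_normal"
      by (rule PJ.borel_measurable_nn_integral)
    show ?thesis by (subst nn_integral_cmult) auto
  qed
  also have "\<dots> = ennreal ((1 / r) ^ card (insert i J)) * (\<integral>\<^sup>+y. (\<integral>\<^sup>+a. F (\<lambda>l\<in>insert i J. (a(i := y)) l / r) \<partial>Pi\<^sub>M J (\<lambda>_. half_normal)) \<partial>half_normal)"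
  proof -
    have "(\<lambda>i\<in>J. a i / r)(i := y / r) = (\<lambda>l\<in>insert i J. (a(i := y)) l / r)" for a y
      using insert.hyps by (auto simp: fun_eq_iff restrict_def)
    moreover have "ennreal (1 / r) * (ennreal ((1 / r) ^ card J) * X) = ennreal ((1 / r) ^ card (insert i J)) * X" for X
      using insert.hyps by (simp add: r_def flip: mult.assoc ennreal_mult)
    ultimately show ?thesis by simp
  qed
  also have "(\<integral>\<^sup>+y. (\<integral>\<^sup>+a. F (\<lambda>l\<in>insert i J. (a(i := y)) l / r) \<partial>Pi\<^sub>M J (\<lambda>_. half_normal)) \<partial>half_normal)
      = (\<integral>\<^sup>+a. F (\<lambda>l\<in>insert i J. a l / r) \<partial>Pi\<^sub>M (insert i J) (\<lambda>_. half_normal))"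
    using insert.hyps by (intro product_nn_integral_insert_rev[symmetric] measurable_compose[OF _ F]) measurable
  finally show ?case by (simp only: r_def)
qed

lemma nn_integral_times_exp_square:
  assumes s: "0 < s"
  shows "(\<integral>\<^sup>+a. ennreal (a * exp (- (s * a\<^sup>2 / 2))) * indicator {0..} a \<partial>lborel) = ennreal (1 / s)"
proof -
  have "(\<integral>\<^sup>+a. ennreal (a * exp (- (s * a\<^sup>2 / 2))) * indicator {0..} a \<partial>lborel) = ennreal (0 - (- (exp (- (s * 0\<^sup>2 / 2)) / s)))"
  proof (rule nn_integral_FTC_atLeast)
    fix a :: real
    show "((\<lambda>a. - (exp (- (s * a\<^sup>2 / 2)) / s)) has_real_derivative a * exp (- (s * a\<^sup>2 / 2))) (at a)"
      using s by (auto intro!: derivative_eq_intros)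
    show "((\<lambda>a. - (exp (- (s * a\<^sup>2 / 2)) / s)) \<longlongrightarrow> 0) at_top"
      using s by real_asymp
  qed auto
  then show ?thesis by simp
qed

lemma nn_integral_cauchy_tail:
  "(\<integral>\<^sup>+t. ennreal (1 / (pi * (1 + t\<^sup>2))) * indicator {c<..} t \<partial>lborel) = ennreal (1 / 2 - arctan c / pi)"
proof -
  have "(\<integral>\<^sup>+t. ennreal (1 / (pi * (1 + t\<^sup>2))) * indicator {c<..} t \<partial>lborel) = (\<integral>\<^sup>+t. ennreal (1 / (pi * (1 + t\<^sup>2))) * indicator {c..} t \<partial>lborel)"
    by (intro nn_integral_cong_AE eventually_mono[OF AE_lborel_singleton[of c]]) (auto simp: indicator_def)
  also have "\<dots> = ennreal (1 / 2 - arctan c / pi)"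
  proof (rule nn_integral_FTC_atLeast)
    fix t :: real
    show "((\<lambda>t. arctan t / pi) has_real_derivative 1 / (pi * (1 + t\<^sup>2))) (at t)"
      by (rule DERIV_cong[OF DERIV_cdivide[OF DERIV_arctan]]) (simp add: divide_inverse mult.commute)
    have "((\<lambda>t. arctan t / pi) \<longlongrightarrow> (pi / 2) / pi) at_top"
      by (intro tendsto_divide tendsto_arctan_at_top tendsto_const) simp
    then show "((\<lambda>t. arctan t / pi) \<longlongrightarrow> 1 / 2) at_top" by simp
  qed (auto simp: add_nonneg_nonneg)
  finally show ?thesis .
qed

text \<open>With the unit vector u along y' and q = y_0/|y'|, the condition on a row (a, v) reads
  (v.u)/a > -q. The quotient of a standard normal and an independent half-normal variable is Cauchy
  distributed, whence the arctan.\<close>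

lemma emeasure_open_half_space:
  fixes y' :: "'b::euclidean_space"
  assumes y': "y' \<noteq> 0"
  shows "emeasure (half_normal \<Otimes>\<^sub>M gauss) {x. 0 < x \<bullet> (y0, y')} = ennreal (1 / 2 + arctan (y0 / norm y') / pi)"
proof -
  define q where "q = y0 / norm y'"
  define u where "u = y' /\<^sub>R norm y'"
  have u: "norm u = 1" "y' = norm y' *\<^sub>R u" using y' by (auto simp: u_def)
  have n: "0 < norm y'" using y' by simp
  have set: "{x :: real \<times> 'b. 0 < x \<bullet> (y0, y')} \<in> sets (half_normal \<Otimes>\<^sub>M gauss)"
  proof -
    have "{x :: real \<times> 'b. 0 < x \<bullet> (y0, y')} \<in> sets borel" by measurable
    moreover have "sets (half_normal \<Otimes>\<^sub>M (gauss :: 'b measure)) = sets (borel \<Otimes>\<^sub>M borel)"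
      by (rule sets_pair_measure_cong) simp_all
    ultimately show ?thesis by (simp only: borel_prod)
  qed
  have slice: "emeasure gauss (Pair a -` {x :: real \<times> 'b. 0 < x \<bullet> (y0, y')}) = (\<integral>\<^sup>+t. ennreal (a * std_normal_density (a * t)) * indicator {-q<..} t \<partial>lborel)"
    if a: "0 < a" for a
  proof -
    have mem: "0 < (a, v) \<bullet> (y0, y') \<longleftrightarrow> - q < (v \<bullet> u) / a" for v
    proof -
      have "(a, v) \<bullet> (y0, y') = norm y' * (a * (q + (v \<bullet> u) / a))"
        using a n by (subst u(2)) (simp add: q_def field_simps)
      then have "0 < (a, v) \<bullet> (y0, y') \<longleftrightarrow> 0 < q + (v \<bullet> u) / a" using a n by (simp only: zero_less_mult_iff) auto
      then show ?thesis by linarith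
    qed
    have [measurable]: "Pair a -` {x :: real \<times> 'b. 0 < x \<bullet> (y0, y')} \<in> sets gauss"
      using set by (rule sets_Pair1)
    have "emeasure gauss (Pair a -` {x :: real \<times> 'b. 0 < x \<bullet> (y0, y')}) = (\<integral>\<^sup>+v. indicator (Pair a -` {x :: real \<times> 'b. 0 < x \<bullet> (y0, y')}) v \<partial>gauss)"
      by simp
    also have "\<dots> = (\<integral>\<^sup>+v. indicator {-q<..} ((v \<bullet> u) / a) \<partial>gauss)"
      by (intro nn_integral_cong) (simp add: indicator_def mem del: inner_Pair)
    also have "\<dots> = (\<integral>\<^sup>+z. ennreal (std_normal_density z) * indicator {-q<..} (z / a) \<partial>lborel)"
      by (rule nn_integral_gauss_inner[OF u(1)]) measurable
    also have "\<dots> = (\<integral>\<^sup>+t. ennreal (a * std_normal_density (a * t)) * indicator {-q<..} t \<partial>lborel)"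
      by (rule nn_integral_std_normal_scale[OF _ a]) measurable
    finally show ?thesis .
  qed
  have "emeasure (half_normal \<Otimes>\<^sub>M gauss) {x :: real \<times> 'b. 0 < x \<bullet> (y0, y')}
     = (\<integral>\<^sup>+a. emeasure gauss (Pair a -` {x :: real \<times> 'b. 0 < x \<bullet> (y0, y')}) \<partial>half_normal)"
    by (rule gauss.emeasure_pair_measure_alt[OF set])
  also have "\<dots> = (\<integral>\<^sup>+a. (\<integral>\<^sup>+t. ennreal (a * std_normal_density (a * t)) * indicator {-q<..} t \<partial>lborel) \<partial>half_normal)"
    by (intro nn_integral_cong_AE eventually_mono[OF AE_half_normal_pos]) (rule slice)
  also have "\<dots> = (\<integral>\<^sup>+a. ennreal (2 * std_normal_density a) * (\<integral>\<^sup>+t. ennreal (a * std_normal_density (a * t)) * indicator {-q<..} t \<partial>lborel) * indicator {0<..} a \<partial>lborel)"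
    by (rule nn_integral_half_normal) measurable
  also have "\<dots> = (\<integral>\<^sup>+a. (\<integral>\<^sup>+t. ennreal (2 * std_normal_density a) * (ennreal (a * std_normal_density (a * t)) * indicator {-q<..} t) * indicator {0<..} a \<partial>lborel) \<partial>lborel)"
    by (simp add: nn_integral_cmult nn_integral_multc)
  also have "\<dots> = (\<integral>\<^sup>+t. (\<integral>\<^sup>+a. ennreal (2 * std_normal_density a) * (ennreal (a * std_normal_density (a * t)) * indicator {-q<..} t) * indicator {0<..} a \<partial>lborel) \<partial>lborel)"
    by (rule lborel_pair.Fubini') measurable
  also have "\<dots> = (\<integral>\<^sup>+t. ennreal (1 / (pi * (1 + t\<^sup>2))) * indicator {-q<..} t \<partial>lborel)"
  proof (rule nn_integral_cong)
    fix t :: real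
    have pos: "0 < 1 + t\<^sup>2" by (simp add: add_pos_nonneg)
    have "2 * std_normal_density a * (a * std_normal_density (a * t)) = 1 / pi * (a * exp (- ((1 + t\<^sup>2) * a\<^sup>2 / 2)))" for a
    proof -
      have "sqrt (2 * pi) * sqrt (2 * pi) = 2 * pi" by simp
      moreover have "exp (- (a\<^sup>2 / 2)) * exp (- ((a * t)\<^sup>2 / 2)) = exp (- ((1 + t\<^sup>2) * a\<^sup>2 / 2))"
        by (simp add: power_mult_distrib algebra_simps add_divide_distrib flip: exp_add)
      ultimately show ?thesis by (simp add: std_normal_density_def field_simps)
    qed
    then have "(\<integral>\<^sup>+a. ennreal (2 * std_normal_density a) * (ennreal (a * std_normal_density (a * t)) * indicator {-q<..} t) * indicator {0<..} a \<partial>lborel)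
      = (\<integral>\<^sup>+a. ennreal (1 / pi) * indicator {-q<..} t * (ennreal (a * exp (- ((1 + t\<^sup>2) * a\<^sup>2 / 2))) * indicator {0..} a) \<partial>lborel)"
      by (intro nn_integral_cong_AE eventually_mono[OF AE_lborel_singleton[of 0]])
        (auto simp: indicator_def simp flip: ennreal_mult')
    also have "\<dots> = ennreal (1 / pi) * indicator {-q<..} t * (\<integral>\<^sup>+a. (ennreal (a * exp (- ((1 + t\<^sup>2) * a\<^sup>2 / 2))) * indicator {0..} a) \<partial>lborel)"
      by (rule nn_integral_cmult) measurable
    also have "\<dots> = ennreal (1 / (pi * (1 + t\<^sup>2))) * indicator {-q<..} t"
      unfolding nn_integral_times_exp_square[OF pos] using pos by (simp add: indicator_def flip: ennreal_mult')
    finally show "(\<integral>\<^sup>+a. ennreal (2 * std_normal_density a) * (ennreal (a * std_normal_density (a * t)) * indicator {-q<..} t) * indicator {0<..} a \<partial>lborel)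
      = ennreal (1 / (pi * (1 + t\<^sup>2))) * indicator {-q<..} t" .
  qed
  also have "\<dots> = ennreal (1 / 2 - arctan (- q) / pi)" by (rule nn_integral_cauchy_tail)
  finally show ?thesis by (simp add: q_def arctan_minus)
qed

section \<open>Separation of the constant from the integral over the resampled quotient\<close>

lemma nn_integral_PiM_pair:
  fixes M :: "'a measure" and N :: "'c measure"
  assumes "sigma_finite_measure M" "sigma_finite_measure N"
    and "finite J" "f \<in> borel_measurable (Pi\<^sub>M J (\<lambda>_::nat. M \<Otimes>\<^sub>M N))"
  shows "(\<integral>\<^sup>+x. f x \<partial>Pi\<^sub>M J (\<lambda>_. M \<Otimes>\<^sub>M N)) = (\<integral>\<^sup>+a. \<integral>\<^sup>+v. f (\<lambda>i\<in>J. (a i, v i)) \<partial>Pi\<^sub>M J (\<lambda>_. N) \<partial>Pi\<^sub>M J (\<lambda>_. M))"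
  using assms(3,4)
proof (induction J arbitrary: f rule: finite_induct)
  case empty
  then show ?case by (simp add: PiM_empty nn_integral_count_space_finite restrict_def)
next
  case (insert i J)
  interpret M: sigma_finite_measure M by fact
  interpret N: sigma_finite_measure N by fact
  interpret pM: product_sigma_finite "\<lambda>_::nat. M" by standard
  interpret pN: product_sigma_finite "\<lambda>_::nat. N" by standard
  interpret MN: pair_sigma_finite M N by standard
  interpret pMN: product_sigma_finite "\<lambda>_::nat. M \<Otimes>\<^sub>M N" by standard
  have sM: "sigma_finite_measure (Pi\<^sub>M J (\<lambda>_. M))" by (rule pM.sigma_finite) (rule insert.hyps)
  have sN: "sigma_finite_measure (Pi\<^sub>M J (\<lambda>_. N))" by (rule pN.sigma_finite) (rule insert.hyps)
  interpret PM: sigma_finite_measure "Pi\<^sub>M J (\<lambda>_. M)" by (rule sM)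
  interpret PN: sigma_finite_measure "Pi\<^sub>M J (\<lambda>_. N)" by (rule sN)
  interpret P: pair_sigma_finite "Pi\<^sub>M J (\<lambda>_. M)" N by standard
  have f [measurable]: "f \<in> borel_measurable (Pi\<^sub>M (insert i J) (\<lambda>_. M \<Otimes>\<^sub>M N))" by fact
  have m [measurable]: "(\<lambda>(a, v, s, t). f ((\<lambda>i\<in>J. (a i, v i))(i := (s, t)))) \<in> borel_measurable (Pi\<^sub>M J (\<lambda>_. M) \<Otimes>\<^sub>M Pi\<^sub>M J (\<lambda>_. N) \<Otimes>\<^sub>M M \<Otimes>\<^sub>M N)"
    unfolding case_prod_beta by (rule measurable_compose[OF _ f], rule measurable_fun_upd[of _ J]) auto
  have upd: "(\<lambda>l\<in>insert i J. ((a(i := s)) l, (v(i := t)) l)) = (\<lambda>i\<in>J. (a i, v i))(i := (s, t))" for a :: "nat \<Rightarrow> 'a" and v :: "nat \<Rightarrow> 'c" and s t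
    using insert.hyps by (auto simp: fun_eq_iff restrict_def)
  have "(\<integral>\<^sup>+x. f x \<partial>Pi\<^sub>M (insert i J) (\<lambda>_. M \<Otimes>\<^sub>M N)) = (\<integral>\<^sup>+p. \<integral>\<^sup>+x. f (x(i := p)) \<partial>Pi\<^sub>M J (\<lambda>_. M \<Otimes>\<^sub>M N) \<partial>(M \<Otimes>\<^sub>M N))"
    using insert.hyps by (intro pMN.product_nn_integral_insert_rev) auto
  also have "\<dots> = (\<integral>\<^sup>+p. \<integral>\<^sup>+a. \<integral>\<^sup>+v. f ((\<lambda>i\<in>J. (a i, v i))(i := p)) \<partial>Pi\<^sub>M J (\<lambda>_. N) \<partial>Pi\<^sub>M J (\<lambda>_. M) \<partial>(M \<Otimes>\<^sub>M N))"
    by (intro nn_integral_cong insert.IH) measurable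
  also have "\<dots> = (\<integral>\<^sup>+s. \<integral>\<^sup>+t. \<integral>\<^sup>+a. \<integral>\<^sup>+v. f ((\<lambda>i\<in>J. (a i, v i))(i := (s, t))) \<partial>Pi\<^sub>M J (\<lambda>_. N) \<partial>Pi\<^sub>M J (\<lambda>_. M) \<partial>N \<partial>M)"
    by (rule N.nn_integral_fst[symmetric]) measurable
  also have "\<dots> = (\<integral>\<^sup>+s. \<integral>\<^sup>+a. \<integral>\<^sup>+t. \<integral>\<^sup>+v. f ((\<lambda>i\<in>J. (a i, v i))(i := (s, t))) \<partial>Pi\<^sub>M J (\<lambda>_. N) \<partial>N \<partial>Pi\<^sub>M J (\<lambda>_. M) \<partial>M)"
    by (intro nn_integral_cong P.Fubini') measurable
  also have "\<dots> = (\<integral>\<^sup>+s. \<integral>\<^sup>+a. \<integral>\<^sup>+v. f (\<lambda>l\<in>insert i J. ((a(i := s)) l, v l)) \<partial>Pi\<^sub>M (insert i J) (\<lambda>_. N) \<partial>Pi\<^sub>M J (\<lambda>_. M) \<partial>M)"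
  proof (rule nn_integral_cong, rule nn_integral_cong)
    fix s a assume [measurable]: "s \<in> space M" "a \<in> space (Pi\<^sub>M J (\<lambda>_. M))"
    have [measurable]: "a \<in> space (Pi\<^sub>M J (\<lambda>_. M)) \<Longrightarrow> j \<in> J \<Longrightarrow> a j \<in> space M" for j by (auto simp: space_PiM)
    have [measurable]: "(\<lambda>v. f (\<lambda>l\<in>insert i J. ((a(i := s)) l, v l))) \<in> borel_measurable (Pi\<^sub>M (insert i J) (\<lambda>_. N))"
      by (rule measurable_compose[OF _ f]) (auto intro!: measurable_restrict measurable_Pair simp: space_PiM)
    show "(\<integral>\<^sup>+t. \<integral>\<^sup>+v. f ((\<lambda>i\<in>J. (a i, v i))(i := (s, t))) \<partial>Pi\<^sub>M J (\<lambda>_. N) \<partial>N) = (\<integral>\<^sup>+v. f (\<lambda>l\<in>insert i J. ((a(i := s)) l, v l)) \<partial>Pi\<^sub>M (insert i J) (\<lambda>_. N))"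
      unfolding upd[symmetric]
      by (rule pN.product_nn_integral_insert_rev[symmetric]; fact)
  qed
  also have "\<dots> = (\<integral>\<^sup>+a. \<integral>\<^sup>+v. f (\<lambda>l\<in>insert i J. (a l, v l)) \<partial>Pi\<^sub>M (insert i J) (\<lambda>_. N) \<partial>Pi\<^sub>M (insert i J) (\<lambda>_. M))"
  proof -
    have sN': "sigma_finite_measure (Pi\<^sub>M (insert i J) (\<lambda>_. N))" by (rule pN.sigma_finite) (use insert.hyps in auto)
    have "(\<lambda>(a, v). f (\<lambda>l\<in>insert i J. (a l, v l))) \<in> borel_measurable (Pi\<^sub>M (insert i J) (\<lambda>_. M) \<Otimes>\<^sub>M Pi\<^sub>M (insert i J) (\<lambda>_. N))"
      unfolding case_prod_beta by (rule measurable_compose[OF _ f]) measurable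
    then have "(\<lambda>a. \<integral>\<^sup>+v. f (\<lambda>l\<in>insert i J. (a l, v l)) \<partial>Pi\<^sub>M (insert i J) (\<lambda>_. N)) \<in> borel_measurable (Pi\<^sub>M (insert i J) (\<lambda>_. M))"
      by (rule sigma_finite_measure.borel_measurable_nn_integral[OF sN'])
    then show ?thesis
      using insert.hyps by (intro pM.product_nn_integral_insert_rev[symmetric]) auto
  qed
  finally show ?case .
qed

lemma AE_PiM_half_normal_pos:
  assumes "finite J"
  shows "AE a in Pi\<^sub>M J (\<lambda>_::nat. half_normal). \<forall>i\<in>J. 0 < a i"
proof -
  have "AE a in Pi\<^sub>M J (\<lambda>_::nat. half_normal). 0 < a i" if "i \<in> J" for i
    using that AE_half_normal_pos by (intro AE_PiM_component) (auto intro: half_normal.prob_space_axioms)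
  then show ?thesis using assms by (simp add: AE_finite_all)
qed

text \<open>The factor |a|/sqrt(2 pi) is what remains of the density of (\<xi>.u)/|a| after its
  exponential has been absorbed by a rescaling of a. No explicit value is calculated; it is
  recovered from a case in which the integral is known.\<close>

definition mixing_constant :: "nat set \<Rightarrow> ((nat \<Rightarrow> real) \<Rightarrow> (nat \<Rightarrow> 'b::euclidean_space) \<Rightarrow> bool) \<Rightarrow> ennreal" where
  "mixing_constant J b = (\<integral>\<^sup>+v. \<integral>\<^sup>+a. of_bool (b a v) * ennreal (L2_set a J / sqrt (2 * pi))
     \<partial>Pi\<^sub>M J (\<lambda>_. half_normal) \<partial>Pi\<^sub>M J (\<lambda>_. gauss))"

text \<open>After resampling the component of v along a/|a|, only t = (\<xi>.u)/|a| enters, with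
  density |a| phi(|a| t) for the standard normal density phi. For fixed t its exponential is
  absorbed by dividing a by sqrt(1 + t^2), under which b is invariant. This gives one factor for
  each index of J and another one from |a|, hence the exponent \<open>Suc (card J)\<close>.\<close>

lemma nn_integral_half_normal_gauss_mix:
  fixes \<Phi> :: "(nat \<Rightarrow> real) \<Rightarrow> (nat \<Rightarrow> 'b::euclidean_space) \<Rightarrow> ennreal" and h :: "real \<Rightarrow> ennreal"
  assumes J: "finite J" "J \<noteq> {}"
    and \<Phi> [measurable]: "(\<lambda>(a, v). \<Phi> a v) \<in> borel_measurable (Pi\<^sub>M J (\<lambda>_. half_normal) \<Otimes>\<^sub>M Pi\<^sub>M J (\<lambda>_. gauss))"
    and b [measurable]: "Measurable.pred (Pi\<^sub>M J (\<lambda>_. half_normal) \<Otimes>\<^sub>M Pi\<^sub>M J (\<lambda>_. gauss)) (\<lambda>(a, v). b a v)"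
    and h [measurable]: "h \<in> borel_measurable borel"
    and b_scale: "\<And>a v r. 0 < r \<Longrightarrow> b (\<lambda>i\<in>J. a i / r) v \<longleftrightarrow> b a v"
    and mix: "AE a in Pi\<^sub>M J (\<lambda>_. half_normal). AE v in Pi\<^sub>M J (\<lambda>_. gauss). \<exists>u. norm u = 1 \<and>
      (\<forall>\<xi>. \<Phi> a (mix J a v \<xi>) = of_bool (b a v) * h ((\<xi> \<bullet> u) / L2_set a J))"
  shows "(\<integral>\<^sup>+a. \<integral>\<^sup>+v. \<Phi> a v \<partial>Pi\<^sub>M J (\<lambda>_. gauss) \<partial>Pi\<^sub>M J (\<lambda>_. half_normal)) =
    mixing_constant J b * (\<integral>\<^sup>+t. h t * ennreal ((1 / sqrt (1 + t\<^sup>2)) ^ Suc (card J)) \<partial>lborel)"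
proof -
  let ?A = "Pi\<^sub>M J (\<lambda>_::nat. half_normal)"
  let ?V = "Pi\<^sub>M J (\<lambda>_::nat. gauss :: 'b measure)"
  interpret A: prob_space ?A by (rule prob_space_PiM) (rule prob_space_half_normal)
  interpret V: prob_space ?V by (rule prob_space_PiM) (rule prob_space_gauss)
  interpret AV: pair_sigma_finite ?A ?V by standard
  interpret LA: pair_sigma_finite lborel ?A by standard
  interpret LV: pair_sigma_finite lborel ?V by standard
  have [measurable]: "(\<lambda>a. L2_set a J) \<in> borel_measurable ?A" unfolding L2_set_def by measurable
  define w where "w a v = (of_bool (b a v) :: ennreal)" for a v
  have [measurable]: "(\<lambda>(a, v). w a v) \<in> borel_measurable (?A \<Otimes>\<^sub>M ?V)" unfolding w_def by measurable
  define k where "k a t = ennreal (L2_set a J * std_normal_density (L2_set a J * t))" for a :: "nat \<Rightarrow> real" and t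
  have [measurable]: "(\<lambda>(a, t). k a t) \<in> borel_measurable (?A \<Otimes>\<^sub>M borel)" unfolding k_def by measurable
  have pos: "AE a in ?A. \<forall>i\<in>J. 0 < a i" using J(1) by (rule AE_PiM_half_normal_pos)
  have "(\<integral>\<^sup>+a. \<integral>\<^sup>+v. \<Phi> a v \<partial>?V \<partial>?A) = (\<integral>\<^sup>+a. \<integral>\<^sup>+v. (\<integral>\<^sup>+t. w a v * (k a t * h t) \<partial>lborel) \<partial>?V \<partial>?A)"
  proof (intro nn_integral_cong_AE, use pos mix AE_space in eventually_elim)
    fix a assume a: "\<forall>i\<in>J. 0 < a i" "AE v in ?V. \<exists>u. norm u = 1 \<and> (\<forall>\<xi>. \<Phi> a (mix J a v \<xi>) = of_bool (b a v) * h ((\<xi> \<bullet> u) / L2_set a J))"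
      and aA [measurable]: "a \<in> space ?A"
    have L: "0 < L2_set a J" using J a by (intro L2_set_pos) auto
    have [measurable]: "(\<lambda>(v, \<xi>). \<Phi> a (mix J a v \<xi>)) \<in> borel_measurable (?V \<Otimes>\<^sub>M gauss)"
    proof -
      have "(\<lambda>(v, \<xi>). (a, mix J a v \<xi>)) \<in> (?V \<Otimes>\<^sub>M gauss) \<rightarrow>\<^sub>M (?A \<Otimes>\<^sub>M ?V)"
        using measurable_mix[of J a] aA by (auto simp: case_prod_beta' intro!: measurable_Pair)
      from measurable_compose[OF this \<Phi>] show ?thesis by (simp add: case_prod_beta')
    qed
    have [measurable]: "(\<lambda>(\<xi>, v). \<Phi> a (mix J a v \<xi>)) \<in> borel_measurable (gauss \<Otimes>\<^sub>M ?V)"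
      using measurable_pair_swap[OF \<open>(\<lambda>(v, \<xi>). \<Phi> a (mix J a v \<xi>)) \<in> borel_measurable (?V \<Otimes>\<^sub>M gauss)\<close>] by (simp add: case_prod_beta')
    have [measurable]: "\<Phi> a \<in> borel_measurable ?V" using measurable_Pair2[OF \<Phi> aA] by simp
    have "(\<integral>\<^sup>+v. \<Phi> a v \<partial>?V) = (\<integral>\<^sup>+\<xi>. \<integral>\<^sup>+v. \<Phi> a (mix J a v \<xi>) \<partial>?V \<partial>gauss)"
      using J a by (intro nn_integral_gauss_mix[symmetric]) auto
    also have "\<dots> = (\<integral>\<^sup>+v. \<integral>\<^sup>+\<xi>. \<Phi> a (mix J a v \<xi>) \<partial>gauss \<partial>?V)"
      by (rule gauss_Fubini[symmetric]) (measurable, unfold_locales)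
    also have "\<dots> = (\<integral>\<^sup>+v. (\<integral>\<^sup>+t. w a v * (k a t * h t) \<partial>lborel) \<partial>?V)"
    proof (intro nn_integral_cong_AE, use a(2) in eventually_elim)
      fix v assume "\<exists>u. norm u = 1 \<and> (\<forall>\<xi>. \<Phi> a (mix J a v \<xi>) = of_bool (b a v) * h ((\<xi> \<bullet> u) / L2_set a J))"
      then obtain u where u: "norm u = 1" "\<And>\<xi>. \<Phi> a (mix J a v \<xi>) = of_bool (b a v) * h ((\<xi> \<bullet> u) / L2_set a J)" by blast
      have "(\<integral>\<^sup>+\<xi>. \<Phi> a (mix J a v \<xi>) \<partial>gauss) = w a v * (\<integral>\<^sup>+\<xi>. h ((\<xi> \<bullet> u) / L2_set a J) \<partial>gauss)"
        unfolding u(2) w_def by (rule nn_integral_cmult) measurable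
      also have "(\<integral>\<^sup>+\<xi>. h ((\<xi> \<bullet> u) / L2_set a J) \<partial>gauss) = (\<integral>\<^sup>+z. ennreal (std_normal_density z) * h (z / L2_set a J) \<partial>lborel)"
        by (rule nn_integral_gauss_inner[OF u(1)]) measurable
      also have "\<dots> = (\<integral>\<^sup>+t. k a t * h t \<partial>lborel)"
        unfolding k_def by (rule nn_integral_std_normal_scale[OF h L])
      also have "w a v * \<dots> = (\<integral>\<^sup>+t. w a v * (k a t * h t) \<partial>lborel)"
        using aA by (intro nn_integral_cmult[symmetric]) (auto simp: k_def)
      finally show "(\<integral>\<^sup>+\<xi>. \<Phi> a (mix J a v \<xi>) \<partial>gauss) = (\<integral>\<^sup>+t. w a v * (k a t * h t) \<partial>lborel)" .
    qed
    finally show "(\<integral>\<^sup>+v. \<Phi> a v \<partial>?V) = (\<integral>\<^sup>+v. (\<integral>\<^sup>+t. w a v * (k a t * h t) \<partial>lborel) \<partial>?V)" .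
  qed
  also have "\<dots> = (\<integral>\<^sup>+v. \<integral>\<^sup>+a. (\<integral>\<^sup>+t. w a v * (k a t * h t) \<partial>lborel) \<partial>?A \<partial>?V)"
    by (rule AV.Fubini'[symmetric]) measurable
  also have "\<dots> = (\<integral>\<^sup>+v. \<integral>\<^sup>+t. (\<integral>\<^sup>+a. w a v * (k a t * h t) \<partial>?A) \<partial>lborel \<partial>?V)"
    by (intro nn_integral_cong LA.Fubini') measurable
  also have "\<dots> = (\<integral>\<^sup>+t. \<integral>\<^sup>+v. (\<integral>\<^sup>+a. w a v * (k a t * h t) \<partial>?A) \<partial>?V \<partial>lborel)"
    by (rule LV.Fubini') measurable
  also have "\<dots> = (\<integral>\<^sup>+t. mixing_constant J b * (h t * ennreal ((1 / sqrt (1 + t\<^sup>2)) ^ Suc (card J))) \<partial>lborel)"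
  proof (rule nn_integral_cong)
    fix t :: real
    define r where "r = sqrt (1 + t\<^sup>2)"
    have r: "0 < r" by (simp add: r_def add_pos_nonneg)
    have "(\<integral>\<^sup>+a. w a v * (k a t * h t) \<partial>?A) = h t * ennreal ((1 / r) ^ Suc (card J)) * (\<integral>\<^sup>+a. w a v * ennreal (L2_set a J / sqrt (2 * pi)) \<partial>?A)"
      if v [measurable]: "v \<in> space ?V" for v
    proof -
      have "k a t = ennreal (L2_set a J / sqrt (2 * pi)) * ennreal (exp (- (t\<^sup>2 * (\<Sum>i\<in>J. (a i)\<^sup>2) / 2)))" for a
      proof -
        have "(L2_set a J * t)\<^sup>2 = t\<^sup>2 * (\<Sum>i\<in>J. (a i)\<^sup>2)"
          by (simp add: power_mult_distrib L2_set_def sum_nonneg mult.commute)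
        then show ?thesis
          by (simp add: k_def std_normal_density_def L2_set_nonneg flip: ennreal_mult)
      qed
      then have "(\<integral>\<^sup>+a. w a v * (k a t * h t) \<partial>?A) = (\<integral>\<^sup>+a. h t * (w a v * ennreal (L2_set a J / sqrt (2 * pi)) * ennreal (exp (- (t\<^sup>2 * (\<Sum>i\<in>J. (a i)\<^sup>2) / 2)))) \<partial>?A)"
        by (simp add: mult_ac)
      also have "\<dots> = h t * (\<integral>\<^sup>+a. w a v * ennreal (L2_set a J / sqrt (2 * pi)) * ennreal (exp (- (t\<^sup>2 * (\<Sum>i\<in>J. (a i)\<^sup>2) / 2))) \<partial>?A)"
        by (rule nn_integral_cmult) measurable
      also have "(\<integral>\<^sup>+a. w a v * ennreal (L2_set a J / sqrt (2 * pi)) * ennreal (exp (- (t\<^sup>2 * (\<Sum>i\<in>J. (a i)\<^sup>2) / 2))) \<partial>?A)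
         = ennreal ((1 / sqrt (1 + t\<^sup>2)) ^ card J) * (\<integral>\<^sup>+a. w (\<lambda>i\<in>J. a i / sqrt (1 + t\<^sup>2)) v * ennreal (L2_set (\<lambda>i\<in>J. a i / sqrt (1 + t\<^sup>2)) J / sqrt (2 * pi)) \<partial>?A)"
        using J(1) by (rule half_normal_PiM_scale) measurable
      also have "(\<integral>\<^sup>+a. w (\<lambda>i\<in>J. a i / sqrt (1 + t\<^sup>2)) v * ennreal (L2_set (\<lambda>i\<in>J. a i / sqrt (1 + t\<^sup>2)) J / sqrt (2 * pi)) \<partial>?A)
         = (\<integral>\<^sup>+a. ennreal (1 / r) * (w a v * ennreal (L2_set a J / sqrt (2 * pi))) \<partial>?A)"
      proof (rule nn_integral_cong)
        fix a :: "nat \<Rightarrow> real"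
        have "L2_set (\<lambda>i\<in>J. a i / r) J = L2_set (\<lambda>i. (1 / r) * a i) J"
          by (rule L2_set_cong) auto
        also have "\<dots> = (1 / r) * L2_set a J" using r by (intro L2_set_right_distrib[symmetric]) auto
        finally have "ennreal (L2_set (\<lambda>i\<in>J. a i / r) J / sqrt (2 * pi)) = ennreal (1 / r) * ennreal (L2_set a J / sqrt (2 * pi))"
          using r by (simp add: L2_set_nonneg flip: ennreal_mult)
        then show "w (\<lambda>i\<in>J. a i / sqrt (1 + t\<^sup>2)) v * ennreal (L2_set (\<lambda>i\<in>J. a i / sqrt (1 + t\<^sup>2)) J / sqrt (2 * pi)) = ennreal (1 / r) * (w a v * ennreal (L2_set a J / sqrt (2 * pi)))"
          using b_scale[OF r] by (simp add: w_def r_def[symmetric] mult_ac)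
      qed
      also have "\<dots> = ennreal (1 / r) * (\<integral>\<^sup>+a. w a v * ennreal (L2_set a J / sqrt (2 * pi)) \<partial>?A)"
        by (rule nn_integral_cmult) measurable
      finally have 1: "(\<integral>\<^sup>+a. w a v * (k a t * h t) \<partial>?A) = h t * (ennreal ((1 / r) ^ card J) *
          (ennreal (1 / r) * (\<integral>\<^sup>+a. w a v * ennreal (L2_set a J / sqrt (2 * pi)) \<partial>?A)))"
        unfolding r_def .
      have "ennreal ((1 / r) ^ Suc (card J)) = ennreal ((1 / r) ^ card J) * ennreal (1 / r)"
        using r by (subst power_Suc2, subst ennreal_mult) auto
      then show ?thesis unfolding 1 by (simp only: mult.assoc)
    qed
    then have "(\<integral>\<^sup>+v. (\<integral>\<^sup>+a. w a v * (k a t * h t) \<partial>?A) \<partial>?V)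
       = (\<integral>\<^sup>+v. h t * ennreal ((1 / r) ^ Suc (card J)) * (\<integral>\<^sup>+a. w a v * ennreal (L2_set a J / sqrt (2 * pi)) \<partial>?A) \<partial>?V)"
      by (intro nn_integral_cong) auto
    also have "\<dots> = h t * ennreal ((1 / r) ^ Suc (card J)) * mixing_constant J b"
      unfolding mixing_constant_def w_def[symmetric]
      by (rule nn_integral_cmult) measurable
    finally show "(\<integral>\<^sup>+v. (\<integral>\<^sup>+a. w a v * (k a t * h t) \<partial>?A) \<partial>?V) = mixing_constant J b * (h t * ennreal ((1 / sqrt (1 + t\<^sup>2)) ^ Suc (card J)))"
      by (simp add: r_def mult_ac)
  qed
  also have "\<dots> = mixing_constant J b * (\<integral>\<^sup>+t. h t * ennreal ((1 / sqrt (1 + t\<^sup>2)) ^ Suc (card J)) \<partial>lborel)"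
    by (rule nn_integral_cmult) measurable
  finally show ?thesis .
qed

text \<open>For t = tan y and x = y + pi/2 the Cauchy distribution function becomes x/pi and
  1/sqrt(1 + t^2) becomes sin x. Two of the p + 2 factors are consumed by dt.\<close>

lemma nn_integral_arctan_power:
  "(\<integral>\<^sup>+t. ennreal ((1 / 2 + arctan t / pi) ^ N * (1 / sqrt (1 + t\<^sup>2)) ^ Suc (Suc p)) \<partial>lborel) =
    ennreal (sin_moment p N / pi ^ N)"
proof -
  define f where "f t = (1 / 2 + arctan t / pi) ^ N * (1 / sqrt (1 + t\<^sup>2)) ^ Suc (Suc p)" for t
  define k where "k y = (1 / 2 + y / pi) ^ N * cos y ^ p" for y :: real
  have F_nonneg: "0 \<le> 1 / 2 + arctan t / pi" for t
    using arctan_lbound[of t] by (simp add: field_simps)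
  have f_nonneg: "0 \<le> f t" for t unfolding f_def using F_nonneg by (intro mult_nonneg_nonneg zero_le_power) auto
  have cos_pos: "0 < cos y" if "- (pi / 2) < y" "y < pi / 2" for y using that by (rule cos_gt_zero_pi)
  have fk: "f (tan y) * (1 + (tan y)\<^sup>2) = k y" if y: "- (pi / 2) < y" "y < pi / 2" for y
  proof -
    have c: "0 < cos y" using cos_pos y by blast
    have sq: "1 + (tan y)\<^sup>2 = 1 / (cos y)\<^sup>2" using tan_sec[of y] c by (simp add: inverse_eq_divide power_one_over)
    have "sqrt (1 + (tan y)\<^sup>2) = 1 / cos y" unfolding sq using c by (simp add: real_sqrt_divide)
    then show ?thesis unfolding f_def k_def sq using c y
      by (simp add: arctan_tan power2_eq_square)
  qed
  have contk: "continuous_on A k" for A unfolding k_def by (intro continuous_intros) auto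
  have iv: "einterval (ereal (- (pi / 2))) (ereal (pi / 2)) = {- (pi / 2)<..<pi / 2}" by (auto simp: einterval_def)
  have int_k: "set_integrable lborel {- (pi / 2)..pi / 2} k"
    by (rule borel_integrable_atLeastAtMost') (rule contk)
  then have int_fg: "set_integrable lborel (einterval (- (pi / 2)) (pi / 2)) (\<lambda>y. f (tan y) * (1 + (tan y)\<^sup>2))"
  proof -
    have "set_integrable lborel {- (pi / 2)<..<pi / 2} k"
      by (rule set_integrable_subset[OF int_k]) auto
    then show ?thesis unfolding iv
      by (subst set_integrable_cong[OF refl refl, of _ _ k]) (auto simp: fk)
  qed
  have contf: "isCont f t" for t
  proof -
    have "1 + t\<^sup>2 \<noteq> 0" by (metis add_pos_nonneg less_irrefl zero_le_power2 zero_less_one)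
    then show ?thesis unfolding f_def by (intro continuous_intros) auto
  qed
  note subst = interval_integral_substitution_nonneg[where a = "- (pi / 2)" and b = "pi / 2" and g = tan
      and g' = "\<lambda>x. 1 + (tan x)\<^sup>2" and f = f and A = "-\<infinity>" and B = "\<infinity>"]
  have cz: "cos y \<noteq> 0" if "- (pi / 2) < y" "y < pi / 2" for y using cos_pos[OF that] by simp
  have deriv: "DERIV tan y :> 1 + (tan y)\<^sup>2" if "- (pi / 2) < y" "y < pi / 2" for y
    using DERIV_tan[OF cz[OF that]] tan_sec[OF cz[OF that]] by (simp add: power_inverse)
  have s: "set_integrable lborel (einterval (-\<infinity>) \<infinity>) f"
    "(LBINT x=-\<infinity>..\<infinity>. f x) = (LBINT x=- (pi / 2)..pi / 2. f (tan x) * (1 + (tan x)\<^sup>2))"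
    by (rule subst; use deriv contf f_nonneg int_fg cz in \<open>auto intro!: continuous_intros simp: ereal_tendsto_simps filterlim_tan_at_left filterlim_tan_at_right add_nonneg_nonneg\<close>)+
  have "(\<integral>\<^sup>+t. ennreal (f t) \<partial>lborel) = ennreal (LBINT x. f x)"
    using s(1) f_nonneg by (intro nn_integral_eq_integral) (auto simp: set_integrable_def)
  also have "(LBINT x. f x) = (LBINT x=-\<infinity>..\<infinity>. f x)"
    by (simp add: interval_lebesgue_integral_def set_lebesgue_integral_def)
  also have "\<dots> = (LBINT x=- (pi / 2)..pi / 2. k x)"
    unfolding s(2) by (rule interval_integral_cong) (auto simp: fk)
  also have "\<dots> = integral {- (pi / 2)..pi / 2} k"
    using contk by (intro interval_integral_eq_integral) (auto intro!: borel_integrable_atLeastAtMost')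
  also have "\<dots> = integral {- (pi / 2)..pi / 2} ((\<lambda>x. (x / pi) ^ N * sin x ^ p) \<circ> (\<lambda>x. x + pi / 2))"
    by (rule integral_cong) (simp add: k_def add_divide_distrib add.commute sin_cos_eq)
  also have "\<dots> = integral {- (pi / 2) + pi / 2..pi / 2 + pi / 2} (\<lambda>x. (x / pi) ^ N * sin x ^ p)"
    by (rule integral_shift) (auto intro!: continuous_intros)
  also have "\<dots> = integral {0..pi} (\<lambda>x. (sin x ^ p * x ^ N) / pi ^ N)"
    by (simp add: power_divide mult.commute)
  also have "\<dots> = sin_moment p N / pi ^ N"
    unfolding sin_moment_def by (rule integral_divide)
  finally show ?thesis by (simp add: f_def)
qed

subsection \<open>Measurability and general position\<close>

lemma measurable_ex_compact:
  fixes K :: "'e::euclidean_space set" and f :: "'a \<Rightarrow> 'e \<Rightarrow> real"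
  assumes K: "compact K"
    and meas: "\<And>y. (\<lambda>x. f x y) \<in> borel_measurable M"
    and cont: "\<And>x. x \<in> space M \<Longrightarrow> continuous_on K (f x)"
  shows "Measurable.pred M (\<lambda>x. \<exists>y\<in>K. f x y \<le> 0)"
proof -
  obtain T where T: "countable T" "T \<subseteq> K" "K \<subseteq> closure T"
    using separable[of K] by blast
  have eq: "(\<exists>y\<in>K. f x y \<le> 0) \<longleftrightarrow> (\<forall>n::nat. \<exists>y\<in>T. f x y < 1 / Suc n)" if x: "x \<in> space M" for x
  proof
    assume "\<exists>y\<in>K. f x y \<le> 0"
    then obtain y where y: "y \<in> K" "f x y \<le> 0" by blast
    show "\<forall>n::nat. \<exists>y\<in>T. f x y < 1 / Suc n"
    proof
      fix n :: nat
      obtain \<delta> where \<delta>: "0 < \<delta>" "\<And>z. z \<in> K \<Longrightarrow> dist z y < \<delta> \<Longrightarrow> dist (f x z) (f x y) < 1 / Suc n"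
        using cont[OF x] y(1) unfolding continuous_on_iff by (metis of_nat_0_less_iff zero_less_Suc zero_less_divide_1_iff)
      obtain z where z: "z \<in> T" "dist z y < \<delta>"
        using T(3) y(1) \<delta>(1) closure_approachable by blast
      then have "dist (f x z) (f x y) < 1 / Suc n" using \<delta>(2) T(2) by blast
      then have "f x z < 1 / Suc n" using y(2) by (simp add: dist_real_def abs_less_iff)
      then show "\<exists>y\<in>T. f x y < 1 / Suc n" using z(1) by blast
    qed
  next
    assume R: "\<forall>n::nat. \<exists>y\<in>T. f x y < 1 / Suc n"
    then have "K \<noteq> {}" using T(2) by blast
    then obtain y where y: "y \<in> K" "\<And>z. z \<in> K \<Longrightarrow> f x y \<le> f x z"
      using continuous_attains_inf[OF K _ cont[OF x]] by blast
    have "f x y \<le> 0"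
    proof (rule ccontr)
      assume "\<not> f x y \<le> 0"
      then obtain n where n: "inverse (real (Suc n)) < f x y" using reals_Archimedean[of "f x y"] by auto
      obtain z where "z \<in> T" "f x z < 1 / Suc n" using R by blast
      then show False using n y(2)[of z] T(2) by (auto simp: inverse_eq_divide)
    qed
    then show "\<exists>y\<in>K. f x y \<le> 0" using y(1) by blast
  qed
  have meas_T: "Measurable.pred M (\<lambda>x. \<forall>n::nat. \<exists>y\<in>T. f x y < 1 / Suc n)"
    using T(1) meas by (intro pred_intros_countable pred_intros_countable_bounded borel_measurable_pred_less) auto
  show ?thesis by (subst measurable_cong[OF eq]) (assumption | rule meas_T)+
qed

text \<open>Brings \<open>exposes\<close> into the form of \<open>measurable_ex_compact\<close>.
  Scaling y raises all positive products to at least 1, which makes the inequalities closed, and the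
  balls of radius N exhaust S.\<close>

lemma exposes_bounded:
  assumes "subspace S" "finite I" "R \<subseteq> I"
  shows "exposes S x I R \<longleftrightarrow> (\<exists>N::nat. \<exists>y\<in>S \<inter> cball 0 (real N).
    (\<Sum>i\<in>R. \<bar>x i \<bullet> y\<bar>) + (\<Sum>i\<in>I - R. max 0 (1 - x i \<bullet> y)) \<le> 0)"
proof
  assume "exposes S x I R"
  then obtain y where y: "y \<in> S" "\<And>i. i \<in> R \<Longrightarrow> x i \<bullet> y = 0" "\<And>i. i \<in> I - R \<Longrightarrow> 0 < x i \<bullet> y"
    by (auto simp: exposes_def)
  define s where "s = (\<Sum>i\<in>I - R. 1 / (x i \<bullet> y))"
  have s: "1 \<le> s * (x i \<bullet> y)" if i: "i \<in> I - R" for i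
  proof -
    have "1 / (x i \<bullet> y) \<le> s" unfolding s_def
      using assms(2) i y(3) by (intro member_le_sum) (auto intro: less_imp_le)
    then show ?thesis using y(3)[OF i] by (simp add: pos_divide_le_eq)
  qed
  obtain N :: nat where N: "norm (s *\<^sub>R y) \<le> real N" using real_arch_simple by blast
  have "(\<Sum>i\<in>R. \<bar>x i \<bullet> s *\<^sub>R y\<bar>) = 0" using y(2) by simp
  moreover have "(\<Sum>i\<in>I - R. max 0 (1 - x i \<bullet> s *\<^sub>R y)) = 0" using s by (intro sum.neutral) auto
  ultimately show "\<exists>N::nat. \<exists>y\<in>S \<inter> cball 0 (real N). (\<Sum>i\<in>R. \<bar>x i \<bullet> y\<bar>) + (\<Sum>i\<in>I - R. max 0 (1 - x i \<bullet> y)) \<le> 0"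
    using N y(1) assms(1) by (intro exI[of _ N] bexI[of _ "s *\<^sub>R y"]) (auto simp: subspace_scale)
next
  assume "\<exists>N::nat. \<exists>y\<in>S \<inter> cball 0 (real N). (\<Sum>i\<in>R. \<bar>x i \<bullet> y\<bar>) + (\<Sum>i\<in>I - R. max 0 (1 - x i \<bullet> y)) \<le> 0"
  then obtain y where y: "y \<in> S" "(\<Sum>i\<in>R. \<bar>x i \<bullet> y\<bar>) + (\<Sum>i\<in>I - R. max 0 (1 - x i \<bullet> y)) \<le> 0" by blast
  have "0 \<le> (\<Sum>i\<in>R. \<bar>x i \<bullet> y\<bar>)" "0 \<le> (\<Sum>i\<in>I - R. max 0 (1 - x i \<bullet> y))" by (auto intro: sum_nonneg)
  then have "(\<Sum>i\<in>R. \<bar>x i \<bullet> y\<bar>) = 0" "(\<Sum>i\<in>I - R. max 0 (1 - x i \<bullet> y)) = 0" using y(2) by linarith+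
  then have "\<forall>i\<in>R. \<bar>x i \<bullet> y\<bar> = 0" "\<forall>i\<in>I - R. max 0 (1 - x i \<bullet> y) = 0"
    using assms by (simp_all add: sum_nonneg_eq_0_iff finite_subset)
  moreover have "0 < t" if "max 0 (1 - t) = 0" for t :: real using that by linarith
  ultimately have "\<forall>i\<in>R. x i \<bullet> y = 0" "\<forall>i\<in>I - R. 0 < x i \<bullet> y" by auto
  then show "exposes S x I R" using y(1) by (auto simp: exposes_def)
qed

lemma measurable_exposes:
  fixes S :: "'e::euclidean_space set"
  assumes S: "subspace S" and I: "finite I" "R \<subseteq> I"
    and x: "\<And>i. i \<in> I \<Longrightarrow> (\<lambda>\<omega>. x \<omega> i) \<in> borel_measurable M"
  shows "Measurable.pred M (\<lambda>\<omega>. exposes S (x \<omega>) I R)"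
proof -
  have [measurable]: "i \<in> R \<Longrightarrow> (\<lambda>\<omega>. x \<omega> i) \<in> borel_measurable M" "i \<in> I - R \<Longrightarrow> (\<lambda>\<omega>. x \<omega> i) \<in> borel_measurable M" for i
    using x I by auto
  have "Measurable.pred M (\<lambda>\<omega>. \<exists>y\<in>S \<inter> cball 0 (real N). (\<Sum>i\<in>R. \<bar>x \<omega> i \<bullet> y\<bar>) + (\<Sum>i\<in>I - R. max 0 (1 - x \<omega> i \<bullet> y)) \<le> 0)" for N :: nat
    using S by (intro measurable_ex_compact closed_Int_compact closed_subspace compact_cball)
      (auto intro!: continuous_intros)
  then show ?thesis unfolding exposes_bounded[OF S I] by (intro pred_intros_countable)
qed

lemma measurable_ex_orthogonal:
  fixes S :: "'e::euclidean_space set"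
  assumes S: "subspace S" and x: "\<And>i. i \<in> J \<Longrightarrow> (\<lambda>\<omega>. x \<omega> i) \<in> borel_measurable M"
  shows "Measurable.pred M (\<lambda>\<omega>. \<exists>y\<in>S. y \<noteq> 0 \<and> (\<Sum>i\<in>J. \<bar>x \<omega> i \<bullet> y\<bar>) = 0)"
proof -
  note x[measurable]
  have eq: "(\<exists>y\<in>S. y \<noteq> 0 \<and> (\<Sum>i\<in>J. \<bar>x \<omega> i \<bullet> y\<bar>) = 0) \<longleftrightarrow> (\<exists>y\<in>S \<inter> sphere 0 1. (\<Sum>i\<in>J. \<bar>x \<omega> i \<bullet> y\<bar>) \<le> 0)" for \<omega>
  proof
    assume "\<exists>y\<in>S. y \<noteq> 0 \<and> (\<Sum>i\<in>J. \<bar>x \<omega> i \<bullet> y\<bar>) = 0"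
    then obtain y where y: "y \<in> S" "y \<noteq> 0" "(\<Sum>i\<in>J. \<bar>x \<omega> i \<bullet> y\<bar>) = 0" by blast
    have "(\<Sum>i\<in>J. \<bar>x \<omega> i \<bullet> (y /\<^sub>R norm y)\<bar>) = (\<Sum>i\<in>J. \<bar>x \<omega> i \<bullet> y\<bar>) / norm y"
      by (simp add: abs_mult divide_inverse sum_distrib_left mult.commute)
    then show "\<exists>y\<in>S \<inter> sphere 0 1. (\<Sum>i\<in>J. \<bar>x \<omega> i \<bullet> y\<bar>) \<le> 0"
      using y S by (intro bexI[of _ "y /\<^sub>R norm y"]) (auto simp: subspace_scale)
  next
    assume "\<exists>y\<in>S \<inter> sphere 0 1. (\<Sum>i\<in>J. \<bar>x \<omega> i \<bullet> y\<bar>) \<le> 0"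
    then obtain y where y: "y \<in> S" "norm y = 1" "(\<Sum>i\<in>J. \<bar>x \<omega> i \<bullet> y\<bar>) \<le> 0" by auto
    moreover have "0 \<le> (\<Sum>i\<in>J. \<bar>x \<omega> i \<bullet> y\<bar>)" by (auto intro: sum_nonneg)
    ultimately show "\<exists>y\<in>S. y \<noteq> 0 \<and> (\<Sum>i\<in>J. \<bar>x \<omega> i \<bullet> y\<bar>) = 0" by (intro bexI[of _ y]) auto
  qed
  show ?thesis unfolding eq using S
    by (intro measurable_ex_compact closed_Int_compact closed_subspace compact_sphere) (auto intro!: continuous_intros)
qed

section \<open>Coordinate flags\<close>

definition basis_enum :: "nat \<Rightarrow> 'b::euclidean_space" where
  "basis_enum = (SOME g. bij_betw g {..<DIM('b)} Basis)"

lemma bij_betw_basis_enum: "bij_betw (basis_enum :: nat \<Rightarrow> 'b::euclidean_space) {..<DIM('b)} Basis"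
proof -
  have "\<exists>g. bij_betw g {..<DIM('b)} (Basis :: 'b set)"
    using ex_bij_betw_nat_finite[of "Basis :: 'b set"] by (simp add: atLeast0LessThan)
  then show ?thesis unfolding basis_enum_def by (rule someI_ex)
qed

lemma basis_enum_in_Basis: "j < DIM('b) \<Longrightarrow> (basis_enum j :: 'b::euclidean_space) \<in> Basis"
  using bij_betw_basis_enum bij_betwE by blast

lemma inner_basis_enum: "i < DIM('b) \<Longrightarrow> j < DIM('b) \<Longrightarrow>
   (basis_enum i :: 'b::euclidean_space) \<bullet> basis_enum j = (if i = j then 1 else 0)"
  using bij_betw_basis_enum[where 'b = 'b] basis_enum_in_Basis[where 'b = 'b]
  by (auto simp: inner_Basis bij_betw_def inj_on_def)

text \<open>The span of the distinguished direction and the first m basis vectors, hence of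
  dimension m + 1. Only \<open>snd\<close> is constrained, so flags are closed under every change of
  the first coordinate; shears and scalings of the rows rely on this.\<close>

definition flag :: "nat \<Rightarrow> (real \<times> 'b::euclidean_space) set" where
  "flag m = {y. \<forall>j\<in>{m..<DIM('b)}. snd y \<bullet> basis_enum j = 0}"

lemma subspace_flag: "subspace (flag m)"
  by (auto simp: subspace_def flag_def inner_add_left)

lemma flag_DIM [simp]: "flag DIM('b) = (UNIV :: (real \<times> 'b::euclidean_space) set)"
  by (simp add: flag_def)

lemma dim_flag:
  assumes m: "m \<le> DIM('b)"
  shows "dim (flag m :: (real \<times> 'b::euclidean_space) set) = Suc m"
proof -
  define d :: "(real \<times> 'b) set" where "d = insert (1, 0) ((\<lambda>j. (0, basis_enum j)) ` {..<m})"
  have inj: "inj_on (\<lambda>j. (0 :: real, basis_enum j :: 'b)) {..<m}"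
    using bij_betw_basis_enum[where 'b = 'b] m by (auto simp: bij_betw_def inj_on_def)
  have "d \<subseteq> Basis" using m basis_enum_in_Basis[where 'b = 'b] by (auto simp: d_def Basis_prod_def)
  moreover have "flag m = {x :: real \<times> 'b. \<forall>i\<in>Basis. i \<notin> d \<longrightarrow> x \<bullet> i = 0}"
  proof (intro equalityI subsetI CollectI ballI impI)
    fix y :: "real \<times> 'b" and i assume y: "y \<in> flag m" and i: "i \<in> Basis" "i \<notin> d"
    from i obtain b :: 'b where b: "i = (0, b)" "b \<in> Basis" by (auto simp: Basis_prod_def d_def)
    obtain j where j: "b = basis_enum j" "j < DIM('b)"
      using b(2) bij_betw_imp_surj_on[OF bij_betw_basis_enum[where 'b = 'b]] by blast
    have "m \<le> j" using i(2) b j by (auto simp: d_def not_less[symmetric])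
    then show "y \<bullet> i = 0" using y b j by (auto simp: flag_def inner_prod_def)
  next
    fix y :: "real \<times> 'b" assume y: "y \<in> {x. \<forall>i\<in>Basis. i \<notin> d \<longrightarrow> x \<bullet> i = 0}"
    show "y \<in> flag m" unfolding flag_def
    proof (intro CollectI ballI)
      fix j assume j: "j \<in> {m..<DIM('b)}"
      have "(0, basis_enum j) \<notin> d"
      proof -
        have "basis_enum j \<noteq> (basis_enum i :: 'b)" if "i < m" for i
          using that j m inj_onD[OF bij_betw_imp_inj_on[OF bij_betw_basis_enum[where 'b = 'b]], of j i] by auto
        then show ?thesis by (auto simp: d_def)
      qed
      moreover have "(0, basis_enum j) \<in> (Basis :: (real \<times> 'b) set)"
        using basis_enum_in_Basis[where 'b = 'b, of j] j by (auto simp: Basis_prod_def)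
      ultimately have "y \<bullet> (0, basis_enum j) = 0" using y by blast
      then show "snd y \<bullet> basis_enum j = 0" by (simp add: inner_prod_def)
    qed
  qed
  moreover have "card d = Suc m"
  proof -
    have "(1, 0) \<notin> (\<lambda>j. (0 :: real, basis_enum j :: 'b)) ` {..<m}" by auto
    then show ?thesis unfolding d_def by (subst card_insert_disjoint) (auto simp only: card_image[OF inj] finite_imageI finite_lessThan card_lessThan)
  qed
  ultimately show ?thesis using dim_substandard[of d] by simp
qed

lemma flag_Suc: "m < DIM('b) \<Longrightarrow> flag m = {y \<in> flag (Suc m). (0, basis_enum m :: 'b::euclidean_space) \<bullet> y = 0}"
  by (auto simp: flag_def inner_prod_def inner_commute Suc_le_eq le_less)

lemma basis_enum_in_flag: "j < m \<Longrightarrow> m \<le> DIM('b) \<Longrightarrow> (0, basis_enum j :: 'b::euclidean_space) \<in> flag m"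
  by (auto simp: flag_def inner_basis_enum)

lemma generic_mono: "generic S x I \<Longrightarrow> J \<subseteq> I \<Longrightarrow> generic S x J"
  by (auto simp: generic_def)

text \<open>The directions e and f are the last two basis vectors in the flag, so S1 and S0 are the
  flags of index m - 1 and m - 2.\<close>

lemma wedge_flag:
  fixes x :: "nat \<Rightarrow> real \<times> 'b::euclidean_space"
  assumes m: "2 \<le> m" "m \<le> DIM('b)" and I: "finite I" "m \<le> card I" and R: "R \<subseteq> I" "card R < m"
    and gen: "\<And>j. j \<le> m \<Longrightarrow> generic (flag j) x I"
  shows "wedge (flag m) (0, basis_enum (m - 2)) (0, basis_enum (m - 1)) x I R m"
proof -
  obtain k where k: "m = Suc (Suc k)" using m(1) by (metis add_2_eq_Suc le_Suc_ex)
  have S1: "{y \<in> flag m. (0, basis_enum (m - 1)) \<bullet> y = 0} = (flag (m - 1) :: (real \<times> 'b) set)"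
    using flag_Suc[of "Suc k", where 'b = 'b] m k by simp
  have S0: "{y \<in> flag m. (0, basis_enum (m - 1)) \<bullet> y = 0 \<and> (0, basis_enum (m - 2)) \<bullet> y = 0} = (flag (m - 2) :: (real \<times> 'b) set)"
    using flag_Suc[of "Suc k", where 'b = 'b] flag_Suc[of k, where 'b = 'b] m k by auto
  show ?thesis
    unfolding wedge_def S1 S0
    using m k I R gen dim_flag[where 'b = 'b] subspace_flag basis_enum_in_flag[where 'b = 'b] inner_basis_enum[where 'b = 'b]
    by (auto simp: inner_prod_def)
qed

lemma flag_minus_2:
  assumes m: "2 \<le> m" "m \<le> DIM('b)"
  shows "{y \<in> flag m. (0, basis_enum (m - 1)) \<bullet> y = 0 \<and> (0, basis_enum (m - 2)) \<bullet> y = 0} = (flag (m - 2) :: (real \<times> 'b::euclidean_space) set)"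
proof -
  obtain k where k: "m = Suc (Suc k)" using m(1) by (metis add_2_eq_Suc le_Suc_ex)
  show ?thesis
    using flag_Suc[of "Suc k", where 'b = 'b] flag_Suc[of k, where 'b = 'b] m k by auto
qed

text \<open>The m rows are independent already on the flag of index m - 1, which has dimension m, so
  arbitrary values can be prescribed to them.\<close>

lemma exposes_full:
  fixes x :: "nat \<Rightarrow> real \<times> 'b::euclidean_space"
  assumes m: "1 \<le> m" "m \<le> DIM('b)" and G: "finite G" "card G = m" and R: "R \<subseteq> G"
    and gen: "generic (flag (m - 1)) x G"
  shows "exposes (flag m) x G R"
proof -
  have d: "dim (flag (m - 1) :: (real \<times> 'b) set) = m" using dim_flag[of "m - 1", where 'b = 'b] m by simp
  obtain z where z: "z \<in> flag (m - 1)" "\<forall>i\<in>G. x i \<bullet> z = (if i \<in> R then 0 else 1)"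
    using generic_solvable[OF gen subspace_flag G(1), of G "\<lambda>i. if i \<in> R then 0 else 1"] G d by auto
  moreover have "flag (m - 1) \<subseteq> (flag m :: (real \<times> 'b) set)" by (auto simp: flag_def)
  ultimately show ?thesis using R unfolding exposes_def by (intro bexI[of _ z]) auto
qed

text \<open>For generic points the sign condition in \<open>exposes_difference\<close> says that no vector of
  the smaller subspace exposes \<open>R\<close> among \<open>G\<close>, as one sees by taking \<open>I = G\<close>.\<close>

theorem flag_exposes_difference:
  fixes x :: "nat \<Rightarrow> real \<times> 'b::euclidean_space"
  assumes m: "2 \<le> m" "m \<le> DIM('b)" and I: "finite I" "m \<le> card I" and R: "R \<subseteq> I" "card R < m"
    and gen: "\<And>j. j \<le> m \<Longrightarrow> generic (flag j) x I"
  shows "2 * (of_bool (exposes (flag m) x I R) - of_bool (exposes (flag (m - 2)) x I R)) =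
    (\<Sum>G | R \<subseteq> G \<and> G \<subseteq> I \<and> card G = m. of_bool (\<not> exposes (flag (m - 2)) x G R)
       * (if G = I then 2 else of_bool (exposes (flag m) x I G)) :: real)"
proof -
  interpret wedge "flag m" "(0, basis_enum (m - 2))" "(0, basis_enum (m - 1))" x I R m
    "{y \<in> flag m. (0, basis_enum (m - 1)) \<bullet> y = 0 \<and> (0, basis_enum (m - 2)) \<bullet> y = 0}"
    "{y \<in> flag m. (0, basis_enum (m - 1)) \<bullet> y = 0}"
    by (rule wedge_flag[OF m I R gen]) auto
  have bal: "balanced (flag (m - 2)) x G R \<longleftrightarrow> \<not> exposes (flag (m - 2)) x G R" if G: "R \<subseteq> G" "G \<subseteq> I" "card G = m" for G
  proof -
    have finG: "finite G" using G I finite_subset by blast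
    have genG: "generic (flag j) x G" if "j \<le> m" for j using gen[OF that] G(2) by (rule generic_mono)
    interpret G: wedge "flag m" "(0, basis_enum (m - 2))" "(0, basis_enum (m - 1))" x G R m
      "{y \<in> flag m. (0, basis_enum (m - 1)) \<bullet> y = 0 \<and> (0, basis_enum (m - 2)) \<bullet> y = 0}"
      "{y \<in> flag m. (0, basis_enum (m - 1)) \<bullet> y = 0}"
      by (rule wedge_flag[OF m finG _ G(1) R(2) genG]) (use G in auto)
    have "{H. R \<subseteq> H \<and> H \<subseteq> G \<and> card H = m} = {G}"
    proof -
      have "H = G" if "H \<subseteq> G" "card H = m" for H using card_subset_eq[OF finG that(1)] that(2) G(3) by simp
      then show ?thesis using G by auto
    qed
    moreover have "exposes (flag m) x G R" using m G finG genG by (intro exposes_full) auto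
    ultimately show ?thesis
      using G.exposes_difference unfolding G.facets_def flag_minus_2[OF m]
      by (cases "balanced (flag (m - 2)) x G R"; cases "exposes (flag (m - 2)) x G R") auto
  qed
  have "(\<Sum>G | R \<subseteq> G \<and> G \<subseteq> I \<and> card G = m. of_bool (balanced (flag (m - 2)) x G R) * (if G = I then 2 else of_bool (exposes (flag m) x I G)) :: real)
     = (\<Sum>G | R \<subseteq> G \<and> G \<subseteq> I \<and> card G = m. of_bool (\<not> exposes (flag (m - 2)) x G R) * (if G = I then 2 else of_bool (exposes (flag m) x I G)))"
  proof (rule sum.cong[OF refl])
    fix G assume "G \<in> {G. R \<subseteq> G \<and> G \<subseteq> I \<and> card G = m}"
    then have "R \<subseteq> G" "G \<subseteq> I" "card G = m" by auto
    then show "of_bool (balanced (flag (m - 2)) x G R) * (if G = I then 2 else of_bool (exposes (flag m) x I G) :: real)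
        = of_bool (\<not> exposes (flag (m - 2)) x G R) * (if G = I then 2 else of_bool (exposes (flag m) x I G))"
      by (simp only: bal)
  qed
  then show ?thesis
    using exposes_difference unfolding facets_def flag_minus_2[OF m] by simp
qed

section \<open>General position of the random rows\<close>

abbreviation row_measure :: "(real \<times> 'b::euclidean_space) measure" where
  "row_measure \<equiv> half_normal \<Otimes>\<^sub>M gauss"

lemma sets_row_measure: "sets (row_measure :: (real \<times> 'b::euclidean_space) measure) = sets borel"
proof -
  have "sets (row_measure :: (real \<times> 'b) measure) = sets (borel \<Otimes>\<^sub>M borel)"
    by (rule sets_pair_measure_cong) simp_all
  then show ?thesis by (simp only: borel_prod)
qed

lemma prob_space_row_measure: "prob_space (row_measure :: (real \<times> 'b::euclidean_space) measure)"
  by (intro prob_space_pair prob_space_half_normal prob_space_gauss)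

lemma row_measure_density:
  "row_measure = density lborel (\<lambda>x::real \<times> 'b::euclidean_space. ennreal (2 * gauss_density x * indicator {x. 0 < fst x} x))"
proof -
  have "row_measure = density (lborel \<Otimes>\<^sub>M lborel) (\<lambda>(a, v::'b). ennreal (2 * std_normal_density a * indicator {0<..} a) * ennreal (gauss_density v))"
    unfolding half_normal_def gauss_def
    by (rule pair_measure_density) (auto simp: gauss_def[symmetric] intro: gauss.sigma_finite_measure_axioms lborel.sigma_finite_measure_axioms)
  also have "(\<lambda>(a, v::'b). ennreal (2 * std_normal_density a * indicator {0<..} a) * ennreal (gauss_density v)) =
      (\<lambda>x. ennreal (2 * gauss_density x * indicator {x. 0 < fst x} x))"
  proof (rule ext, clarify)
    fix a and v :: 'b
    have "exp (- (norm (a, v))\<^sup>2 / 2) = exp (- (a\<^sup>2 / 2)) * exp (- (norm v)\<^sup>2 / 2)"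
      by (simp add: norm_Pair exp_add[symmetric] add_divide_distrib)
    then have "gauss_density (a, v) = std_normal_density a * gauss_density v"
      by (simp add: gauss_density_def std_normal_density_def)
    then show "ennreal (2 * std_normal_density a * indicator {0<..} a) * ennreal (gauss_density v)
      = ennreal (2 * gauss_density (a, v) * indicator {x. 0 < fst x} (a, v))"
      by (auto simp: indicator_def gauss_density_pos less_imp_le simp flip: ennreal_mult)
  qed
  finally show ?thesis by (simp only: lborel_prod)
qed

lemma AE_row_measure_hyperplane:
  fixes y :: "real \<times> 'b::euclidean_space"
  assumes y: "y \<noteq> 0"
  shows "AE x in row_measure. x \<bullet> y \<noteq> 0"
proof -
  have "negligible {x. y \<bullet> x = 0}" using y by (intro negligible_hyperplane) auto
  moreover have "{x. y \<bullet> x = 0} \<in> sets borel" by (intro borel_closed closed_hyperplane)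
  ultimately have "{x. y \<bullet> x = 0} \<in> null_sets lborel"
    by (simp add: negligible_iff_null_sets null_sets_completion_iff)
  then have "AE x in lborel. x \<bullet> y \<noteq> 0" by (auto dest: AE_not_in simp: inner_commute)
  moreover have [measurable]: "{x :: real \<times> 'b. 0 < fst x} \<in> sets borel"
    by (intro borel_open open_Collect_less continuous_intros)
  ultimately show ?thesis unfolding row_measure_density by (subst AE_density) (auto elim: eventually_mono)
qed

lemma measurable_row_component [measurable]:
  "i \<in> I \<Longrightarrow> (\<lambda>x. x i) \<in> borel_measurable (Pi\<^sub>M I (\<lambda>_. row_measure :: (real \<times> 'b::euclidean_space) measure))"
  by (subst measurable_cong_sets[OF refl sets_row_measure[symmetric]]) (rule measurable_component_singleton)

lemma AE_PiM_subset:
  assumes "finite I" "J \<subseteq> I" "\<And>i. prob_space (M i)" and P: "AE x in Pi\<^sub>M J M. P x"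
    and cong: "\<And>x. P (restrict x J) \<longleftrightarrow> P x"
  shows "AE x in Pi\<^sub>M I M. P x"
proof -
  have "product_prob_space M" using assms(3) by (rule product_prob_spaceI)
  moreover have "finite J" using assms(1,2) by (rule rev_finite_subset)
  ultimately have "distr (Pi\<^sub>M I M) (Pi\<^sub>M J M) (\<lambda>x. restrict x J) = Pi\<^sub>M J M"
    using assms(2) by (rule product_prob_space.distr_PiM_restrict_finite)
  then have "AE x in distr (Pi\<^sub>M I M) (Pi\<^sub>M J M) (\<lambda>x. restrict x J). P x"
    using P by (simp only:)
  then have "AE x in Pi\<^sub>M I M. P (restrict x J)"
    by (rule AE_distrD[rotated]) (rule measurable_restrict_subset[OF assms(2)])
  then show ?thesis by (simp only: cong)
qed

text \<open>One row is removed. By induction the others have trivial kernel in the smaller flag, a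
  hyperplane of the larger one, so in the larger flag their kernel is at most a line. The removed
  row is independent of the others and almost surely not orthogonal to that line.\<close>

lemma AE_trivial_kernel:
  fixes J :: "nat set"
  assumes "finite J" "card J = Suc m" "m \<le> DIM('b::euclidean_space)"
  shows "AE x in Pi\<^sub>M J (\<lambda>_. row_measure :: (real \<times> 'b) measure). \<not> (\<exists>y\<in>flag m. y \<noteq> 0 \<and> (\<Sum>i\<in>J. \<bar>x i \<bullet> y\<bar>) = 0)"
  using assms
proof (induction m arbitrary: J)
  case 0
  then obtain i where J: "J = {i}" by (auto simp: card_Suc_eq)
  have "AE p in row_measure. p \<bullet> (1, 0 :: 'b) \<noteq> 0" by (rule AE_row_measure_hyperplane) (simp add: zero_prod_def)
  then have "AE x in Pi\<^sub>M J (\<lambda>_. row_measure :: (real \<times> 'b) measure). x i \<bullet> (1, 0) \<noteq> 0"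
    using J by (intro AE_PiM_component prob_space_row_measure) auto
  then show ?case
  proof eventually_elim
    fix x :: "nat \<Rightarrow> real \<times> 'b" assume x: "x i \<bullet> (1, 0) \<noteq> 0"
    have "y = 0" if y: "y \<in> flag 0" "(\<Sum>i\<in>J. \<bar>x i \<bullet> y\<bar>) = 0" for y :: "real \<times> 'b"
    proof -
      have "snd y \<bullet> b = 0" if b: "b \<in> Basis" for b
      proof -
        obtain j where "b = basis_enum j" "j < DIM('b)"
          using b bij_betw_imp_surj_on[OF bij_betw_basis_enum[where 'b = 'b]] by blast
        then show ?thesis using y(1) by (auto simp: flag_def)
      qed
      then have "snd y = 0" using euclidean_all_zero_iff by blast
      moreover have "x i \<bullet> y = 0" using y(2) J by simp
      ultimately show "y = 0" using x by (cases y) (auto simp: inner_prod_def zero_prod_def)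
    qed
    then show "\<not> (\<exists>y\<in>flag 0. y \<noteq> 0 \<and> (\<Sum>i\<in>J. \<bar>x i \<bullet> y\<bar>) = 0)" by blast
  qed
next
  case (Suc m)
  obtain i J' where J: "J = insert i J'" "i \<notin> J'" "card J' = Suc m"
    using card_eq_SucD[OF Suc.prems(2)] by blast
  have finJ': "finite J'" using Suc.prems J by simp
  interpret row: prob_space "row_measure :: (real \<times> 'b) measure" by (rule prob_space_row_measure)
  interpret product_sigma_finite "\<lambda>_::nat. row_measure :: (real \<times> 'b) measure" by standard
  have m: "m < DIM('b)" using Suc.prems by simp
  define bad where "bad x \<longleftrightarrow> (\<exists>y\<in>flag (Suc m). y \<noteq> 0 \<and> (\<Sum>i\<in>J. \<bar>x i \<bullet> y\<bar>) = 0)" for x :: "nat \<Rightarrow> real \<times> 'b"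
  have [measurable]: "Measurable.pred (Pi\<^sub>M J (\<lambda>_. row_measure)) bad"
    unfolding bad_def by (intro measurable_ex_orthogonal subspace_flag) auto
  have IH: "AE x in Pi\<^sub>M J' (\<lambda>_. row_measure). \<not> (\<exists>y\<in>(flag m :: (real \<times> 'b) set). y \<noteq> 0 \<and> (\<Sum>i\<in>J'. \<bar>x i \<bullet> y\<bar>) = 0)"
    using Suc.IH[OF finJ' J(3)] m by simp
  have "(\<integral>\<^sup>+x. of_bool (bad x) \<partial>Pi\<^sub>M J (\<lambda>_. row_measure)) = (\<integral>\<^sup>+x. \<integral>\<^sup>+p. of_bool (bad (x(i := p))) \<partial>row_measure \<partial>Pi\<^sub>M J' (\<lambda>_. row_measure))"
    unfolding J(1) using finJ' J(2) by (intro product_nn_integral_insert) (auto simp flip: J(1))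
  also have "\<dots> = (\<integral>\<^sup>+x. 0 \<partial>Pi\<^sub>M J' (\<lambda>_. row_measure :: (real \<times> 'b) measure))"
  proof (intro nn_integral_cong_AE, use IH in eventually_elim)
    fix x :: "nat \<Rightarrow> real \<times> 'b" assume x: "\<not> (\<exists>y\<in>flag m. y \<noteq> 0 \<and> (\<Sum>i\<in>J'. \<bar>x i \<bullet> y\<bar>) = 0)"
    define f where "f = (0 :: real, basis_enum m :: 'b)"
    have flag_m: "flag m = {y \<in> flag (Suc m). f \<bullet> y = 0}" unfolding f_def using m by (rule flag_Suc)
    have x': "y = 0" if "y \<in> flag (Suc m)" "f \<bullet> y = 0" "\<And>j. j \<in> J' \<Longrightarrow> x j \<bullet> y = 0" for y
    proof -
      have "y \<in> flag m" "(\<Sum>i\<in>J'. \<bar>x i \<bullet> y\<bar>) = 0" using that by (simp_all add: flag_m)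
      then show ?thesis using x by blast
    qed
    have "AE p in row_measure. \<not> bad (x(i := p))"
    proof (cases "\<exists>z\<in>flag (Suc m). z \<noteq> 0 \<and> (\<forall>j\<in>J'. x j \<bullet> z = 0)")
      case True
      then obtain z where z: "z \<in> flag (Suc m)" "z \<noteq> 0" "\<And>j. j \<in> J' \<Longrightarrow> x j \<bullet> z = 0" by blast
      have fz: "f \<bullet> z \<noteq> 0" using x' z by blast
      from AE_row_measure_hyperplane[OF z(2)] show ?thesis
      proof eventually_elim
        fix p :: "real \<times> 'b" assume p: "p \<bullet> z \<noteq> 0"
        show "\<not> bad (x(i := p))"
        proof
          assume "bad (x(i := p))"
          then obtain y where y: "y \<in> flag (Suc m)" "y \<noteq> 0" "(\<Sum>j\<in>J. \<bar>(x(i := p)) j \<bullet> y\<bar>) = 0" by (auto simp: bad_def)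
          have "\<forall>j\<in>J. \<bar>(x(i := p)) j \<bullet> y\<bar> = 0" using y(3) Suc.prems(1) by (simp add: sum_nonneg_eq_0_iff)
          then have y0: "p \<bullet> y = 0" "\<And>j. j \<in> J' \<Longrightarrow> x j \<bullet> y = 0" using J by (auto split: if_splits)
          have "y - (f \<bullet> y / (f \<bullet> z)) *\<^sub>R z = 0"
            using y y0 z fz by (intro x') (auto intro!: subspace_diff subspace_scale subspace_flag simp: inner_diff_right)
          then have yz: "y = (f \<bullet> y / (f \<bullet> z)) *\<^sub>R z" by simp
          then have "(f \<bullet> y / (f \<bullet> z)) * (p \<bullet> z) = 0" using y0(1) by (metis inner_scaleR_right)
          then have "f \<bullet> y / (f \<bullet> z) = 0" using p by simp
          then show False using yz y(2) by (metis scaleR_zero_left)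
        qed
      qed
    next
      case False
      have "\<not> bad (x(i := p))" for p
      proof
        assume "bad (x(i := p))"
        then obtain y where y: "y \<in> flag (Suc m)" "y \<noteq> 0" "(\<Sum>j\<in>J. \<bar>(x(i := p)) j \<bullet> y\<bar>) = 0" by (auto simp: bad_def)
        have "\<forall>j\<in>J. \<bar>(x(i := p)) j \<bullet> y\<bar> = 0" using y(3) Suc.prems(1) by (simp add: sum_nonneg_eq_0_iff)
        then have "\<And>j. j \<in> J' \<Longrightarrow> x j \<bullet> y = 0" using J by (auto split: if_splits)
        then show False using y False by blast
      qed
      then show ?thesis by simp
    qed
    then have "(\<integral>\<^sup>+p. of_bool (bad (x(i := p))) \<partial>row_measure) = (\<integral>\<^sup>+p. 0 \<partial>(row_measure :: (real \<times> 'b) measure))"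
      by (intro nn_integral_cong_AE) (auto elim: eventually_mono)
    then show "(\<integral>\<^sup>+p. of_bool (bad (x(i := p))) \<partial>row_measure) = 0" by simp
  qed
  finally have "(\<integral>\<^sup>+x. of_bool (bad x) \<partial>Pi\<^sub>M J (\<lambda>_. row_measure)) = 0" by simp
  then have "AE x in Pi\<^sub>M J (\<lambda>_. row_measure). of_bool (bad x) = (0 :: ennreal)"
    by (subst (asm) nn_integral_0_iff_AE) auto
  then show ?case unfolding bad_def by (auto elim: eventually_mono)
qed

lemma AE_generic:
  assumes I: "finite I"
  shows "AE x in Pi\<^sub>M I (\<lambda>_. row_measure :: (real \<times> 'b::euclidean_space) measure). \<forall>m\<le>DIM('b). generic (flag m) x I"
proof -
  have "AE x in Pi\<^sub>M I (\<lambda>_. row_measure :: (real \<times> 'b) measure). \<not> (\<exists>y\<in>flag m. y \<noteq> 0 \<and> (\<Sum>i\<in>J. \<bar>x i \<bullet> y\<bar>) = 0)"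
    if "J \<subseteq> I" "card J = Suc m" "m \<le> DIM('b)" for J m
    by (rule AE_PiM_subset[OF I that(1) prob_space_row_measure AE_trivial_kernel])
      (use that I finite_subset in auto)
  then have "AE x in Pi\<^sub>M I (\<lambda>_. row_measure :: (real \<times> 'b) measure). \<forall>m\<in>{..DIM('b)}. \<forall>J\<in>{J. J \<subseteq> I \<and> card J = Suc m}. \<not> (\<exists>y\<in>flag m. y \<noteq> 0 \<and> (\<Sum>i\<in>J. \<bar>x i \<bullet> y\<bar>) = 0)"
    using I by (intro AE_finite_allI) auto
  then show ?thesis
  proof eventually_elim
    fix x :: "nat \<Rightarrow> real \<times> 'b"
    assume x: "\<forall>m\<in>{..DIM('b)}. \<forall>J\<in>{J. J \<subseteq> I \<and> card J = Suc m}. \<not> (\<exists>y\<in>flag m. y \<noteq> 0 \<and> (\<Sum>i\<in>J. \<bar>x i \<bullet> y\<bar>) = 0)"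
    show "\<forall>m\<le>DIM('b). generic (flag m) x I"
      unfolding generic_def
    proof (intro allI impI ballI)
      fix m J y assume m: "m \<le> DIM('b)" and J: "J \<subseteq> I" "card J = dim (flag m :: (real \<times> 'b) set)"
        and y: "y \<in> flag m" "\<forall>i\<in>J. x i \<bullet> y = 0"
      have "card J = Suc m" using J dim_flag[OF m] by simp
      moreover have "(\<Sum>i\<in>J. \<bar>x i \<bullet> y\<bar>) = 0" using y by simp
      ultimately show "y = 0" using x m J(1) y(1) by blast
    qed
  qed
qed

subsection \<open>Exposure probabilities\<close>

definition cauchy_cdf :: "real \<Rightarrow> real" where
  "cauchy_cdf t = 1 / 2 + arctan t / pi"

lemma cauchy_cdf_nonneg: "0 \<le> cauchy_cdf t"
  using arctan_lbound[of t] by (simp add: cauchy_cdf_def field_simps)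

lemma measurable_cauchy_cdf [measurable]: "cauchy_cdf \<in> borel_measurable borel"
  unfolding cauchy_cdf_def by measurable

text \<open>For N > 0 this is the probability that N independent rows lie strictly on the same side
  of the hyperplane orthogonal to y, where t = y_0/|y'|. For N = 0 the value is 2, in accordance
  with the weight of G = I.\<close>

definition one_sided_prob :: "nat \<Rightarrow> real \<Rightarrow> ennreal" where
  "one_sided_prob N t = ennreal (cauchy_cdf t ^ N) + ennreal (cauchy_cdf (- t) ^ N)"

lemma measurable_one_sided_prob [measurable]: "one_sided_prob N \<in> borel_measurable borel"
  unfolding one_sided_prob_def by measurable

lemma nn_integral_one_sided_prob:
  "(\<integral>\<^sup>+t. one_sided_prob N t * ennreal ((1 / sqrt (1 + t\<^sup>2)) ^ Suc (Suc p)) \<partial>lborel) =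
    2 * ennreal (sin_moment p N / pi ^ N)"
proof -
  let ?k = "\<lambda>t. ennreal (cauchy_cdf t ^ N) * ennreal ((1 / sqrt (1 + t\<^sup>2)) ^ Suc (Suc p))"
  have 1: "(\<integral>\<^sup>+t. ?k t \<partial>lborel) = ennreal (sin_moment p N / pi ^ N)"
    unfolding nn_integral_arctan_power[symmetric] cauchy_cdf_def[symmetric]
    by (intro nn_integral_cong ennreal_mult[symmetric] zero_le_power cauchy_cdf_nonneg) simp
  have "(\<integral>\<^sup>+t. one_sided_prob N t * ennreal ((1 / sqrt (1 + t\<^sup>2)) ^ Suc (Suc p)) \<partial>lborel) =
      (\<integral>\<^sup>+t. ?k t + ?k (- t) \<partial>lborel)"
    by (simp add: one_sided_prob_def distrib_right)
  also have "\<dots> = (\<integral>\<^sup>+t. ?k t \<partial>lborel) + (\<integral>\<^sup>+t. ?k (- t) \<partial>lborel)"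
    by (rule nn_integral_add) measurable
  also have "(\<integral>\<^sup>+t. ?k (- t) \<partial>lborel) = (\<integral>\<^sup>+t. ?k t \<partial>lborel)"
    using nn_integral_real_affine[of ?k "- 1" 0] by simp
  finally show ?thesis unfolding 1 by (simp add: mult_2)
qed

interpretation row: prob_space "row_measure :: (real \<times> 'b::euclidean_space) measure"
  by (rule prob_space_row_measure)

lemma nn_integral_all_positive:
  fixes y :: "real \<times> 'b::euclidean_space"
  assumes J: "finite J" and y: "snd y \<noteq> 0"
  shows "(\<integral>\<^sup>+x. of_bool (\<forall>i\<in>J. 0 < x i \<bullet> y) \<partial>Pi\<^sub>M J (\<lambda>_::nat. row_measure)) = ennreal (cauchy_cdf (fst y / norm (snd y)) ^ card J)"
proof -
  interpret product_sigma_finite "\<lambda>_::nat. row_measure :: (real \<times> 'b) measure" by standard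
  have open_half: "{p. 0 < p \<bullet> y} \<in> sets borel"
    by (intro borel_open open_Collect_less continuous_intros)
  then have half [measurable]: "{p. 0 < p \<bullet> y} \<in> sets row_measure" by (simp only: sets_row_measure)
  have "(\<integral>\<^sup>+x. of_bool (\<forall>i\<in>J. 0 < x i \<bullet> y) \<partial>Pi\<^sub>M J (\<lambda>_::nat. row_measure)) = (\<integral>\<^sup>+x. (\<Prod>i\<in>J. indicator {p. 0 < p \<bullet> y} (x i)) \<partial>Pi\<^sub>M J (\<lambda>_::nat. row_measure))"
    using J by (intro nn_integral_cong) (auto simp: indicator_def)
  also have "\<dots> = (\<Prod>i\<in>J. \<integral>\<^sup>+p. indicator {p. 0 < p \<bullet> y} p \<partial>row_measure)"
    using J by (intro product_nn_integral_prod) auto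
  also have "\<dots> = emeasure row_measure {p. 0 < p \<bullet> y} ^ card J"
    by (simp only: nn_integral_indicator[OF half] prod_constant)
  also have "emeasure row_measure {p. 0 < p \<bullet> y} = ennreal (cauchy_cdf (fst y / norm (snd y)))"
    using emeasure_open_half_space[OF y, of "fst y"] by (simp add: cauchy_cdf_def)
  finally show ?thesis by (simp add: ennreal_power cauchy_cdf_nonneg)
qed

text \<open>The rows of G determine the exposing vector up to a factor, so G is exposed iff all
  other rows lie on the side of y or all on the side of -y. For G different from I these events are
  disjoint.\<close>

lemma nn_integral_exposes_facet:
  fixes x :: "nat \<Rightarrow> real \<times> 'b::euclidean_space"
  assumes I: "finite I" "G \<subseteq> I"
    and y: "y \<in> flag m" "\<And>i. i \<in> G \<Longrightarrow> x i \<bullet> y = 0" "snd y \<noteq> 0"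
    and uniq: "\<And>w. w \<in> flag m \<Longrightarrow> (\<And>i. i \<in> G \<Longrightarrow> x i \<bullet> w = 0) \<Longrightarrow> \<exists>s. w = s *\<^sub>R y"
  shows "(\<integral>\<^sup>+x'. (if G = I then 2 else of_bool (exposes (flag m) (merge G (I - G) (x, x')) I G)) \<partial>Pi\<^sub>M (I - G) (\<lambda>_. row_measure))
     = one_sided_prob (card (I - G)) (fst y / norm (snd y))"
proof (cases "G = I")
  case True
  interpret P: prob_space "Pi\<^sub>M {} (\<lambda>_::nat. row_measure :: (real \<times> 'b) measure)" by (rule prob_space_PiM) (rule prob_space_row_measure)
  show ?thesis using True P.emeasure_space_1 by (simp add: one_sided_prob_def)
next
  case False
  define J where "J = I - G"
  have J: "finite J" "J \<noteq> {}" using False I by (auto simp: J_def)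
  have [measurable]: "Measurable.pred (Pi\<^sub>M J (\<lambda>_. row_measure)) (\<lambda>x'. 0 < x' i \<bullet> w)" if "i \<in> J" for i and w :: "real \<times> 'b"
  proof -
    have "(\<lambda>x'. x' i) \<in> borel_measurable (Pi\<^sub>M J (\<lambda>_. row_measure :: (real \<times> 'b) measure))"
      using that by (rule measurable_row_component)
    moreover have "Measurable.pred borel (\<lambda>p. 0 < p \<bullet> w)"
      unfolding pred_def using borel_open[OF open_Collect_less[of "\<lambda>_. 0" "\<lambda>p. p \<bullet> w"]] by (simp add: continuous_intros)
    ultimately show ?thesis by (rule measurable_compose)
  qed
  have ex: "exposes (flag m) (merge G J (x, x')) I G \<longleftrightarrow> (\<forall>i\<in>J. 0 < x' i \<bullet> y) \<or> (\<forall>i\<in>J. 0 < x' i \<bullet> - y)" for x'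
  proof
    assume "exposes (flag m) (merge G J (x, x')) I G"
    then obtain w where w: "w \<in> flag m" "\<And>i. i \<in> G \<Longrightarrow> x i \<bullet> w = 0" "\<And>i. i \<in> J \<Longrightarrow> 0 < x' i \<bullet> w"
      by (auto simp: exposes_def J_def)
    then obtain s where s: "w = s *\<^sub>R y" using uniq by blast
    show "(\<forall>i\<in>J. 0 < x' i \<bullet> y) \<or> (\<forall>i\<in>J. 0 < x' i \<bullet> - y)"
    proof (cases "0 < s")
      case True
      then show ?thesis using w(3) by (auto simp: s zero_less_mult_iff)
    next
      case False
      then have "s < 0 \<or> s = 0" by auto
      then show ?thesis using w(3) J(2) by (auto simp: s zero_less_mult_iff)
    qed
  next
    have mG: "merge G J (x, x') i = x i" if "i \<in> G" for i using that by (simp add: merge_def)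
    have mJ: "merge G J (x, x') i = x' i" if "i \<in> J" for i using that by (simp add: merge_def J_def)
    have *: "exposes (flag m) (merge G J (x, x')) I G" if "w \<in> flag m" "\<forall>i\<in>G. x i \<bullet> w = 0" "\<forall>i\<in>J. 0 < x' i \<bullet> w" for w
      unfolding exposes_def J_def[symmetric] using that mG mJ by (intro bexI[of _ w]) auto
    have ny: "- y \<in> flag m" using y(1) subspace_neg[OF subspace_flag] by blast
    assume "(\<forall>i\<in>J. 0 < x' i \<bullet> y) \<or> (\<forall>i\<in>J. 0 < x' i \<bullet> - y)"
    then show "exposes (flag m) (merge G J (x, x')) I G"
    proof
      assume "\<forall>i\<in>J. 0 < x' i \<bullet> y" then show ?thesis using *[OF y(1)] y(2) by blast
    next
      assume "\<forall>i\<in>J. 0 < x' i \<bullet> - y" then show ?thesis using *[OF ny] y(2) by auto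
    qed
  qed
  have dis: "\<not> ((\<forall>i\<in>J. 0 < x' i \<bullet> y) \<and> (\<forall>i\<in>J. 0 < x' i \<bullet> - y))" for x'
  proof -
    obtain i where i: "i \<in> J" using J(2) by blast
    have "\<not> (0 < x' i \<bullet> y \<and> 0 < x' i \<bullet> - y)" by simp
    then show ?thesis using i by blast
  qed
  have "(\<integral>\<^sup>+x'. of_bool (exposes (flag m) (merge G J (x, x')) I G) \<partial>Pi\<^sub>M J (\<lambda>_. row_measure))
     = (\<integral>\<^sup>+x'. of_bool (\<forall>i\<in>J. 0 < x' i \<bullet> y) + of_bool (\<forall>i\<in>J. 0 < x' i \<bullet> - y) \<partial>Pi\<^sub>M J (\<lambda>_. row_measure))"
    using dis by (intro nn_integral_cong) (auto simp: ex)
  also have "\<dots> = (\<integral>\<^sup>+x'. of_bool (\<forall>i\<in>J. 0 < x' i \<bullet> y) \<partial>Pi\<^sub>M J (\<lambda>_. row_measure)) + (\<integral>\<^sup>+x'. of_bool (\<forall>i\<in>J. 0 < x' i \<bullet> - y) \<partial>Pi\<^sub>M J (\<lambda>_. row_measure))"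
    using J(1) by (intro nn_integral_add) measurable
  also have "\<dots> = one_sided_prob (card J) (fst y / norm (snd y))"
    using nn_integral_all_positive[OF J(1) y(3)] nn_integral_all_positive[OF J(1), of "- y"] y(3)
    by (simp add: one_sided_prob_def)
  finally show ?thesis using False by (simp add: J_def)
qed

text \<open>The counterpart of \<open>kernel_vector\<close> for flags, with the same construction.
  The component of y along the last basis vector is 1, so \<open>snd y\<close> is nonzero and the
  quotient \<open>fst y / norm (snd y)\<close> is meaningful.\<close>

lemma generic_kernel_vector:
  fixes x :: "nat \<Rightarrow> real \<times> 'b::euclidean_space"
  assumes m: "1 \<le> m" "m \<le> DIM('b)" and G: "finite G" "card G = m" and gen: "generic (flag (m - 1)) x G"
  obtains y where "y \<in> flag m" "\<And>i. i \<in> G \<Longrightarrow> x i \<bullet> y = 0" "snd y \<noteq> 0"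
    "\<And>w. w \<in> flag m \<Longrightarrow> (\<And>i. i \<in> G \<Longrightarrow> x i \<bullet> w = 0) \<Longrightarrow> \<exists>s. w = s *\<^sub>R y"
proof -
  define f where "f = (0 :: real, basis_enum (m - 1) :: 'b)"
  have f: "f \<in> flag m" "f \<bullet> f = 1"
    using m basis_enum_in_flag[of "m - 1" m, where 'b = 'b] inner_basis_enum[of "m - 1" "m - 1", where 'b = 'b]
    by (auto simp: f_def inner_prod_def)
  have flag: "flag (m - 1) = {y \<in> flag m. f \<bullet> y = 0}"
    using flag_Suc[of "m - 1", where 'b = 'b] m by (simp add: f_def)
  have d: "dim (flag (m - 1) :: (real \<times> 'b) set) = m" using dim_flag[of "m - 1", where 'b = 'b] m by simp
  obtain z where z: "z \<in> flag (m - 1)" "\<forall>i\<in>G. x i \<bullet> z = x i \<bullet> f"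
    using generic_solvable[OF gen subspace_flag G(1), of G "\<lambda>i. x i \<bullet> f"] G d by auto
  have zf: "z \<in> flag m" "f \<bullet> z = 0" using z(1) unfolding flag by auto
  define y where "y = f - z"
  have y: "y \<in> flag m" "f \<bullet> y = 1" "\<And>i. i \<in> G \<Longrightarrow> x i \<bullet> y = 0"
    using f z(2) zf by (auto simp: y_def inner_diff_right intro: subspace_diff subspace_flag)
  show ?thesis
  proof (rule that[OF y(1,3)])
    show "snd y \<noteq> 0" using y(2) by (auto simp: f_def inner_prod_def)
    fix w assume w: "w \<in> flag m" "\<And>i. i \<in> G \<Longrightarrow> x i \<bullet> w = 0"
    have A: "w - (f \<bullet> w) *\<^sub>R y \<in> flag (m - 1)"
      unfolding flag
    proof (intro CollectI conjI)
      show "w - (f \<bullet> w) *\<^sub>R y \<in> flag m"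
        using w(1) y(1) by (intro subspace_diff subspace_scale subspace_flag)
      show "f \<bullet> (w - (f \<bullet> w) *\<^sub>R y) = 0" by (simp only: inner_diff_right inner_scaleR_right y(2) mult_1_right diff_self)
    qed
    have B: "x i \<bullet> (w - (f \<bullet> w) *\<^sub>R y) = 0" if "i \<in> G" for i
      by (simp only: inner_diff_right inner_scaleR_right w(2)[OF that] y(3)[OF that] mult_zero_right diff_self)
    have "card G = dim (flag (m - 1) :: (real \<times> 'b) set)" using G(2) d by simp
    then have "w - (f \<bullet> w) *\<^sub>R y = 0"
      by (rule gen[unfolded generic_def, rule_format, OF order_refl _ A B])
    then show "\<exists>s. w = s *\<^sub>R y" by (intro exI[of _ "f \<bullet> w"]) simp
  qed
qed

lemma AE_PiM_pair:
  fixes M :: "'a measure" and N :: "'c measure"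
  assumes sf: "sigma_finite_measure M" "sigma_finite_measure N" and J: "finite (J :: nat set)"
    and P: "AE x in Pi\<^sub>M J (\<lambda>_. M \<Otimes>\<^sub>M N). P x"
  shows "AE a in Pi\<^sub>M J (\<lambda>_. M). AE v in Pi\<^sub>M J (\<lambda>_. N). P (\<lambda>i\<in>J. (a i, v i))"
proof -
  interpret M: sigma_finite_measure M by fact
  interpret N: sigma_finite_measure N by fact
  interpret pN: product_sigma_finite "\<lambda>_::nat. N" by standard
  have sN: "sigma_finite_measure (Pi\<^sub>M J (\<lambda>_. N))" by (rule pN.sigma_finite) (rule J)
  obtain Z where Z: "{x \<in> space (Pi\<^sub>M J (\<lambda>_. M \<Otimes>\<^sub>M N)). \<not> P x} \<subseteq> Z" "emeasure (Pi\<^sub>M J (\<lambda>_. M \<Otimes>\<^sub>M N)) Z = 0"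
    and Zs: "Z \<in> sets (Pi\<^sub>M J (\<lambda>_. M \<Otimes>\<^sub>M N))"
    using P by (rule AE_E)
  have ind [measurable]: "indicator Z \<in> borel_measurable (Pi\<^sub>M J (\<lambda>_. M \<Otimes>\<^sub>M N))" using Zs by (rule borel_measurable_indicator)
  have pair: "(\<lambda>(a, v). \<lambda>i\<in>J. (a i, v i)) \<in> (Pi\<^sub>M J (\<lambda>_. M) \<Otimes>\<^sub>M Pi\<^sub>M J (\<lambda>_. N)) \<rightarrow>\<^sub>M Pi\<^sub>M J (\<lambda>_. M \<Otimes>\<^sub>M N)"
    unfolding case_prod_beta by measurable
  have m: "(\<lambda>(a, v). indicator Z (\<lambda>i\<in>J. (a i, v i)) :: ennreal) \<in> borel_measurable (Pi\<^sub>M J (\<lambda>_. M) \<Otimes>\<^sub>M Pi\<^sub>M J (\<lambda>_. N))"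
    using measurable_compose[OF pair ind] by (simp add: case_prod_beta')
  have "0 = (\<integral>\<^sup>+x. indicator Z x \<partial>Pi\<^sub>M J (\<lambda>_. M \<Otimes>\<^sub>M N))" using Z(2) Zs by simp
  also have "\<dots> = (\<integral>\<^sup>+a. \<integral>\<^sup>+v. indicator Z (\<lambda>i\<in>J. (a i, v i)) \<partial>Pi\<^sub>M J (\<lambda>_. N) \<partial>Pi\<^sub>M J (\<lambda>_. M))"
    by (rule nn_integral_PiM_pair[OF sf J ind])
  finally have "AE a in Pi\<^sub>M J (\<lambda>_. M). (\<integral>\<^sup>+v. indicator Z (\<lambda>i\<in>J. (a i, v i)) \<partial>Pi\<^sub>M J (\<lambda>_. N)) = 0"
    using sigma_finite_measure.borel_measurable_nn_integral[OF sN m] by (subst (asm) eq_commute) (simp add: nn_integral_0_iff_AE)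
  then show ?thesis
    using AE_space
  proof eventually_elim
    fix a assume a: "(\<integral>\<^sup>+v. indicator Z (\<lambda>i\<in>J. (a i, v i)) \<partial>Pi\<^sub>M J (\<lambda>_. N)) = 0" "a \<in> space (Pi\<^sub>M J (\<lambda>_. M))"
    have "(\<lambda>v. indicator Z (\<lambda>i\<in>J. (a i, v i)) :: ennreal) \<in> borel_measurable (Pi\<^sub>M J (\<lambda>_. N))"
      using measurable_Pair2[OF m a(2)] by simp
    then have "AE v in Pi\<^sub>M J (\<lambda>_. N). (indicator Z (\<lambda>i\<in>J. (a i, v i)) :: ennreal) = 0"
      using a(1) by (simp add: nn_integral_0_iff_AE)
    then show "AE v in Pi\<^sub>M J (\<lambda>_. N). P (\<lambda>i\<in>J. (a i, v i))"
      using AE_space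
    proof eventually_elim
      fix v assume v: "(indicator Z (\<lambda>i\<in>J. (a i, v i)) :: ennreal) = 0" "v \<in> space (Pi\<^sub>M J (\<lambda>_. N))"
      have "(\<lambda>i\<in>J. (a i, v i)) \<in> space (Pi\<^sub>M J (\<lambda>_. M \<Otimes>\<^sub>M N))"
        using measurable_space[OF pair, of "(a, v)"] a(2) v(2) by (simp add: space_pair_measure)
      moreover have "(\<lambda>i\<in>J. (a i, v i)) \<notin> Z" using v(1) by (auto simp: indicator_def split: if_splits)
      ultimately show "P (\<lambda>i\<in>J. (a i, v i))" using Z(1) by blast
    qed
  qed
qed

text \<open>Adding \<open>a\<^sub>i t\<close> to all \<open>v\<^sub>i\<close> moves the vectors orthogonal to the rows by a linear shear.\<close>

lemma inner_shift_row:
  fixes p y :: "real \<times> 'b::euclidean_space"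
  shows "(fst p, snd p + fst p *\<^sub>R t) \<bullet> (fst y - t \<bullet> snd y, snd y) = p \<bullet> y"
  by (simp add: inner_prod_def inner_add_left algebra_simps)

text \<open>Mixing is a shear by a common vector t. As v_l.y' = - a_l y_0 for the kernel vector, the
  component of v along a/|a| has the product - |a| y_0 with y'. Replacing that component by \<xi>
  erases y_0, so the new first coordinate depends only on \<xi>, y' and |a|.\<close>

lemma mix_kernel:
  fixes v :: "nat \<Rightarrow> 'b::euclidean_space" and \<xi> :: 'b
  assumes G: "finite G" "G \<noteq> {}" and a: "\<And>i. i \<in> G \<Longrightarrow> 0 < a i"
    and y: "\<And>i. i \<in> G \<Longrightarrow> (a i, v i) \<bullet> y = 0"
  defines "t \<equiv> (\<xi> - (\<Sum>l\<in>G. (a l / L2_set a G) *\<^sub>R v l)) /\<^sub>R L2_set a G"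
  shows "\<And>i. i \<in> G \<Longrightarrow> mix G a v \<xi> i = v i + a i *\<^sub>R t"
    and "fst y - t \<bullet> snd y = - (\<xi> \<bullet> snd y) / L2_set a G"
proof -
  define L where "L = L2_set a G"
  have L: "0 < L" unfolding L_def using G a by (rule L2_set_pos)
  show "mix G a v \<xi> i = v i + a i *\<^sub>R t" if "i \<in> G" for i
    using that by (simp add: mix_def t_def divide_inverse)
  have L2: "(\<Sum>i\<in>G. (a i)\<^sup>2) = L\<^sup>2" by (simp add: L_def L2_set_def sum_nonneg)
  have vy: "v i \<bullet> snd y = - (a i * fst y)" if "i \<in> G" for i
    using y[OF that] by (simp add: inner_prod_def)
  have "(\<Sum>l\<in>G. (a l / L) *\<^sub>R v l) \<bullet> snd y = (\<Sum>l\<in>G. (a l)\<^sup>2 * (- (fst y / L)))"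
    unfolding inner_sum_left by (rule sum.cong) (simp_all add: vy power2_eq_square)
  also have "\<dots> = L\<^sup>2 * (- (fst y / L))" unfolding L2[symmetric] by (rule sum_distrib_right[symmetric])
  finally have "(\<Sum>l\<in>G. (a l / L) *\<^sub>R v l) \<bullet> snd y = - (L\<^sup>2 / L * fst y)" by simp
  then show "fst y - t \<bullet> snd y = - (\<xi> \<bullet> snd y) / L2_set a G"
    using L unfolding t_def L_def[symmetric] by (simp add: inner_diff_left power2_eq_square field_simps)
qed

text \<open>The rows outside G enter only through the quotient q = y_0/|y'| of the kernel vector y
  of G. Mixing the rows of G resamples q and leaves B alone, by invariance under shears; invariance
  under scaling then separates B from q. Hence I affects only the moment, while the condition B
  affects only the constant.\<close>

theorem nn_integral_facet:
  fixes B :: "(nat \<Rightarrow> real \<times> 'b::euclidean_space) \<Rightarrow> bool"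
  assumes I: "finite I" "G \<subseteq> I" and m: "card G = m" "1 \<le> m" "m \<le> DIM('b)"
    and B [measurable]: "Measurable.pred (Pi\<^sub>M G (\<lambda>_. row_measure)) B"
    and B_cong: "\<And>x x'. (\<And>i. i \<in> G \<Longrightarrow> x i = x' i) \<Longrightarrow> B x \<longleftrightarrow> B x'"
    and B_shift: "\<And>x t. B (\<lambda>i. (fst (x i), snd (x i) + fst (x i) *\<^sub>R t)) \<longleftrightarrow> B x"
    and B_scale: "\<And>x r. 0 < r \<Longrightarrow> B (\<lambda>i. (fst (x i) / r, snd (x i))) \<longleftrightarrow> B x"
  shows "(\<integral>\<^sup>+x. of_bool (B x) * (if G = I then 2 else of_bool (exposes (flag m) x I G)) \<partial>Pi\<^sub>M I (\<lambda>_. row_measure)) =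
    mixing_constant G (\<lambda>a v. B (\<lambda>i. (a i, v i))) * (2 * ennreal (sin_moment (m - 1) (card (I - G)) / pi ^ card (I - G)))"
proof -
  let ?R = "row_measure :: (real \<times> 'b) measure"
  interpret product_sigma_finite "\<lambda>_::nat. ?R" by standard
  define J where "J = I - G"
  have J: "finite J" "finite G" "G \<inter> J = {}" "I = G \<union> J" "G \<noteq> {}"
    using I m finite_subset by (auto simp: J_def)
  define N where "N x = (if G = I then 2 else of_bool (exposes (flag m) x I G) :: ennreal)" for x :: "nat \<Rightarrow> real \<times> 'b"
  have exm: "Measurable.pred (Pi\<^sub>M I (\<lambda>_. ?R)) (\<lambda>x. exposes (flag m) x I G)"
    using I by (intro measurable_exposes subspace_flag measurable_row_component)
  then have N_meas [measurable]: "N \<in> borel_measurable (Pi\<^sub>M I (\<lambda>_. ?R))" unfolding N_def by measurable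
  have BI: "Measurable.pred (Pi\<^sub>M I (\<lambda>_. ?R)) B"
  proof -
    have "Measurable.pred (Pi\<^sub>M I (\<lambda>_. ?R)) (\<lambda>x. B (restrict x G))"
      by (rule measurable_compose[OF measurable_restrict_subset[OF I(2)] B])
    moreover have "B (restrict x G) = B x" for x by (rule B_cong) simp
    ultimately show ?thesis by simp
  qed
  define \<Psi> where "\<Psi> x = of_bool (B x) * (\<integral>\<^sup>+x'. N (merge G J (x, x')) \<partial>Pi\<^sub>M J (\<lambda>_. ?R))" for x
  have sJ: "sigma_finite_measure (Pi\<^sub>M J (\<lambda>_. ?R))" by (rule sigma_finite) (rule J(1))
  have N_merge: "(\<lambda>(x, x'). N (merge G J (x, x'))) \<in> borel_measurable (Pi\<^sub>M G (\<lambda>_. ?R) \<Otimes>\<^sub>M Pi\<^sub>M J (\<lambda>_. ?R))"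
    using measurable_compose[OF measurable_merge N_meas[unfolded J(4)]] by simp
  have \<Psi>_meas [measurable]: "\<Psi> \<in> borel_measurable (Pi\<^sub>M G (\<lambda>_. ?R))"
    unfolding \<Psi>_def using sigma_finite_measure.borel_measurable_nn_integral[OF sJ N_merge] by measurable
  have \<Psi>_eq: "\<Psi> x = of_bool (B x) * one_sided_prob (card J) (fst y / norm (snd y))"
    if "y \<in> flag m" "\<And>i. i \<in> G \<Longrightarrow> x i \<bullet> y = 0" "snd y \<noteq> 0"
      "\<And>w. w \<in> flag m \<Longrightarrow> (\<And>i. i \<in> G \<Longrightarrow> x i \<bullet> w = 0) \<Longrightarrow> \<exists>s. w = s *\<^sub>R y" for x y
    using nn_integral_exposes_facet[OF I that] unfolding \<Psi>_def N_def J_def[symmetric] by simp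
  have "(\<integral>\<^sup>+x. of_bool (B x) * N x \<partial>Pi\<^sub>M I (\<lambda>_. ?R)) =
      (\<integral>\<^sup>+x. \<integral>\<^sup>+x'. of_bool (B (merge G J (x, x'))) * N (merge G J (x, x')) \<partial>Pi\<^sub>M J (\<lambda>_. ?R) \<partial>Pi\<^sub>M G (\<lambda>_. ?R))"
    unfolding J(4) using J BI by (intro product_nn_integral_fold) (auto simp flip: J(4))
  also have "\<dots> = (\<integral>\<^sup>+x. \<Psi> x \<partial>Pi\<^sub>M G (\<lambda>_. ?R))"
  proof (rule nn_integral_cong)
    fix x assume x: "x \<in> space (Pi\<^sub>M G (\<lambda>_. ?R))"
    have "B (merge G J (x, x')) = B x" for x' by (rule B_cong) (simp add: merge_def)
    moreover have "(\<lambda>x'. N (merge G J (x, x'))) \<in> borel_measurable (Pi\<^sub>M J (\<lambda>_. ?R))"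
      using measurable_Pair2[OF N_merge x] by simp
    ultimately show "(\<integral>\<^sup>+x'. of_bool (B (merge G J (x, x'))) * N (merge G J (x, x')) \<partial>Pi\<^sub>M J (\<lambda>_. ?R)) = \<Psi> x"
      by (simp add: \<Psi>_def nn_integral_cmult)
  qed
  also have "\<dots> = (\<integral>\<^sup>+a. \<integral>\<^sup>+v. \<Psi> (\<lambda>i\<in>G. (a i, v i)) \<partial>Pi\<^sub>M G (\<lambda>_. gauss) \<partial>Pi\<^sub>M G (\<lambda>_. half_normal))"
    by (rule nn_integral_PiM_pair[OF half_normal.sigma_finite_measure_axioms gauss.sigma_finite_measure_axioms J(2) \<Psi>_meas])
  also have "\<dots> = mixing_constant G (\<lambda>a v. B (\<lambda>i. (a i, v i))) *
      (\<integral>\<^sup>+t. one_sided_prob (card J) t * ennreal ((1 / sqrt (1 + t\<^sup>2)) ^ Suc (card G)) \<partial>lborel)"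
  proof (rule nn_integral_half_normal_gauss_mix[OF J(2,5)])
    have pair: "(\<lambda>(a, v). \<lambda>i\<in>G. (a i, v i)) \<in> (Pi\<^sub>M G (\<lambda>_. half_normal) \<Otimes>\<^sub>M Pi\<^sub>M G (\<lambda>_. gauss)) \<rightarrow>\<^sub>M Pi\<^sub>M G (\<lambda>_. ?R)"
      unfolding case_prod_beta by measurable
    show "(\<lambda>(a, v). \<Psi> (\<lambda>i\<in>G. (a i, v i))) \<in> borel_measurable (Pi\<^sub>M G (\<lambda>_. half_normal) \<Otimes>\<^sub>M Pi\<^sub>M G (\<lambda>_. gauss))"
      using measurable_compose[OF pair \<Psi>_meas] by (simp add: case_prod_beta')
    have "B (\<lambda>i\<in>G. (a i, v i)) = B (\<lambda>i. (a i, v i))" for a v by (rule B_cong) simp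
    then show "Measurable.pred (Pi\<^sub>M G (\<lambda>_. half_normal) \<Otimes>\<^sub>M Pi\<^sub>M G (\<lambda>_. gauss)) (\<lambda>(a, v). B (\<lambda>i. (a i, v i)))"
      using measurable_compose[OF pair B] by (simp add: case_prod_beta')
    show "one_sided_prob (card J) \<in> borel_measurable borel" by measurable
    show "B (\<lambda>i. ((\<lambda>i\<in>G. a i / r) i, v i)) = B (\<lambda>i. (a i, v i))" if "0 < r" for a v r
    proof -
      have "B (\<lambda>i. ((\<lambda>i\<in>G. a i / r) i, v i)) = B (\<lambda>i. (fst (a i, v i) / r, snd (a i, v i)))"
        by (rule B_cong) simp
      also have "\<dots> = B (\<lambda>i. (a i, v i))" using B_scale[OF that, of "\<lambda>i. (a i, v i)"] by simp
      finally show ?thesis .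
    qed
    have gen: "AE a in Pi\<^sub>M G (\<lambda>_. half_normal). AE v in Pi\<^sub>M G (\<lambda>_. gauss :: 'b measure).
        \<forall>j\<le>DIM('b). generic (flag j) (\<lambda>i\<in>G. (a i, v i)) G"
      by (rule AE_PiM_pair[OF half_normal.sigma_finite_measure_axioms gauss.sigma_finite_measure_axioms J(2) AE_generic[OF J(2)]])
    show "AE a in Pi\<^sub>M G (\<lambda>_. half_normal). AE v in Pi\<^sub>M G (\<lambda>_. gauss :: 'b measure). \<exists>u. norm u = 1 \<and>
      (\<forall>\<xi>. \<Psi> (\<lambda>i\<in>G. (a i, mix G a v \<xi> i)) = of_bool (B (\<lambda>i. (a i, v i))) * one_sided_prob (card J) ((\<xi> \<bullet> u) / L2_set a G))"
      using AE_PiM_half_normal_pos[OF J(2)] gen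
    proof eventually_elim
      fix a :: "nat \<Rightarrow> real"
      assume a: "\<forall>i\<in>G. 0 < a i" and "AE v in Pi\<^sub>M G (\<lambda>_. gauss :: 'b measure). \<forall>j\<le>DIM('b). generic (flag j) (\<lambda>i\<in>G. (a i, v i)) G"
      from this(2) show "AE v in Pi\<^sub>M G (\<lambda>_. gauss :: 'b measure). \<exists>u. norm u = 1 \<and>
        (\<forall>\<xi>. \<Psi> (\<lambda>i\<in>G. (a i, mix G a v \<xi> i)) = of_bool (B (\<lambda>i. (a i, v i))) * one_sided_prob (card J) ((\<xi> \<bullet> u) / L2_set a G))"
      proof eventually_elim
        fix v :: "nat \<Rightarrow> 'b" assume g: "\<forall>j\<le>DIM('b). generic (flag j) (\<lambda>i\<in>G. (a i, v i)) G"
        then have gm: "generic (flag (m - 1)) (\<lambda>i\<in>G. (a i, v i)) G" using m by simp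
        obtain y where y0: "y \<in> flag m" "\<And>i. i \<in> G \<Longrightarrow> (\<lambda>i\<in>G. (a i, v i)) i \<bullet> y = 0" "snd y \<noteq> 0"
          "\<And>w. w \<in> flag m \<Longrightarrow> (\<And>i. i \<in> G \<Longrightarrow> (\<lambda>i\<in>G. (a i, v i)) i \<bullet> w = 0) \<Longrightarrow> \<exists>s. w = s *\<^sub>R y"
          using generic_kernel_vector[OF m(2,3) J(2) m(1) gm] by blast
        have y: "\<And>i. i \<in> G \<Longrightarrow> (a i, v i) \<bullet> y = 0" using y0(2) by simp
        have uniq: "\<exists>s. w = s *\<^sub>R y" if "w \<in> flag m" "\<And>i. i \<in> G \<Longrightarrow> (a i, v i) \<bullet> w = 0" for w
          using y0(4)[OF that(1)] that(2) by simp
        have L: "0 < L2_set a G" using J a by (intro L2_set_pos) auto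
        show "\<exists>u. norm u = 1 \<and> (\<forall>\<xi>. \<Psi> (\<lambda>i\<in>G. (a i, mix G a v \<xi> i)) = of_bool (B (\<lambda>i. (a i, v i))) * one_sided_prob (card J) ((\<xi> \<bullet> u) / L2_set a G))"
        \<comment> \<open>The minus sign cancels the one in the first coordinate of the sheared
          kernel vector.\<close>
        proof (intro exI[of _ "- (snd y /\<^sub>R norm (snd y))"] conjI allI)
          show "norm (- (snd y /\<^sub>R norm (snd y))) = 1" using y0(3) by simp
          fix \<xi> :: 'b
          define t where "t = (\<xi> - (\<Sum>l\<in>G. (a l / L2_set a G) *\<^sub>R v l)) /\<^sub>R L2_set a G"
          define x where "x = (\<lambda>i\<in>G. (a i, mix G a v \<xi> i))"
          define y' where "y' = (fst y - t \<bullet> snd y, snd y)"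
          have mixi: "mix G a v \<xi> i = v i + a i *\<^sub>R t" if "i \<in> G" for i
            unfolding t_def using a y that by (intro mix_kernel(1)[OF J(2,5)]) auto
          have fst_y': "fst y' = - (\<xi> \<bullet> snd y) / L2_set a G"
            unfolding y'_def t_def fst_conv using a y by (intro mix_kernel(2)[OF J(2,5)]) auto
          have xi: "x i \<bullet> (fst w - t \<bullet> snd w, snd w) = (a i, v i) \<bullet> w" if "i \<in> G" for i w
            using inner_shift_row[of "(a i, v i)" t w] that by (simp add: x_def mixi)
          have "\<Psi> x = of_bool (B x) * one_sided_prob (card J) (fst y' / norm (snd y'))"
          proof (rule \<Psi>_eq)
            show "y' \<in> flag m" using y0(1) by (simp add: y'_def flag_def)
            show "x i \<bullet> y' = 0" if "i \<in> G" for i using xi[OF that] y[OF that] by (simp add: y'_def)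
            show "snd y' \<noteq> 0" using y0(3) by (simp add: y'_def)
            fix w assume w: "w \<in> flag m" "\<And>i. i \<in> G \<Longrightarrow> x i \<bullet> w = 0"
            \<comment> \<open>The shear is undone, which reduces uniqueness for the mixed rows to
              uniqueness for the original ones.\<close>
            define w' where "w' = (fst w + t \<bullet> snd w, snd w)"
            have ww: "(fst w' - t \<bullet> snd w', snd w') = w" by (simp add: w'_def)
            have "\<exists>s. w' = s *\<^sub>R y"
            proof (rule uniq)
              show "w' \<in> flag m" using w(1) by (simp add: w'_def flag_def)
              fix i assume i: "i \<in> G"
              show "(a i, v i) \<bullet> w' = 0" using xi[OF i, of w'] w(2)[OF i] unfolding ww by simp
            qed
            then obtain s where s: "w' = s *\<^sub>R y" by blast
            have "w = s *\<^sub>R y'" unfolding ww[symmetric] s by (simp add: y'_def algebra_simps)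
            then show "\<exists>s. w = s *\<^sub>R y'" by blast
          qed
          also have "B x = B (\<lambda>i. (fst (a i, v i), snd (a i, v i) + fst (a i, v i) *\<^sub>R t))"
            by (rule B_cong) (simp add: x_def mixi)
          also have "\<dots> = B (\<lambda>i. (a i, v i))" by (rule B_shift)
          also have "fst y' / norm (snd y') = (\<xi> \<bullet> - (snd y /\<^sub>R norm (snd y))) / L2_set a G"
            unfolding fst_y' by (simp add: y'_def divide_inverse mult_ac)
          finally show "\<Psi> (\<lambda>i\<in>G. (a i, mix G a v \<xi> i)) = of_bool (B (\<lambda>i. (a i, v i))) * one_sided_prob (card J) ((\<xi> \<bullet> - (snd y /\<^sub>R norm (snd y))) / L2_set a G)"
            by (simp only: x_def)
        qed
      qed
    qed
  qed
  also have "(\<integral>\<^sup>+t. one_sided_prob (card J) t * ennreal ((1 / sqrt (1 + t\<^sup>2)) ^ Suc (card G)) \<partial>lborel) = 2 * ennreal (sin_moment (m - 1) (card J) / pi ^ card J)"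
    using nn_integral_one_sided_prob[of "card J" "m - 1"] m by simp
  finally show ?thesis by (simp only: N_def J_def)
qed

text \<open>For q = 0 the recurrence loses its last term, so positivity is inherited in steps of
  two.\<close>

lemma sin_moment_pos: "0 < sin_moment p 0"
proof (induction p rule: induct_nat_012)
  case 0
  show ?case by (simp add: sin_moment_0)
next
  case 1
  show ?case using sin_moment_1[of 0] by simp
next
  case (ge2 p)
  have "(real p + 2)\<^sup>2 * sin_moment (Suc (Suc p)) 0 = (real p + 2) * (real p + 1) * sin_moment p 0"
    using sin_moment_Suc_Suc[of p 0] by simp
  moreover have "0 < (real p + 2) * (real p + 1) * sin_moment p 0" using ge2(1) by (intro mult_pos_pos) auto
  ultimately have "0 < (real p + 2)\<^sup>2 * sin_moment (Suc (Suc p)) 0" by (simp only:)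
  then show ?case by (rule zero_less_mult_pos) simp
qed

section \<open>The recursion for the exposure probabilities and its solution\<close>

definition exposure_prob :: "'b::euclidean_space itself \<Rightarrow> nat set \<Rightarrow> nat set \<Rightarrow> nat \<Rightarrow> real" where
  "exposure_prob _ I R m = measure (Pi\<^sub>M I (\<lambda>_. row_measure :: (real \<times> 'b) measure))
     {x \<in> space (Pi\<^sub>M I (\<lambda>_. row_measure :: (real \<times> 'b) measure)). exposes (flag m) x I R}"

text \<open>The value to be established for the probability that a given set of r out of n rows is
  exposed in the flag of index m. For r = k + 1 and m = d, multiplication by the number of such sets
  gives the right-hand side of the theorem.\<close>

definition exposure_formula :: "nat \<Rightarrow> nat \<Rightarrow> nat \<Rightarrow> real" where
  "exposure_formula n m r = fact (n - r) / pi ^ (n - r) * (\<Sum>s | m - 2 * s \<ge> r. B_num n (m - 2 * s) * A_factor (m - 2 * s) (r - 1))"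

lemma exposure_formula_0: "1 \<le> r \<Longrightarrow> m < r \<Longrightarrow> exposure_formula n m r = 0"
proof -
  assume "1 \<le> r" "m < r"
  then have "{s. m - 2 * s \<ge> r} = {}" by auto
  then show ?thesis unfolding exposure_formula_def by (simp only: sum.empty mult_zero_right)
qed

lemma exposure_formula_step:
  assumes r: "1 \<le> r" "r \<le> m"
  shows "exposure_formula n m r = fact (n - r) / pi ^ (n - r) * (B_num n m * A_factor m (r - 1)) + exposure_formula n (m - 2) r"
proof -
  have "{s. m - 2 * s \<ge> r} = insert 0 (Suc ` {s. m - 2 - 2 * s \<ge> r})"
  proof (intro equalityI subsetI)
    fix s assume "s \<in> {s. m - 2 * s \<ge> r}"
    then show "s \<in> insert 0 (Suc ` {s. m - 2 - 2 * s \<ge> r})" by (cases s) auto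
  qed (use r in auto)
  moreover have "finite {s. m - 2 - 2 * s \<ge> r}"
    by (rule finite_subset[of _ "{..m}"]) (use r in auto)
  ultimately show ?thesis
    by (simp add: exposure_formula_def sum.reindex distrib_left)
qed

text \<open>The prefactor cancels the value given by \<open>A_num_sum_eq\<close>. The value 1 agrees
  with the certain exposure in \<open>exposes_full\<close>; the value 2 at n = r is the doubled
  weight and determines the leading factor in the base case.\<close>

lemma exposure_formula_self:
  assumes r: "1 \<le> r" "r \<le> n"
  shows "exposure_formula n n r = (if n = r then 2 else 1)"
  using A_num_sum_eq[of "r - 1" n] r by (simp add: exposure_formula_def boundary_coeff_def)

lemma card_between:
  assumes I: "finite I" and R: "R \<subseteq> I" and m: "card R \<le> m"
  shows "card {G. R \<subseteq> G \<and> G \<subseteq> I \<and> card G = m} = (card I - card R) choose (m - card R)"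
proof -
  have finR: "finite R" using I R finite_subset by blast
  have "bij_betw (\<lambda>H. R \<union> H) {H. H \<subseteq> I - R \<and> card H = m - card R} {G. R \<subseteq> G \<and> G \<subseteq> I \<and> card G = m}"
  proof (rule bij_betwI[where g = "\<lambda>G. G - R"])
    show "(\<lambda>H. R \<union> H) \<in> {H. H \<subseteq> I - R \<and> card H = m - card R} \<rightarrow> {G. R \<subseteq> G \<and> G \<subseteq> I \<and> card G = m}"
    proof
      fix H assume H: "H \<in> {H. H \<subseteq> I - R \<and> card H = m - card R}"
      then have "finite H" "R \<inter> H = {}" using I by (auto intro: finite_subset)
      then show "R \<union> H \<in> {G. R \<subseteq> G \<and> G \<subseteq> I \<and> card G = m}" using H R m finR by (auto simp: card_Un_disjoint)
    qed
    show "(\<lambda>G. G - R) \<in> {G. R \<subseteq> G \<and> G \<subseteq> I \<and> card G = m} \<rightarrow> {H. H \<subseteq> I - R \<and> card H = m - card R}"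
      using finR by (auto simp: card_Diff_subset)
  qed auto
  then have "card {G. R \<subseteq> G \<and> G \<subseteq> I \<and> card G = m} = card {H. H \<subseteq> I - R \<and> card H = m - card R}"
    by (rule bij_betw_same_card[symmetric])
  also have "\<dots> = (card I - card R) choose (m - card R)"
    using I R finR by (simp add: n_subsets card_Diff_subset)
  finally show ?thesis .
qed

lemma exposes_measurable_row:
  assumes "finite I" "R \<subseteq> I"
  shows "Measurable.pred (Pi\<^sub>M I (\<lambda>_. row_measure :: (real \<times> 'b::euclidean_space) measure)) (\<lambda>x. exposes (flag m) x I R)"
  using assms by (intro measurable_exposes subspace_flag measurable_row_component)

lemma nn_integral_exposure_prob:
  assumes "finite I" "R \<subseteq> I"
  shows "(\<integral>\<^sup>+x. of_bool (exposes (flag m) x I R) \<partial>Pi\<^sub>M I (\<lambda>_. row_measure :: (real \<times> 'b::euclidean_space) measure))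
    = ennreal (exposure_prob TYPE('b) I R m)"
proof -
  let ?M = "Pi\<^sub>M I (\<lambda>_. row_measure :: (real \<times> 'b) measure)"
  interpret P: prob_space ?M by (rule prob_space_PiM) (rule prob_space_row_measure)
  have E: "{x \<in> space ?M. exposes (flag m) x I R} \<in> sets ?M" using exposes_measurable_row[OF assms] by (simp add: pred_def)
  have "(\<integral>\<^sup>+x. of_bool (exposes (flag m) x I R) \<partial>?M) = (\<integral>\<^sup>+x. indicator {x \<in> space ?M. exposes (flag m) x I R} x \<partial>?M)"
    by (intro nn_integral_cong) (auto simp: indicator_def)
  also have "\<dots> = emeasure ?M {x \<in> space ?M. exposes (flag m) x I R}" using E by (rule nn_integral_indicator)
  finally show ?thesis by (simp add: exposure_prob_def P.emeasure_eq_measure)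
qed

lemma exposes_cong: "(\<And>i. i \<in> I \<union> R \<Longrightarrow> x i = x' i) \<Longrightarrow> exposes S x I R \<longleftrightarrow> exposes S x' I R"
  unfolding exposes_def by (intro bex_cong conj_cong ball_cong) auto

text \<open>A shear of the rows is compensated by changing the first coordinate of y, which stays in
  the flag.\<close>

lemma exposes_shift:
  fixes x :: "nat \<Rightarrow> real \<times> 'b::euclidean_space"
  shows "exposes (flag m) (\<lambda>i. (fst (x i), snd (x i) + fst (x i) *\<^sub>R t)) I R \<longleftrightarrow> exposes (flag m) x I R"
proof -
  have 1: "exposes (flag m) (\<lambda>i. (fst (x i), snd (x i) + fst (x i) *\<^sub>R t)) I R" if ex: "exposes (flag m) x I R" for x :: "nat \<Rightarrow> real \<times> 'b" and t
  proof -
    obtain y where y: "y \<in> flag m" "\<forall>i\<in>R. x i \<bullet> y = 0" "\<forall>i\<in>I - R. 0 < x i \<bullet> y"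
      using ex unfolding exposes_def by blast
    then show ?thesis unfolding exposes_def
      by (intro bexI[of _ "(fst y - t \<bullet> snd y, snd y)"]) (simp_all only: inner_shift_row, auto simp: flag_def)
  qed
  show ?thesis
  proof
    assume "exposes (flag m) (\<lambda>i. (fst (x i), snd (x i) + fst (x i) *\<^sub>R t)) I R"
    from 1[OF this, of "- t"] show "exposes (flag m) x I R" by simp
  qed (rule 1)
qed

lemma exposes_scale:
  fixes x :: "nat \<Rightarrow> real \<times> 'b::euclidean_space"
  assumes r: "0 < r"
  shows "exposes (flag m) (\<lambda>i. (fst (x i) / r, snd (x i))) I R \<longleftrightarrow> exposes (flag m) x I R"
proof -
  have 1: "exposes (flag m) (\<lambda>i. (fst (x i) / r, snd (x i))) I R" if ex: "exposes (flag m) x I R" and r: "0 < r" for x :: "nat \<Rightarrow> real \<times> 'b" and r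
  proof -
    obtain y where y: "y \<in> flag m" "\<forall>i\<in>R. x i \<bullet> y = 0" "\<forall>i\<in>I - R. 0 < x i \<bullet> y"
      using ex unfolding exposes_def by blast
    have "(fst (x i) / r, snd (x i)) \<bullet> (r * fst y, snd y) = x i \<bullet> y" for i
      using r by (simp add: inner_prod_def)
    then show ?thesis unfolding exposes_def using y
      by (intro bexI[of _ "(r * fst y, snd y)"]) (simp_all only:, auto simp: flag_def)
  qed
  show ?thesis
  proof
    assume "exposes (flag m) (\<lambda>i. (fst (x i) / r, snd (x i))) I R"
    from 1[OF this, of "1 / r"] r show "exposes (flag m) x I R" by simp
  qed (use r 1 in blast)
qed

lemma two_times_ennreal: "2 * ennreal x = ennreal (2 * x)"
  using ennreal_mult'[of 2 x] by simp

lemma eq_of_ennreal: "ennreal a = ennreal b + ennreal c \<Longrightarrow> 0 \<le> a \<Longrightarrow> 0 \<le> b \<Longrightarrow> 0 \<le> c \<Longrightarrow> a = b + c"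
  by (simp flip: ennreal_plus)

text \<open>\<open>flag_exposes_difference\<close> is integrated and each summand evaluated by
  \<open>nn_integral_facet\<close>. The constant belonging to G does not depend on I, so it can be
  taken from the same identity for I = G, where exposure in the flag of index m is almost surely
  certain.\<close>

lemma exposure_prob_recurrence:
  assumes I: "finite I" "m \<le> card I" and R: "R \<subseteq> I" "card R < m" and m: "2 \<le> m" "m \<le> DIM('b::euclidean_space)"
  shows "exposure_prob TYPE('b) I R m = exposure_prob TYPE('b) I R (m - 2) +
    sin_moment (m - 1) (card I - m) / (pi ^ (card I - m) * sin_moment (m - 1) 0) *
      (\<Sum>G | R \<subseteq> G \<and> G \<subseteq> I \<and> card G = m. 1 - exposure_prob TYPE('b) G R (m - 2))"
proof -
  define C where "C G = mixing_constant G (\<lambda>a (v :: nat \<Rightarrow> 'b). \<not> exposes (flag (m - 2)) (\<lambda>i. (a i, v i)) G R)" for G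
  have key: "2 * ennreal (exposure_prob TYPE('b) I R m) = 2 * ennreal (exposure_prob TYPE('b) I R (m - 2)) +
      (\<Sum>G | R \<subseteq> G \<and> G \<subseteq> I \<and> card G = m. C G * (2 * ennreal (sin_moment (m - 1) (card I - m) / pi ^ (card I - m))))"
    if I: "finite I" "m \<le> card I" "R \<subseteq> I" for I
  proof -
    let ?M = "Pi\<^sub>M I (\<lambda>_. row_measure :: (real \<times> 'b) measure)"
    let ?F = "{G. R \<subseteq> G \<and> G \<subseteq> I \<and> card G = m}"
    note [measurable] = exposes_measurable_row[OF I(1,3), where 'b = 'b]
    have finF: "finite ?F" using I by (auto intro: finite_subset[of _ "Pow I"])
    define N where "N G x = (of_bool (\<not> exposes (flag (m - 2)) x G R) * (if G = I then 2 else of_bool (exposes (flag m) x I G)) :: ennreal)" for G and x :: "nat \<Rightarrow> real \<times> 'b"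
    have BG: "Measurable.pred (Pi\<^sub>M G (\<lambda>_. row_measure :: (real \<times> 'b) measure)) (\<lambda>x. \<not> exposes (flag (m - 2)) x G R)" if G: "G \<in> ?F" for G
    proof -
      have "finite G" "R \<subseteq> G" using G I(1) finite_subset by auto
      from exposes_measurable_row[OF this, where 'b = 'b] show ?thesis by measurable
    qed
    have N_meas: "N G \<in> borel_measurable ?M" if G: "G \<in> ?F" for G
    proof -
      have "Measurable.pred ?M (\<lambda>x. exposes (flag (m - 2)) x G R)"
        using G I finite_subset by (intro measurable_exposes subspace_flag measurable_row_component) auto
      moreover have "Measurable.pred ?M (\<lambda>x. exposes (flag m) x I G)"
        using G I by (intro exposes_measurable_row) auto
      ultimately show ?thesis unfolding N_def by measurable
    qed
    have N_int: "(\<integral>\<^sup>+x. N G x \<partial>?M) = C G * (2 * ennreal (sin_moment (m - 1) (card I - m) / pi ^ (card I - m)))" if G: "G \<in> ?F" for G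
    proof -
      have "card (I - G) = card I - m" using G I by (auto simp: card_Diff_subset finite_subset)
      moreover have "(\<integral>\<^sup>+x. N G x \<partial>?M) = C G * (2 * ennreal (sin_moment (m - 1) (card (I - G)) / pi ^ card (I - G)))"
        unfolding N_def C_def
      proof (rule nn_integral_facet[OF I(1) _ _ _ m(2) BG[OF G]])
        show "(\<not> exposes (flag (m - 2)) x G R) = (\<not> exposes (flag (m - 2)) x' G R)" if "\<And>i. i \<in> G \<Longrightarrow> x i = x' i" for x x' :: "nat \<Rightarrow> real \<times> 'b"
          using exposes_cong[of G R x x' "flag (m - 2)"] that G by auto
        show "(\<not> exposes (flag (m - 2)) (\<lambda>i. (fst (x i), snd (x i) + fst (x i) *\<^sub>R t)) G R) = (\<not> exposes (flag (m - 2)) x G R)"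
          for x :: "nat \<Rightarrow> real \<times> 'b" and t
          by (simp only: exposes_shift)
        show "(\<not> exposes (flag (m - 2)) (\<lambda>i. (fst (x i) / r, snd (x i))) G R) = (\<not> exposes (flag (m - 2)) x G R)"
          if "0 < r" for x :: "nat \<Rightarrow> real \<times> 'b" and r
          by (simp only: exposes_scale[OF that])
      qed (use G m in auto)
      ultimately show ?thesis by simp
    qed
    have "AE x in ?M. 2 * of_bool (exposes (flag m) x I R) = 2 * of_bool (exposes (flag (m - 2)) x I R) + (\<Sum>G\<in>?F. N G x)"
      using AE_generic[OF I(1), where 'b = 'b]
    proof eventually_elim
      fix x :: "nat \<Rightarrow> real \<times> 'b" assume g: "\<forall>j\<le>DIM('b). generic (flag j) x I"
      define N' where "N' G = (of_bool (\<not> exposes (flag (m - 2)) x G R) * (if G = I then 2 else of_bool (exposes (flag m) x I G)) :: real)" for G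
      have ob: "ennreal (2 * of_bool P) = 2 * of_bool P" for P by (cases P) auto
      have NN': "N G x = ennreal (N' G)" for G by (simp add: N_def N'_def)
      have "2 * (of_bool (exposes (flag m) x I R) - of_bool (exposes (flag (m - 2)) x I R)) = (\<Sum>G\<in>?F. N' G)"
        unfolding N'_def using flag_exposes_difference[OF m I(1,2,3) R(2), of x] g m(2) by simp
      then have "2 * of_bool (exposes (flag m) x I R) = 2 * of_bool (exposes (flag (m - 2)) x I R) + (\<Sum>G\<in>?F. N' G)"
        by (simp add: right_diff_distrib)
      then have "ennreal (2 * of_bool (exposes (flag m) x I R)) = ennreal (2 * of_bool (exposes (flag (m - 2)) x I R) + (\<Sum>G\<in>?F. N' G))"
        by simp
      also have "\<dots> = ennreal (2 * of_bool (exposes (flag (m - 2)) x I R)) + (\<Sum>G\<in>?F. N G x)"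
        by (subst ennreal_plus) (auto simp: N'_def NN' intro!: sum_nonneg sum_ennreal)
      finally show "2 * of_bool (exposes (flag m) x I R) = 2 * of_bool (exposes (flag (m - 2)) x I R) + (\<Sum>G\<in>?F. N G x)"
        by (simp only: ob)
    qed
    then have "(\<integral>\<^sup>+x. 2 * of_bool (exposes (flag m) x I R) \<partial>?M) = (\<integral>\<^sup>+x. 2 * of_bool (exposes (flag (m - 2)) x I R) + (\<Sum>G\<in>?F. N G x) \<partial>?M)"
      by (rule nn_integral_cong_AE)
    also have "\<dots> = (\<integral>\<^sup>+x. 2 * of_bool (exposes (flag (m - 2)) x I R) \<partial>?M) + (\<integral>\<^sup>+x. (\<Sum>G\<in>?F. N G x) \<partial>?M)"
      using N_meas by (intro nn_integral_add borel_measurable_sum) auto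
    also have "(\<integral>\<^sup>+x. (\<Sum>G\<in>?F. N G x) \<partial>?M) = (\<Sum>G\<in>?F. \<integral>\<^sup>+x. N G x \<partial>?M)"
      using N_meas by (intro nn_integral_sum) auto
    also have "\<dots> = (\<Sum>G\<in>?F. C G * (2 * ennreal (sin_moment (m - 1) (card I - m) / pi ^ (card I - m))))"
      by (intro sum.cong refl N_int)
    finally show ?thesis
      using nn_integral_exposure_prob[OF I(1,3), where 'b = 'b] by (simp add: nn_integral_cmult)
  qed
  \<comment> \<open>From \<open>key\<close> with I = G: the left-hand side is 2 and G is the only
    set in the sum.\<close>
  have C: "C G = ennreal ((1 - exposure_prob TYPE('b) G R (m - 2)) / sin_moment (m - 1) 0)" "exposure_prob TYPE('b) G R (m - 2) \<le> 1"
    if G: "R \<subseteq> G" "G \<subseteq> I" "card G = m" for G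
  proof -
    have finG: "finite G" using G I finite_subset by blast
    let ?M = "Pi\<^sub>M G (\<lambda>_. row_measure :: (real \<times> 'b) measure)"
    interpret P: prob_space ?M by (rule prob_space_PiM) (rule prob_space_row_measure)
    have F: "{H. R \<subseteq> H \<and> H \<subseteq> G \<and> card H = m} = {G}"
    proof -
      have "H = G" if "H \<subseteq> G" "card H = m" for H using card_subset_eq[OF finG that(1)] that(2) G(3) by simp
      then show ?thesis using G by auto
    qed
    have "AE x in ?M. exposes (flag m) x G R"
      using AE_generic[OF finG, where 'b = 'b]
    proof eventually_elim
      fix x :: "nat \<Rightarrow> real \<times> 'b" assume "\<forall>j\<le>DIM('b). generic (flag j) x G"
      then show "exposes (flag m) x G R" using m G finG by (intro exposes_full) auto
    qed
    then have "(\<integral>\<^sup>+x. of_bool (exposes (flag m) x G R) \<partial>?M) = (\<integral>\<^sup>+x. 1 \<partial>?M)"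
      by (intro nn_integral_cong_AE) (auto elim: eventually_mono)
    then have "ennreal (exposure_prob TYPE('b) G R m) = 1"
      using nn_integral_exposure_prob[OF finG G(1), where 'b = 'b] P.emeasure_space_1 by simp
    then have "2 = 2 * ennreal (exposure_prob TYPE('b) G R (m - 2)) + C G * (2 * ennreal (sin_moment (m - 1) 0))"
      using key[of G] finG G F by simp
    moreover have s0: "0 < sin_moment (m - 1) 0" by (rule sin_moment_pos)
    moreover show "exposure_prob TYPE('b) G R (m - 2) \<le> 1" unfolding exposure_prob_def by (rule P.prob_le_1)
    moreover have "0 \<le> exposure_prob TYPE('b) G R (m - 2)" by (simp add: exposure_prob_def)
    ultimately show "C G = ennreal ((1 - exposure_prob TYPE('b) G R (m - 2)) / sin_moment (m - 1) 0)"
    proof (cases "C G")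
      case (real c)
      have "ennreal 2 = ennreal (2 * exposure_prob TYPE('b) G R (m - 2) + c * (2 * sin_moment (m - 1) 0))"
        using \<open>2 = _\<close> real s0 \<open>0 \<le> exposure_prob TYPE('b) G R (m - 2)\<close> by (simp add: ennreal_mult')
      then have "2 = 2 * exposure_prob TYPE('b) G R (m - 2) + c * (2 * sin_moment (m - 1) 0)"
        using real s0 \<open>0 \<le> exposure_prob TYPE('b) G R (m - 2)\<close> by (subst (asm) ennreal_inj) auto
      then have "c = (1 - exposure_prob TYPE('b) G R (m - 2)) / sin_moment (m - 1) 0"
        using s0 by (simp add: field_simps)
      then show ?thesis using real by simp
    next
      \<comment> \<open>An infinite constant would make the right-hand side infinite, because
        \<open>sin_moment (m - 1) 0\<close> is positive.\<close>
      case top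
      then show ?thesis using \<open>2 = _\<close> s0 by (simp add: ennreal_top_mult ennreal_mult_eq_top_iff)
    qed
  qed
  let ?F = "{G. R \<subseteq> G \<and> G \<subseteq> I \<and> card G = m}"
  let ?s = "sin_moment (m - 1) (card I - m) / pi ^ (card I - m)"
  let ?c = "\<lambda>G. (1 - exposure_prob TYPE('b) G R (m - 2)) / sin_moment (m - 1) 0"
  have s_nonneg: "0 \<le> ?s"
    unfolding sin_moment_def
    by (intro divide_nonneg_nonneg integral_nonneg integrable_continuous_interval continuous_intros) (auto intro!: mult_nonneg_nonneg zero_le_power sin_ge_zero)
  have c_nonneg: "0 \<le> ?c G" if "G \<in> ?F" for G using C(2)[of G] that sin_moment_pos[of "m - 1"] by auto
  have cs_nonneg: "0 \<le> ?c G * (2 * ?s)" if "G \<in> ?F" for G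
    by (intro mult_nonneg_nonneg c_nonneg s_nonneg that) simp
  have sum_pos: "0 \<le> (\<Sum>G\<in>?F. ?c G * (2 * ?s))" by (rule sum_nonneg) (rule cs_nonneg)
  have "2 * ennreal (exposure_prob TYPE('b) I R m) = 2 * ennreal (exposure_prob TYPE('b) I R (m - 2)) + (\<Sum>G\<in>?F. C G * (2 * ennreal ?s))"
    using I R by (intro key) auto
  also have "(\<Sum>G\<in>?F. C G * (2 * ennreal ?s)) = (\<Sum>G\<in>?F. ennreal (?c G * (2 * ?s)))"
  proof (rule sum.cong)
    fix G assume G: "G \<in> ?F"
    then have "C G * (2 * ennreal ?s) = ennreal (?c G) * (2 * ennreal ?s)" using C(1)[of G] by simp
    also have "2 * ennreal ?s = ennreal (2 * ?s)" by (rule two_times_ennreal)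
    also have "ennreal (?c G) * ennreal (2 * ?s) = ennreal (?c G * (2 * ?s))" using c_nonneg[OF G] by (rule ennreal_mult'[symmetric])
    finally show "C G * (2 * ennreal ?s) = ennreal (?c G * (2 * ?s))"
      by (simp only: two_times_ennreal)
  qed (rule refl)
  also have "\<dots> = ennreal (\<Sum>G\<in>?F. ?c G * (2 * ?s))"
    by (rule sum_ennreal) (rule cs_nonneg)
  finally have "ennreal (2 * exposure_prob TYPE('b) I R m) =
      ennreal (2 * exposure_prob TYPE('b) I R (m - 2)) + ennreal (\<Sum>G\<in>?F. ?c G * (2 * ?s))"
    by (simp only: two_times_ennreal)
  then have "2 * exposure_prob TYPE('b) I R m = 2 * exposure_prob TYPE('b) I R (m - 2) + (\<Sum>G\<in>?F. ?c G * (2 * ?s))"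
    by (rule eq_of_ennreal[OF _ _ _ sum_pos]) (simp_all add: exposure_prob_def)
  also have "(\<Sum>G\<in>?F. ?c G * (2 * ?s)) = 2 * (?s / sin_moment (m - 1) 0 * (\<Sum>G\<in>?F. 1 - exposure_prob TYPE('b) G R (m - 2)))"
    by (simp add: sum_distrib_left mult_ac)
  finally show ?thesis by simp
qed

text \<open>R contains at least m + 1 rows, the dimension of the flag, so generically only y = 0 is
  orthogonal to all of them, while a row outside R demands a positive product.\<close>

lemma exposure_prob_eq_0:
  assumes I: "finite I" and R: "R \<subseteq> I" "m < card R" "card R < card I" and m: "m \<le> DIM('b::euclidean_space)"
  shows "exposure_prob TYPE('b) I R m = 0"
proof -
  have "AE x in Pi\<^sub>M I (\<lambda>_. row_measure :: (real \<times> 'b) measure). \<not> exposes (flag m) x I R"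
    using AE_generic[OF I, where 'b = 'b]
  proof eventually_elim
    fix x :: "nat \<Rightarrow> real \<times> 'b" assume g: "\<forall>j\<le>DIM('b). generic (flag j) x I"
    show "\<not> exposes (flag m) x I R"
    proof
      assume "exposes (flag m) x I R"
      then obtain y where y: "y \<in> flag m" "\<forall>i\<in>R. x i \<bullet> y = 0" "\<forall>i\<in>I - R. 0 < x i \<bullet> y"
        unfolding exposes_def by blast
      have "Suc m \<le> card R" using R(2) by simp
      then obtain J where J: "J \<subseteq> R" "card J = Suc m" by (rule obtain_subset_with_card_n)
      have "card J = dim (flag m :: (real \<times> 'b) set)" using J(2) dim_flag[OF m] by simp
      moreover have "generic (flag m) x I" using g m by blast
      ultimately have "y = 0" using J(1) R(1) y(1,2) unfolding generic_def by blast
      moreover obtain i where "i \<in> I - R" using R(1,3) by (metis Diff_eq_empty_iff all_not_in_conv less_irrefl subset_antisym)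
      ultimately show False using y(3) by auto
    qed
  qed
  then have "(\<integral>\<^sup>+x. of_bool (exposes (flag m) x I R) \<partial>Pi\<^sub>M I (\<lambda>_. row_measure :: (real \<times> 'b) measure)) = (\<integral>\<^sup>+x. 0 \<partial>Pi\<^sub>M I (\<lambda>_. row_measure :: (real \<times> 'b) measure))"
    by (intro nn_integral_cong_AE) (auto elim: eventually_mono)
  then have "ennreal (exposure_prob TYPE('b) I R m) = 0"
    using nn_integral_exposure_prob[OF I R(1), where 'b = 'b] by simp
  then show ?thesis by (simp add: exposure_prob_def)
qed

text \<open>The base of the recursion, in which R itself plays the part of the facet and no
  condition is imposed on its rows. The constant comes from I = R, where the integrand is 2.\<close>

lemma exposure_prob_simplex:
  assumes I: "finite I" and R: "R \<subseteq> I" "card R < card I" and m: "card R = m" "1 \<le> m" "m \<le> DIM('b::euclidean_space)"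
  shows "exposure_prob TYPE('b) I R m = 2 * sin_moment (m - 1) (card I - m) / (pi ^ (card I - m) * sin_moment (m - 1) 0)"
proof -
  have finR: "finite R" using I R finite_subset by blast
  define C where "C = mixing_constant R (\<lambda>a (v :: nat \<Rightarrow> 'b). True)"
  interpret P: prob_space "Pi\<^sub>M R (\<lambda>_. row_measure :: (real \<times> 'b) measure)" by (rule prob_space_PiM) (rule prob_space_row_measure)
  have key: "(\<integral>\<^sup>+x. of_bool True * (if R = I then 2 else of_bool (exposes (flag m) x I R)) \<partial>Pi\<^sub>M I (\<lambda>_. row_measure :: (real \<times> 'b) measure)) =
    C * (2 * ennreal (sin_moment (m - 1) (card (I - R)) / pi ^ card (I - R)))" if "finite I" "R \<subseteq> I" for I
    unfolding C_def using that m by (intro nn_integral_facet) auto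
  have s0: "0 < sin_moment (m - 1) 0" by (rule sin_moment_pos)
  have "2 = C * (2 * ennreal (sin_moment (m - 1) 0))"
    using key[OF finR order_refl] P.emeasure_space_1 by simp
  then obtain c where c: "C = ennreal c" "0 \<le> c"
    using s0 by (cases C) (auto simp: ennreal_top_mult ennreal_mult_eq_top_iff)
  have "ennreal 2 = ennreal (c * (2 * sin_moment (m - 1) 0))"
    using \<open>2 = C * _\<close> c s0 by (simp add: ennreal_mult')
  then have "2 = c * (2 * sin_moment (m - 1) 0)"
    using c s0 by (subst (asm) ennreal_inj) auto
  then have c_eq: "c = 1 / sin_moment (m - 1) 0" using s0 by (simp add: field_simps)
  have nonneg: "0 \<le> sin_moment (m - 1) (card I - m)"
    unfolding sin_moment_def
    by (intro integral_nonneg integrable_continuous_interval continuous_intros) (auto intro!: mult_nonneg_nonneg zero_le_power sin_ge_zero)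
  have "R \<noteq> I" using R(2) by auto
  have "card (I - R) = card I - m" using finR R m by (simp add: card_Diff_subset)
  then have "ennreal (exposure_prob TYPE('b) I R m) = C * (2 * ennreal (sin_moment (m - 1) (card I - m) / pi ^ (card I - m)))"
    using key[OF I R(1)] nn_integral_exposure_prob[OF I R(1), of m, where 'b = 'b] \<open>R \<noteq> I\<close> by (simp del: One_nat_def)
  also have "\<dots> = ennreal (c * (2 * (sin_moment (m - 1) (card I - m) / pi ^ (card I - m))))"
    unfolding c(1) two_times_ennreal using c(2) by (rule ennreal_mult'[symmetric])
  finally have "exposure_prob TYPE('b) I R m = c * (2 * (sin_moment (m - 1) (card I - m) / pi ^ (card I - m)))"
    using c nonneg by (subst (asm) ennreal_inj) (auto simp: exposure_prob_def)
  then show ?thesis by (simp add: c_eq)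
qed

text \<open>The induction on m runs over all I at once, because the recurrence for I refers to sets
  G with m elements. For these the formula at index m has the value 1, so 1 minus its value at m - 2
  is its leading summand, the one of index m. The recurrence therefore adds to the formula for I
  exactly the summand of index m.\<close>

theorem exposure_prob_eq_formula:
  assumes "finite I" "R \<subseteq> I" "1 \<le> card R" "card R < card I" "m \<le> card I" "m \<le> DIM('b::euclidean_space)"
  shows "exposure_prob TYPE('b) I R m = exposure_formula (card I) m (card R)"
  using assms
proof (induction m arbitrary: I rule: less_induct)
  case (less m)
  define r where "r = card R"
  define n where "n = card I"
  have r1: "1 \<le> r" using less.prems by (simp add: r_def)
  have B: "B_num n m = sin_moment (m - 1) (n - m) / (fact (m - 1) * fact (n - m))" if "1 \<le> m" "m \<le> n" for n m
    using that by (rule B_num_eq_sin_moment)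
  consider "m < r" | "m = r" | "r < m" by linarith
  then show ?case
  proof cases
    case 1
    then show ?thesis using less.prems exposure_prob_eq_0[of I R m] exposure_formula_0[OF r1 1, of n] by (simp add: r_def n_def)
  next
    case 2
    have s0: "0 < sin_moment (r - 1) 0" by (rule sin_moment_pos)
    \<comment> \<open>For n = m = r the formula has a single summand, and its value 2 determines the
      factor.\<close>
    have "A_factor r (r - 1) * (sin_moment (r - 1) 0 / fact (r - 1)) = 2"
      using exposure_formula_self[OF r1 order_refl] exposure_formula_step[OF r1 order_refl, of r] exposure_formula_0[of r "r - 2" r] r1 B[of r r]
      by (simp add: mult.commute)
    then have A: "A_factor r (r - 1) = 2 * fact (r - 1) / sin_moment (r - 1) 0" using s0 by (simp add: field_simps)
    have "exposure_formula n m r = fact (n - r) / pi ^ (n - r) * (B_num n r * A_factor r (r - 1))"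
      using exposure_formula_step[OF r1 order_refl, of n] exposure_formula_0[of r "r - 2" n] r1 2 by simp
    also have "\<dots> = 2 * sin_moment (r - 1) (n - r) / (pi ^ (n - r) * sin_moment (r - 1) 0)"
      using B[of r n] less.prems r1 unfolding A by (simp add: r_def n_def)
    finally show ?thesis
      using exposure_prob_simplex[OF less.prems(1,2,4), of m, where 'b = 'b] less.prems 2 by (simp add: r_def n_def)
  next
    case 3
    then have m: "2 \<le> m" using r1 by simp
    have s0: "0 < sin_moment (m - 1) 0" by (rule sin_moment_pos)
    have mn: "m \<le> n" using less.prems by (simp add: n_def)
    define D where "D = fact (m - r) / pi ^ (m - r) * (B_num m m * A_factor m (r - 1))"
    have D: "1 - exposure_prob TYPE('b) G R (m - 2) = D" if G: "R \<subseteq> G" "G \<subseteq> I" "card G = m" for G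
    proof -
      have "finite G" using G less.prems(1) finite_subset by blast
      then have "exposure_prob TYPE('b) G R (m - 2) = exposure_formula m (m - 2) r"
        using less.IH[of "m - 2" G] G 3 m less.prems by (simp add: r_def)
      moreover have "exposure_formula m m r = 1" using exposure_formula_self[of r m] r1 3 by simp
      ultimately show ?thesis using exposure_formula_step[of r m m] r1 3 by (simp add: D_def)
    qed
    have "exposure_prob TYPE('b) I R m = exposure_prob TYPE('b) I R (m - 2) +
      sin_moment (m - 1) (n - m) / (pi ^ (n - m) * sin_moment (m - 1) 0) * (\<Sum>G | R \<subseteq> G \<and> G \<subseteq> I \<and> card G = m. 1 - exposure_prob TYPE('b) G R (m - 2))"
      using less.prems 3 m unfolding n_def r_def by (intro exposure_prob_recurrence) auto
    also have "(\<Sum>G | R \<subseteq> G \<and> G \<subseteq> I \<and> card G = m. 1 - exposure_prob TYPE('b) G R (m - 2)) = real ((n - r) choose (m - r)) * D"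
      using card_between[OF less.prems(1,2), of m] 3 by (simp add: D r_def n_def)
    also have "exposure_prob TYPE('b) I R (m - 2) = exposure_formula n (m - 2) r"
      using less.IH[of "m - 2" I] less.prems m by (simp add: r_def n_def)
    also have "sin_moment (m - 1) (n - m) / (pi ^ (n - m) * sin_moment (m - 1) 0) * (real ((n - r) choose (m - r)) * D) =
        fact (n - r) / pi ^ (n - r) * (B_num n m * A_factor m (r - 1))"
    proof -
      have ch: "real ((n - r) choose (m - r)) = fact (n - r) / (fact (m - r) * fact (n - m))"
        using binomial_fact[of "m - r" "n - r", where 'a = real] 3 mn by simp
      have pi: "pi ^ (n - r) = pi ^ (n - m) * pi ^ (m - r)" using 3 mn by (simp flip: power_add)
      have bn: "B_num n m = sin_moment (m - 1) (n - m) / (fact (m - 1) * fact (n - m))" and bm: "B_num m m = sin_moment (m - 1) 0 / fact (m - 1)"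
        using B[of m n] B[of m m] m mn by auto
      show ?thesis
        unfolding ch D_def pi using s0 by (simp add: bn bm field_simps)
    qed
    finally have "exposure_prob TYPE('b) I R m = exposure_formula n (m - 2) r + fact (n - r) / pi ^ (n - r) * (B_num n m * A_factor m (r - 1))" .
    then show ?thesis using exposure_formula_step[of r m n] r1 3 by (simp add: r_def n_def)
  qed
qed

subsection \<open>Faces of finitely generated cones\<close>

lemma pos_eq_convex_cone_hull:
  assumes "finite I"
  shows "pos I u = convex_cone hull (u ` I)"
proof
  show "pos I u \<subseteq> convex_cone hull (u ` I)"
  proof
    fix x assume "x \<in> pos I u"
    then obtain l where l: "x = (\<Sum>i\<in>I. l i *\<^sub>R u i)" "\<forall>i\<in>I. 0 \<le> l i" unfolding pos_def by blast
    have "(\<Sum>i\<in>J. l i *\<^sub>R u i) \<in> convex_cone hull (u ` I)" if "J \<subseteq> I" "finite J" for J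
      using that(2,1)
    proof (induction J)
      case empty
      then show ?case by (simp add: convex_cone_hull_contains_0)
    next
      case (insert j J)
      have "u j \<in> convex_cone hull (u ` I)" using insert.prems by (intro hull_inc) auto
      then show ?case
        using insert l(2) by (simp add: convex_cone_hull_add convex_cone_hull_mul)
    qed
    then show "x \<in> convex_cone hull (u ` I)" using l(1) assms by simp
  qed
  show "convex_cone hull (u ` I) \<subseteq> pos I u"
  proof (rule hull_minimal)
    show "u ` I \<subseteq> pos I u"
    proof (rule image_subsetI)
      fix i assume "i \<in> I"
      then have "u i = (\<Sum>j\<in>I. of_bool (j = i) *\<^sub>R u j)"
        using assms by (subst sum.remove[of I i]) (auto intro!: sum.neutral)
      then show "u i \<in> pos I u" unfolding pos_def by (intro CollectI exI[of _ "\<lambda>j. of_bool (j = i)"]) auto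
    qed
    show "convex_cone (pos I u)"
      unfolding convex_cone_iff
    proof (intro conjI ballI allI impI)
      show "0 \<in> pos I u" unfolding pos_def by (intro CollectI exI[of _ "\<lambda>_. 0"]) auto
    next
      fix x y assume "x \<in> pos I u" "y \<in> pos I u"
      then obtain l l' where "x = (\<Sum>i\<in>I. l i *\<^sub>R u i)" "\<forall>i\<in>I. 0 \<le> l i" "y = (\<Sum>i\<in>I. l' i *\<^sub>R u i)" "\<forall>i\<in>I. 0 \<le> l' i"
        unfolding pos_def by blast
      then show "x + y \<in> pos I u"
        unfolding pos_def by (intro CollectI exI[of _ "\<lambda>i. l i + l' i"]) (auto simp: scaleR_add_left sum.distrib)
    next
      fix x and c :: real assume "x \<in> pos I u" "0 \<le> c"
      then obtain l where "x = (\<Sum>i\<in>I. l i *\<^sub>R u i)" "\<forall>i\<in>I. 0 \<le> l i" unfolding pos_def by blast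
      then show "c *\<^sub>R x \<in> pos I u"
        unfolding pos_def using \<open>0 \<le> c\<close> by (intro CollectI exI[of _ "\<lambda>i. c * l i"]) (auto simp: scaleR_sum_right)
    qed
  qed
qed

lemma zero_in_pos: "0 \<in> pos I u"
  unfolding pos_def by (intro CollectI exI[of _ "\<lambda>_. 0"]) auto

lemma generator_in_pos: "finite I \<Longrightarrow> i \<in> I \<Longrightarrow> u i \<in> pos I u"
  unfolding pos_eq_convex_cone_hull by (intro hull_inc) auto

lemma convex_pos: "finite I \<Longrightarrow> convex (pos I u)"
  by (simp add: pos_eq_convex_cone_hull convex_convex_cone_hull)

lemma aff_dim_pos:
  assumes "finite I"
  shows "aff_dim (pos I (u :: nat \<Rightarrow> 'e::euclidean_space)) = int (dim (u ` I))"
proof -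
  have "pos I u \<subseteq> span (u ` I)"
    unfolding pos_def by (auto intro!: span_sum span_scale intro: span_base)
  moreover have "u ` I \<subseteq> pos I u" using generator_in_pos[OF assms] by blast
  ultimately have "dim (pos I u) = dim (u ` I)"
    by (metis dim_span dim_subset order_antisym)
  then show ?thesis by (simp add: aff_dim_zero hull_inc zero_in_pos)
qed

text \<open>The product with y is a sum of nonnegative terms; if it vanishes, all generators with
  positive product have coefficient 0.\<close>

lemma pos_Int_hyperplane:
  assumes I: "finite I" and y: "\<And>i. i \<in> S \<Longrightarrow> u i \<bullet> y = 0" "\<And>i. i \<in> I - S \<Longrightarrow> 0 < u i \<bullet> y" and S: "S \<subseteq> I"
  shows "pos I u \<inter> {x. y \<bullet> x = 0} = pos S u"
proof
  show "pos I u \<inter> {x. y \<bullet> x = 0} \<subseteq> pos S u"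
  proof
    fix x assume x: "x \<in> pos I u \<inter> {x. y \<bullet> x = 0}"
    then obtain l where l: "x = (\<Sum>i\<in>I. l i *\<^sub>R u i)" "\<forall>i\<in>I. 0 \<le> l i" unfolding pos_def by blast
    have "(\<Sum>i\<in>I. l i * (u i \<bullet> y)) = 0"
      using x unfolding l(1) by (simp add: inner_sum_left inner_commute[of y])
    moreover have nonneg: "0 \<le> l i * (u i \<bullet> y)" if "i \<in> I" for i
      using l(2) y[of i] that by (cases "i \<in> S") (auto intro!: mult_nonneg_nonneg intro: less_imp_le)
    ultimately have "\<forall>i\<in>I. l i * (u i \<bullet> y) = 0"
      using sum_nonneg_eq_0_iff[OF I, of "\<lambda>i. l i * (u i \<bullet> y)"] by blast
    then have "l i = 0" if "i \<in> I - S" for i using y(2)[OF that] that by auto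
    then have "x = (\<Sum>i\<in>S. l i *\<^sub>R u i)"
      unfolding l(1) by (intro sum.mono_neutral_right I S) auto
    then show "x \<in> pos S u" unfolding pos_def using l(2) S by blast
  qed
  show "pos S u \<subseteq> pos I u \<inter> {x. y \<bullet> x = 0}"
  proof
    fix x assume "x \<in> pos S u"
    then obtain l where l: "x = (\<Sum>i\<in>S. l i *\<^sub>R u i)" "\<forall>i\<in>S. 0 \<le> l i" unfolding pos_def by blast
    have "x = (\<Sum>i\<in>I. (if i \<in> S then l i else 0) *\<^sub>R u i)"
      unfolding l(1) by (intro sum.mono_neutral_cong_left I S) auto
    then have "x \<in> pos I u" unfolding pos_def using l(2) by (intro CollectI exI[of _ "\<lambda>i. if i \<in> S then l i else 0"]) auto
    moreover have "y \<bullet> x = 0" using y(1) by (simp add: l(1) inner_sum_right inner_commute)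
    ultimately show "x \<in> pos I u \<inter> {x. y \<bullet> x = 0}" by simp
  qed
qed

text \<open>Faces of a polyhedron are exposed. A supporting hyperplane that meets the cone passes
  through the origin, since the cone contains 0 and the double of each of its points. The empty face
  has to be excluded because every \<open>pos S u\<close> contains 0.\<close>

lemma nonempty_faces_pos:
  fixes u :: "nat \<Rightarrow> 'e::euclidean_space"
  assumes I: "finite I"
  shows "{F. F face_of pos I u \<and> F \<noteq> {}} = (\<lambda>S. pos S u) ` {S. S \<subseteq> I \<and> exposes UNIV u I S}"
proof (intro equalityI subsetI)
  fix F assume "F \<in> {F. F face_of pos I u \<and> F \<noteq> {}}"
  then have F: "F face_of pos I u" "F \<noteq> {}" by auto
  have "polyhedron (pos I u)"
    using I by (simp add: pos_eq_convex_cone_hull polyhedron_convex_cone_hull)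
  then have "F exposed_face_of pos I u" using F(1) by (simp add: exposed_face_of_polyhedron)
  then obtain a b where ab: "pos I u \<subseteq> {x. a \<bullet> x \<le> b}" "F = pos I u \<inter> {x. a \<bullet> x = b}"
    unfolding exposed_face_of_def by blast
  have scale: "c *\<^sub>R x \<in> pos I u" if "x \<in> pos I u" "0 \<le> c" for c x
    using that I by (simp add: pos_eq_convex_cone_hull convex_cone_hull_mul)
  obtain z where z: "z \<in> pos I u" "a \<bullet> z = b" using F(2) ab(2) by auto
  have "0 \<le> b" using ab(1) zero_in_pos[of I u] by auto
  moreover have "a \<bullet> (2 *\<^sub>R z) \<le> b" using ab(1) scale[OF z(1), of 2] by auto
  ultimately have "b = 0" using z(2) by simp
  define S where "S = {i\<in>I. u i \<bullet> (- a) = 0}"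
  have "0 \<le> u i \<bullet> (- a)" if "i \<in> I" for i
    using ab(1) generator_in_pos[OF I that] \<open>b = 0\<close> by (force simp: inner_commute)
  then have y: "\<And>i. i \<in> S \<Longrightarrow> u i \<bullet> (- a) = 0" "\<And>i. i \<in> I - S \<Longrightarrow> 0 < u i \<bullet> (- a)"
    unfolding S_def by (auto simp: less_le)
  have "S \<subseteq> I" by (auto simp: S_def)
  have "F = pos S u"
    using pos_Int_hyperplane[where u = u and y = "- a", OF I y \<open>S \<subseteq> I\<close>] ab(2) \<open>b = 0\<close> by simp
  moreover have "exposes UNIV u I S" unfolding exposes_def using y by blast
  ultimately show "F \<in> (\<lambda>S. pos S u) ` {S. S \<subseteq> I \<and> exposes UNIV u I S}" using \<open>S \<subseteq> I\<close> by blast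
next
  fix F assume "F \<in> (\<lambda>S. pos S u) ` {S. S \<subseteq> I \<and> exposes UNIV u I S}"
  then obtain S y where S: "F = pos S u" "S \<subseteq> I" and y: "\<And>i. i \<in> S \<Longrightarrow> u i \<bullet> y = 0" "\<And>i. i \<in> I - S \<Longrightarrow> 0 < u i \<bullet> y"
    unfolding exposes_def by blast
  have nonneg: "0 \<le> u i \<bullet> y" if "i \<in> I" for i using y that by (cases "i \<in> S") (auto intro: less_imp_le)
  have "y \<bullet> x \<ge> 0" if pos_x: "x \<in> pos I u" for x
  proof -
    obtain l where l: "x = (\<Sum>i\<in>I. l i *\<^sub>R u i)" "\<forall>i\<in>I. 0 \<le> l i" using pos_x unfolding pos_def by blast
    then show ?thesis
      using nonneg by (auto simp: inner_sum_right inner_commute intro!: sum_nonneg mult_nonneg_nonneg)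
  qed
  then have "(pos I u \<inter> {x. y \<bullet> x = 0}) face_of pos I u"
    by (intro face_of_Int_supporting_hyperplane_ge convex_pos I)
  then show "F \<in> {F. F face_of pos I u \<and> F \<noteq> {}}"
    using pos_Int_hyperplane[where u = u and y = y, OF I y S(2)] S(1) zero_in_pos[of S u] by auto
qed

text \<open>An exposed S is recovered from its face as the set of generators lying in it, so the
  faces may be counted by their index sets. The empty face has affine dimension -1 and is never
  counted.\<close>

lemma spherical_face_number_pos:
  fixes u :: "nat \<Rightarrow> 'e::euclidean_space"
  assumes I: "finite I"
  shows "spherical_face_number k (pos I u) = card {S. S \<subseteq> I \<and> exposes UNIV u I S \<and> dim (u ` S) = k + 1}"
proof -
  let ?E = "{S. S \<subseteq> I \<and> exposes UNIV u I S}"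
  have fin: "finite S" if "S \<subseteq> I" for S using that I finite_subset by blast
  have "inj_on (\<lambda>S. pos S u) ?E"
  proof (rule inj_on_inverseI[where g = "\<lambda>C. {i\<in>I. u i \<in> C}"])
    fix S assume "S \<in> ?E"
    then obtain y where S: "S \<subseteq> I" and y: "\<And>i. i \<in> S \<Longrightarrow> u i \<bullet> y = 0" "\<And>i. i \<in> I - S \<Longrightarrow> 0 < u i \<bullet> y"
      unfolding exposes_def by blast
    have "i \<in> S" if "i \<in> I" "u i \<in> pos S u" for i
    proof (rule ccontr)
      assume "i \<notin> S"
      then have "0 < u i \<bullet> y" using y(2) that by blast
      moreover have "u i \<bullet> y = 0" using that(2) pos_Int_hyperplane[where u = u and y = y, OF I y S] by (auto simp: inner_commute[of y])
      ultimately show False by simp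
    qed
    then show "{i\<in>I. u i \<in> pos S u} = S" using S generator_in_pos[OF fin[OF S]] by blast
  qed
  then have inj: "inj_on (\<lambda>S. pos S u) {S \<in> ?E. dim (u ` S) = k + 1}" by (rule inj_on_subset) auto
  have aff: "aff_dim (pos S u) = int (k + 1) \<longleftrightarrow> dim (u ` S) = k + 1" if "S \<subseteq> I" for S
    unfolding aff_dim_pos[OF fin[OF that]] by (rule of_nat_eq_iff)
  have "{F. F face_of pos I u \<and> aff_dim F = int (k + 1)} = {F \<in> {F. F face_of pos I u \<and> F \<noteq> {}}. aff_dim F = int (k + 1)}"
    by auto
  also have "\<dots> = (\<lambda>S. pos S u) ` {S \<in> ?E. dim (u ` S) = k + 1}"
    unfolding nonempty_faces_pos[OF I] using aff by blast
  finally have "spherical_face_number k (pos I u) = card {S \<in> ?E. dim (u ` S) = k + 1}"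
    unfolding spherical_face_number_def by (simp only: card_image[OF inj])
  then show ?thesis by (simp add: conj_assoc)
qed

text \<open>A new generator raises the dimension unless it lies in the span of the others. Being
  outside the span means that some vector is orthogonal to the others and positive on it, which is
  an instance of \<open>exposes\<close>.\<close>

lemma measurable_dim:
  fixes u :: "'w \<Rightarrow> nat \<Rightarrow> 'e::euclidean_space"
  assumes "finite S" and u: "\<And>i. i \<in> S \<Longrightarrow> (\<lambda>\<omega>. u \<omega> i) \<in> borel_measurable M"
  shows "(\<lambda>\<omega>. dim (u \<omega> ` S)) \<in> measurable M (count_space UNIV)"
  using assms
proof (induction S)
  case empty
  then show ?case by simp
next
  case (insert j S)
  have span: "u \<omega> j \<in> span (u \<omega> ` S) \<longleftrightarrow> \<not> exposes UNIV (u \<omega>) (insert j S) S" for \<omega>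
  proof
    assume *: "u \<omega> j \<in> span (u \<omega> ` S)"
    show "\<not> exposes UNIV (u \<omega>) (insert j S) S"
    proof
      assume "exposes UNIV (u \<omega>) (insert j S) S"
      then obtain y where y: "\<forall>i\<in>S. u \<omega> i \<bullet> y = 0" "0 < u \<omega> j \<bullet> y" using insert.hyps(2) unfolding exposes_def by blast
      have "orthogonal y (u \<omega> j)" using * y(1) by (intro orthogonal_to_span[OF *]) (auto simp: orthogonal_def inner_commute)
      then show False using y(2) by (simp add: orthogonal_def inner_commute)
    qed
  next
    assume *: "\<not> exposes UNIV (u \<omega>) (insert j S) S"
    obtain p q where pq: "p \<in> span (u \<omega> ` S)" "\<And>w. w \<in> span (u \<omega> ` S) \<Longrightarrow> orthogonal q w" "u \<omega> j = p + q"
      using orthogonal_subspace_decomp_exists[of "u \<omega> ` S" "u \<omega> j"] by blast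
    have "u \<omega> i \<bullet> q = 0" if "i \<in> S" for i using pq(2)[of "u \<omega> i"] that by (auto simp: orthogonal_def inner_commute intro: span_base)
    moreover have "u \<omega> j \<bullet> q = q \<bullet> q" using pq(2)[OF pq(1)] by (simp add: pq(3) inner_add_left orthogonal_def inner_commute[of p])
    ultimately have "q = 0"
      using * unfolding exposes_def by (metis Diff_iff UNIV_I inner_gt_zero_iff insert_iff)
    then show "u \<omega> j \<in> span (u \<omega> ` S)" using pq by simp
  qed
  have eq: "dim (u \<omega> ` insert j S) = (if exposes UNIV (u \<omega>) (insert j S) S then dim (u \<omega> ` S) + 1 else dim (u \<omega> ` S))" for \<omega>
    using span[of \<omega>] by (auto simp: dim_insert)
  have [measurable]: "(\<lambda>\<omega>. dim (u \<omega> ` S)) \<in> measurable M (count_space UNIV)" using insert by blast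
  have [measurable]: "Measurable.pred M (\<lambda>\<omega>. exposes UNIV (u \<omega>) (insert j S) S)"
    using insert by (intro measurable_exposes) auto
  show ?case unfolding eq by measurable
qed

text \<open>Any DIM('e) generators form a basis, and S either extends to such a set or contains
  one.\<close>

lemma dim_generic:
  fixes u :: "nat \<Rightarrow> 'e::euclidean_space"
  assumes I: "finite I" "DIM('e) \<le> card I" and g: "generic UNIV u I" and S: "S \<subseteq> I"
  shows "dim (u ` S) = min (card S) DIM('e)"
proof -
  have full: "dim (u ` J) = DIM('e)" if J: "J \<subseteq> I" "card J = DIM('e)" for J
  proof (rule ccontr)
    assume "dim (u ` J) \<noteq> DIM('e)"
    then have "span (u ` J) \<noteq> UNIV" by (metis dim_UNIV dim_span)
    then obtain y where "y \<noteq> 0" "span (u ` J) \<subseteq> {x. y \<bullet> x = 0}" using span_not_UNIV_orthogonal by blast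
    then have "y \<noteq> 0" "\<forall>i\<in>J. u i \<bullet> y = 0" by (auto simp: inner_commute dest!: subsetD intro: span_base)
    moreover have "card J = dim (UNIV :: 'e set)" using J(2) by simp
    ultimately show False using g J(1) unfolding generic_def by blast
  qed
  have finS: "finite S" using S I(1) finite_subset by blast
  show ?thesis
  proof (cases "card S \<le> DIM('e)")
    case True
    then obtain J where J: "S \<subseteq> J" "J \<subseteq> I" "card J = DIM('e)"
      using exists_subset_between[OF True I(2) S I(1)] by blast
    have finJ: "finite J" using J(2) I(1) finite_subset by blast
    have "card J \<le> card (u ` J)" using full[OF J(2,3)] J(3) dim_le_card'[of "u ` J"] finJ by simp
    then have inj: "inj_on u J" and "card (u ` J) = card J"
      using finJ by (auto simp: eq_card_imp_inj_on card_image_le order_antisym)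
    then have "independent (u ` J)"
      using full[OF J(2,3)] J(3) finJ by (intro card_le_dim_spanning[of _ "span (u ` J)"]) (auto simp: span_superset)
    then have "independent (u ` S)" using image_mono[OF J(1)] by (rule independent_mono)
    then have "dim (u ` S) = card (u ` S)" by (rule dim_eq_card_independent)
    also have "\<dots> = card S" by (rule card_image[OF inj_on_subset[OF inj J(1)]])
    finally show ?thesis using True by simp
  next
    case False
    then obtain J where J: "J \<subseteq> S" "card J = DIM('e)" by (metis nat_le_linear obtain_subset_with_card_n)
    have "DIM('e) \<le> dim (u ` S)" using full[of J] J S dim_subset[of "u ` J" "u ` S"] by auto
    then show ?thesis using False dim_subset_UNIV[of "u ` S"] by simp
  qed
qed

lemma card_Collect_eq_sum: "finite A \<Longrightarrow> card {S. S \<in> A \<and> P S} = (\<Sum>S\<in>A. of_bool (P S))"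
  by (simp add: sum.If_cases of_bool_def Int_def conj_commute)

lemma measurable_face_number:
  fixes u :: "'w \<Rightarrow> nat \<Rightarrow> 'e::euclidean_space"
  assumes I: "finite I" and u: "\<And>i. i \<in> I \<Longrightarrow> (\<lambda>\<omega>. u \<omega> i) \<in> borel_measurable M"
  shows "(\<lambda>\<omega>. real (spherical_face_number k (pos I (u \<omega>)))) \<in> borel_measurable M"
proof -
  have "real (spherical_face_number k (pos I (u \<omega>))) = (\<Sum>S\<in>Pow I. of_bool (exposes UNIV (u \<omega>) I S \<and> dim (u \<omega> ` S) = k + 1))" for \<omega>
    using I card_Collect_eq_sum[of "Pow I" "\<lambda>S. exposes UNIV (u \<omega>) I S \<and> dim (u \<omega> ` S) = k + 1"]
    by (simp add: spherical_face_number_pos)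
  moreover have "(\<lambda>\<omega>. of_bool (exposes UNIV (u \<omega>) I S \<and> dim (u \<omega> ` S) = k + 1) :: real) \<in> borel_measurable M" if "S \<in> Pow I" for S
  proof -
    have [measurable]: "Measurable.pred M (\<lambda>\<omega>. exposes UNIV (u \<omega>) I S)"
      using that I u by (intro measurable_exposes) auto
    have [measurable]: "(\<lambda>\<omega>. dim (u \<omega> ` S)) \<in> measurable M (count_space UNIV)"
      using that I u finite_subset by (intro measurable_dim) auto
    show ?thesis by measurable
  qed
  ultimately show ?thesis by simp
qed

text \<open>Below the full dimension a set of generators spans dimension k + 1 only if it has k + 1
  elements; for \<open>k + 1 = DIM('e)\<close> larger sets would have that dimension as
  well.\<close>

lemma face_number_generic:
  fixes u :: "nat \<Rightarrow> 'e::euclidean_space"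
  assumes I: "finite I" "DIM('e) \<le> card I" and g: "generic UNIV u I" and k: "k + 1 < DIM('e)"
  shows "spherical_face_number k (pos I u) = (\<Sum>S | S \<subseteq> I \<and> card S = k + 1. of_bool (exposes UNIV u I S))"
proof -
  have "{S. S \<subseteq> I \<and> exposes UNIV u I S \<and> dim (u ` S) = k + 1} = {S. S \<in> {S. S \<subseteq> I \<and> card S = k + 1} \<and> exposes UNIV u I S}"
    using k dim_generic[OF I g] by (auto simp: min_def split: if_splits)
  moreover have "finite {S. S \<subseteq> I \<and> card S = k + 1}" using I(1) by simp
  ultimately show ?thesis
    unfolding spherical_face_number_pos[OF I(1)] by (simp only: card_Collect_eq_sum)
qed

subsection \<open>Normalised Gaussian vectors and random cones\<close>

text \<open>Presents the Gaussian weight as a superposition of indicators of balls, t being the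
  radius.\<close>

lemma exp_square_layer_cake:
  assumes "0 \<le> r"
  shows "(\<integral>\<^sup>+t. ennreal (t * exp (- t\<^sup>2 / 2)) * indicator {r..} t \<partial>lborel) = ennreal (exp (- r\<^sup>2 / 2))"
proof -
  have "((\<lambda>t::real. - exp (- t\<^sup>2 / 2)) \<longlongrightarrow> 0) at_top" by real_asymp
  then have "(\<integral>\<^sup>+t. ennreal (t * exp (- t\<^sup>2 / 2)) * indicator {r..} t \<partial>lborel) = 0 - (- exp (- r\<^sup>2 / 2))"
    using assms by (intro nn_integral_FTC_atLeast) (auto intro!: derivative_eq_intros)
  then show ?thesis by simp
qed

lemma emeasure_cone_cball:
  fixes H :: "'e::euclidean_space set"
  assumes H: "H \<in> sets borel" and cone: "\<And>x c. x \<in> H \<Longrightarrow> 0 < c \<Longrightarrow> c *\<^sub>R x \<in> H" and t: "0 < t"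
  shows "emeasure lborel (H \<inter> cball 0 t) = ennreal (t ^ DIM('e)) * emeasure lborel (H \<inter> cball 0 1)"
proof -
  have "indicator (H \<inter> cball 0 t) (t *\<^sub>R x) = (indicator (H \<inter> cball 0 1) x :: ennreal)" for x
  proof -
    have "t *\<^sub>R x \<in> H \<longleftrightarrow> x \<in> H" using cone[of x t] cone[of "t *\<^sub>R x" "1 / t"] t by auto
    then show ?thesis using t by (auto simp: indicator_def)
  qed
  moreover have "(\<integral>\<^sup>+x. indicator (H \<inter> cball 0 t) x \<partial>lborel) =
      ennreal (\<bar>t\<bar> ^ DIM('e)) * (\<integral>\<^sup>+x. indicator (H \<inter> cball 0 t) (0 + t *\<^sub>R x) \<partial>lborel)"
    using H t by (intro nn_integral_lborel_affine borel_measurable_indicator) auto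
  ultimately show ?thesis using H t by simp
qed

text \<open>By the layer cake formula and homogeneity of volume, the Gaussian measure of a cone is a
  multiple of its volume in the unit ball. Only the existence of a common factor is stated; its
  value is irrelevant after normalisation.\<close>

lemma nn_integral_gauss_cone:
  "\<exists>K. \<forall>H\<in>sets (borel :: 'e::euclidean_space measure). (\<forall>x\<in>H. \<forall>c>0. c *\<^sub>R x \<in> H) \<longrightarrow>
     (\<integral>\<^sup>+x. ennreal (gauss_density x) * indicator H x \<partial>lborel) = K * emeasure lborel (H \<inter> cball 0 1)"
proof (intro exI ballI impI)
  fix H :: "'e set" assume H: "H \<in> sets borel" "\<forall>x\<in>H. \<forall>c>0. c *\<^sub>R x \<in> H"
  note H(1)[measurable]
  let ?C = "1 / sqrt (2 * pi) ^ DIM('e)"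
  let ?w = "\<lambda>t. ennreal ?C * ennreal (t * exp (- t\<^sup>2 / 2))"
  have "(\<integral>\<^sup>+x. ennreal (gauss_density x) * indicator H x \<partial>lborel) =
      (\<integral>\<^sup>+x. (\<integral>\<^sup>+t. ?w t * (indicator {norm x..} t * indicator H x) \<partial>lborel) \<partial>lborel)"
  proof (rule nn_integral_cong)
    fix x :: 'e
    have "ennreal (gauss_density x) = ennreal ?C * ennreal (exp (- (norm x)\<^sup>2 / 2))"
      by (simp add: gauss_density_def ennreal_mult'[symmetric])
    also have "\<dots> * indicator H x = (\<integral>\<^sup>+t. ?w t * (indicator {norm x..} t * indicator H x) \<partial>lborel)"
    proof -
      have "(\<integral>\<^sup>+t. ?w t * (indicator {norm x..} t * indicator H x) \<partial>lborel) =
          (\<integral>\<^sup>+t. (ennreal ?C * indicator H x) * (ennreal (t * exp (- t\<^sup>2 / 2)) * indicator {norm x..} t) \<partial>lborel)"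
        by (rule nn_integral_cong) (simp only: mult_ac)
      also have "\<dots> = (ennreal ?C * indicator H x) * ennreal (exp (- (norm x)\<^sup>2 / 2))"
        by (subst nn_integral_cmult) (simp_all only: exp_square_layer_cake[OF norm_ge_zero], measurable)
      finally show ?thesis by (simp only: mult_ac)
    qed
    finally show "ennreal (gauss_density x) * indicator H x = (\<integral>\<^sup>+t. ?w t * (indicator {norm x..} t * indicator H x) \<partial>lborel)" .
  qed
  also have "\<dots> = (\<integral>\<^sup>+t. (\<integral>\<^sup>+x. ?w t * (indicator {norm x..} t * indicator H x) \<partial>lborel) \<partial>lborel)"
    by (rule lborel_pair.Fubini') (simp add: indicator_def[of "{_..}"])
  also have "\<dots> = (\<integral>\<^sup>+t. ?w t * ennreal (t ^ DIM('e)) * emeasure lborel (H \<inter> cball 0 1) \<partial>lborel)"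
  proof (rule nn_integral_cong)
    fix t :: real
    have "(\<integral>\<^sup>+x. ?w t * (indicator {norm x..} t * indicator H x) \<partial>lborel) = ?w t * (\<integral>\<^sup>+x. indicator (H \<inter> cball 0 t) x \<partial>lborel)"
    proof -
      have "indicator {norm x..} t * indicator H x = (indicator (H \<inter> cball 0 t) x :: ennreal)" for x
        by (auto simp: indicator_def)
      then show ?thesis using H(1) by (simp only:) (intro nn_integral_cmult borel_measurable_indicator; simp)
    qed
    also have "\<dots> = ?w t * emeasure lborel (H \<inter> cball 0 t)" using H(1) by simp
    also have "\<dots> = ?w t * (ennreal (t ^ DIM('e)) * emeasure lborel (H \<inter> cball 0 1))"
    proof (cases "0 < t")
      case True
      then show ?thesis using emeasure_cone_cball[OF H(1), of t] H(2) by simp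
    next
      case False
      then have "t * exp (- t\<^sup>2 / 2) \<le> 0" by (simp add: mult_le_0_iff)
      then show ?thesis by (simp add: ennreal_neg)
    qed
    finally show "(\<integral>\<^sup>+x. ?w t * (indicator {norm x..} t * indicator H x) \<partial>lborel) = ?w t * ennreal (t ^ DIM('e)) * emeasure lborel (H \<inter> cball 0 1)"
      by (simp only: mult.assoc)
  qed
  also have "\<dots> = (\<integral>\<^sup>+t. ?w t * ennreal (t ^ DIM('e)) \<partial>lborel) * emeasure lborel (H \<inter> cball 0 1)"
    by (rule nn_integral_multc) simp
  finally show "(\<integral>\<^sup>+x. ennreal (gauss_density x) * indicator H x \<partial>lborel) =
    (\<integral>\<^sup>+t. ?w t * ennreal (t ^ DIM('e)) \<partial>lborel) * emeasure lborel (H \<inter> cball 0 1)" .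
qed

lemma AE_lborel_fst_neq_0: "AE x in (lborel :: (real \<times> 'b::euclidean_space) measure). fst x \<noteq> 0"
proof -
  have "{x. (1, 0) \<bullet> x = 0} \<in> null_sets (lebesgue :: (real \<times> 'b) measure)"
    by (subst negligible_iff_null_sets[symmetric]) (auto intro!: negligible_hyperplane simp: prod_eq_iff)
  then have "AE x in (lebesgue :: (real \<times> 'b) measure). x \<notin> {x. (1, 0) \<bullet> x = 0}" by (rule AE_not_in)
  then have "AE x in (lebesgue :: (real \<times> 'b) measure). fst x \<noteq> 0" by (simp add: inner_prod_def)
  then show ?thesis by (subst (asm) AE_completion_iff) auto
qed

text \<open>Preimages under normalisation are cones, so both laws are proportional to the volume
  \<open>L A\<close> of the part of the unit ball over A in the open half-space. As both have total
  mass 1, they agree. The hyperplane bounding the half-space is a null set.\<close>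

theorem distr_row_measure:
  "distr row_measure borel (\<lambda>x. x /\<^sub>R norm x) = (uniform_half_sphere :: (real \<times> (real ^ 'd)) measure)"
proof -
  let ?g = "\<lambda>x :: real \<times> (real ^ 'd). x /\<^sub>R norm x"
  let ?P = "\<lambda>A. {x. 0 < fst x} \<inter> ?g -` A"
  define L where "L A = emeasure lborel (?P A \<inter> cball 0 1)" for A
  have g[measurable]: "?g \<in> borel_measurable borel" by measurable
  have grow: "?g \<in> measurable row_measure borel"
    using g by (simp only: measurable_cong_sets[OF sets_row_measure refl])
  have vm[measurable]: "?g -` A \<in> sets borel" if "A \<in> sets borel" for A
    using measurable_sets[OF g that] by simp
  have Pm: "?P A \<in> sets borel" if "A \<in> sets borel" for A
    by (rule sets.Int[OF borel_open[OF open_Collect_less] vm[OF that]]) (intro continuous_intros)+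
  have pm[measurable]: "{x :: real \<times> (real ^ 'd). 0 < fst x} \<in> sets borel"
    by (rule borel_open[OF open_Collect_less]) (intro continuous_intros)+
  obtain K where K: "\<And>H. H \<in> sets (borel :: (real \<times> (real ^ 'd)) measure) \<Longrightarrow> \<forall>x\<in>H. \<forall>c>0. c *\<^sub>R x \<in> H \<Longrightarrow>
     (\<integral>\<^sup>+x. ennreal (gauss_density x) * indicator H x \<partial>lborel) = K * emeasure lborel (H \<inter> cball 0 1)"
    using nn_integral_gauss_cone[where 'e = "real \<times> (real ^ 'd)"] by blast
  have row: "emeasure (distr row_measure borel ?g) A = 2 * K * L A" if A: "A \<in> sets borel" for A
  proof -
    have "emeasure (distr row_measure borel ?g) A = emeasure row_measure (?g -` A)"
      using A by (subst emeasure_distr[OF grow]) (auto simp: space_pair_measure)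
    also have "\<dots> = (\<integral>\<^sup>+x. ennreal (2 * gauss_density x * indicator {x. 0 < fst x} x) * indicator (?g -` A) x \<partial>lborel)"
      unfolding row_measure_density using vm[OF A] pm by (subst emeasure_density) (auto simp: gauss_density_def)
    also have "\<dots> = (\<integral>\<^sup>+x. 2 * (ennreal (gauss_density x) * indicator (?P A) x) \<partial>lborel)"
      by (rule nn_integral_cong) (auto simp: indicator_def ennreal_mult')
    also have "\<dots> = 2 * (\<integral>\<^sup>+x. ennreal (gauss_density x) * indicator (?P A) x \<partial>lborel)"
      by (rule nn_integral_cmult) (simp add: Pm[OF A] borel_measurable_times_ennreal borel_measurable_indicator)
    also have "\<dots> = 2 * (K * L A)"
    proof -
      have "?g (c *\<^sub>R x) = ?g x" if "0 < c" for c x using that by simp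
      then have "\<forall>x\<in>?P A. \<forall>c>0. c *\<^sub>R x \<in> ?P A"
        by (intro ballI allI impI) (simp only: Int_iff vimage_eq mem_Collect_eq fst_scaleR, simp)
      then show ?thesis unfolding L_def by (simp only: K[OF Pm[OF A]])
    qed
    finally show ?thesis by (simp add: mult.assoc)
  qed
  have hs: "half_sphere \<in> sets (borel :: (real \<times> (real ^ 'd)) measure)"
    unfolding half_sphere_def
    by (intro borel_closed closed_Collect_conj closed_Collect_le closed_Collect_eq continuous_intros)
  have sph: "emeasure spherical_measure (half_sphere \<inter> A) = of_nat DIM(real \<times> (real ^ 'd)) * L A" if A: "A \<in> sets borel" for A
  proof -
    have hA: "half_sphere \<inter> A \<in> sets borel" using hs A by simp
    have "emeasure spherical_measure (half_sphere \<inter> A) =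
        (\<integral>\<^sup>+x. of_nat DIM(real \<times> (real ^ 'd)) * indicator (cball 0 1) x * indicator (?g -` (half_sphere \<inter> A)) x \<partial>lborel)"
      unfolding spherical_measure_def
      by (subst emeasure_distr, simp, rule hA, subst emeasure_density)
        (use vm[OF hA] in \<open>auto intro!: borel_measurable_times_ennreal borel_measurable_indicator\<close>)
    also have "\<dots> = (\<integral>\<^sup>+x. of_nat DIM(real \<times> (real ^ 'd)) * indicator (?P A \<inter> cball 0 1) x \<partial>lborel)"
      using AE_lborel_fst_neq_0
    proof (intro nn_integral_cong_AE, eventually_elim)
      fix x :: "real \<times> (real ^ 'd)" assume "fst x \<noteq> 0"
      then have "x \<noteq> 0" by auto
      then have "?g x \<in> half_sphere \<longleftrightarrow> 0 < fst x"
        using \<open>fst x \<noteq> 0\<close> by (auto simp: half_sphere_def zero_le_mult_iff)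
      then show "of_nat DIM(real \<times> (real ^ 'd)) * indicator (cball 0 1) x * indicator (?g -` (half_sphere \<inter> A)) x =
          (of_nat DIM(real \<times> (real ^ 'd)) * indicator (?P A \<inter> cball 0 1) x :: ennreal)"
        by (auto simp: indicator_def)
    qed
    also have "\<dots> = of_nat DIM(real \<times> (real ^ 'd)) * L A"
      unfolding L_def using sets.Int[OF Pm[OF A] borel_closed[OF closed_cball]]
      by (intro nn_integral_cmult_indicator) (simp only: sets_lborel)
    finally show ?thesis .
  qed
  have one: "2 * K * L UNIV = 1"
  proof -
    interpret prob_space "distr (row_measure :: (real \<times> (real ^ 'd)) measure) borel ?g"
      by (intro prob_space.prob_space_distr prob_space_row_measure grow)
    show ?thesis using row[of UNIV] emeasure_space_1 by simp
  qed
  have "L UNIV \<le> emeasure lborel (cball (0 :: real \<times> (real ^ 'd)) 1)" unfolding L_def by (intro emeasure_mono) auto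
  then have "L UNIV \<noteq> \<infinity>" using emeasure_lborel_cball_finite[of "0 :: real \<times> (real ^ 'd)" 1] by auto
  have "L UNIV \<noteq> 0" using one by auto
  show ?thesis
  proof (rule measure_eqI)
    fix A assume "A \<in> sets (distr (row_measure :: (real \<times> (real ^ 'd)) measure) borel ?g)"
    then have A: "A \<in> sets borel" by simp
    have "emeasure uniform_half_sphere A = (of_nat DIM(real \<times> (real ^ 'd)) * L A) / (of_nat DIM(real \<times> (real ^ 'd)) * L UNIV)"
      unfolding uniform_half_sphere_def
      using sph[OF A] sph[of UNIV] hs A by (subst emeasure_uniform_measure) auto
    also have "of_nat DIM(real \<times> (real ^ 'd)) * L A = (2 * K * L A) * (of_nat DIM(real \<times> (real ^ 'd)) * L UNIV)"
    proof -
      have "of_nat DIM(real \<times> (real ^ 'd)) * L A = of_nat DIM(real \<times> (real ^ 'd)) * L A * (2 * K * L UNIV)"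
        by (simp only: one mult_1_right)
      then show ?thesis by (simp only: mult_ac)
    qed
    also have "\<dots> / (of_nat DIM(real \<times> (real ^ 'd)) * L UNIV) = 2 * K * L A"
      using \<open>L UNIV \<noteq> 0\<close> \<open>L UNIV \<noteq> \<infinity>\<close>
      by (intro ennreal_mult_divide_eq) (auto simp: ennreal_mult_eq_top_iff)
    finally show "emeasure (distr row_measure borel ?g) A = emeasure uniform_half_sphere A" using row[OF A] by simp
  qed (simp add: uniform_half_sphere_def)
qed

section \<open>Expected face numbers of the random cone\<close>

lemma pos_cong: "(\<And>i. i \<in> I \<Longrightarrow> u i = v i) \<Longrightarrow> pos I u = pos I v"
  unfolding pos_def by (simp cong: sum.cong)

lemma exposes_scaleR:
  assumes "\<And>i. i \<in> I \<union> R \<Longrightarrow> 0 < c i"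
  shows "exposes S (\<lambda>i. c i *\<^sub>R x i) I R \<longleftrightarrow> exposes S x I R"
proof -
  have "c i *\<^sub>R x i \<bullet> y = 0 \<longleftrightarrow> x i \<bullet> y = 0" "0 < c i *\<^sub>R x i \<bullet> y \<longleftrightarrow> 0 < x i \<bullet> y" if "i \<in> I \<union> R" for i y
    using assms[OF that] by (auto simp: zero_less_mult_iff)
  then show ?thesis unfolding exposes_def by simp
qed

lemma generic_scaleR:
  assumes "\<And>i. i \<in> I \<Longrightarrow> c i \<noteq> 0" and "generic S x I"
  shows "generic S (\<lambda>i. c i *\<^sub>R x i) I"
  unfolding generic_def
proof (intro allI impI ballI)
  fix J y assume "J \<subseteq> I" "card J = dim S" "y \<in> S" "\<forall>i\<in>J. c i *\<^sub>R x i \<bullet> y = 0"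
  moreover from this assms(1) have "\<forall>i\<in>J. x i \<bullet> y = 0" by auto
  ultimately show "y = 0" using assms(2) unfolding generic_def by blast
qed

text \<open>Generic rows are nonzero, and positive scaling of single rows affects neither genericity
  nor exposure.\<close>

lemma face_number_normalized:
  fixes x :: "nat \<Rightarrow> 'e::euclidean_space"
  assumes I: "finite I" "DIM('e) \<le> card I" and g: "generic UNIV x I" and k: "k + 1 < DIM('e)"
  shows "spherical_face_number k (pos I (\<lambda>i. x i /\<^sub>R norm (x i))) =
    (\<Sum>S | S \<subseteq> I \<and> card S = k + 1. of_bool (exposes UNIV x I S))"
proof -
  have "x i \<noteq> 0" if "i \<in> I" for i
    using dim_generic[OF I g, of "{i}"] that by auto
  then have c: "0 < inverse (norm (x i))" if "i \<in> I" for i using that by simp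
  have "generic UNIV (\<lambda>i. x i /\<^sub>R norm (x i)) I"
    using c g by (intro generic_scaleR) force+
  moreover have "exposes UNIV (\<lambda>i. x i /\<^sub>R norm (x i)) I S \<longleftrightarrow> exposes UNIV x I S" if "S \<subseteq> I" for S
    using c that by (intro exposes_scaleR) auto
  ultimately show ?thesis using face_number_generic[OF I _ k] by (simp cong: conj_cong)
qed

text \<open>By independence the points have the joint law of the normalised rows. Almost surely the
  rows are generic, so the face number is a sum of indicators that can be integrated term by
  term.\<close>

lemma expectation_face_number:
  fixes U :: "nat \<Rightarrow> 'w \<Rightarrow> real \<times> (real ^ 'd)"
  assumes M: "prob_space M" and I: "finite I" "CARD('d) + 1 \<le> card I" and k: "k < CARD('d)"
    and indep: "prob_space.indep_vars M (\<lambda>_. borel) U I"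
    and law: "\<And>i. i \<in> I \<Longrightarrow> distr M borel (U i) = uniform_half_sphere"
  shows "prob_space.expectation M (\<lambda>\<omega>. real (spherical_face_number k (pos I (\<lambda>i. U i \<omega>)))) =
    (\<Sum>S | S \<subseteq> I \<and> card S = k + 1. exposure_prob TYPE(real ^ 'd) I S CARD('d))"
proof -
  interpret M: prob_space M by fact
  let ?N = "\<lambda>x :: real \<times> (real ^ 'd). x /\<^sub>R norm x"
  let ?R = "Pi\<^sub>M I (\<lambda>_. row_measure :: (real \<times> (real ^ 'd)) measure)"
  let ?B = "Pi\<^sub>M I (\<lambda>_. borel :: (real \<times> (real ^ 'd)) measure)"
  let ?A = "{S. S \<subseteq> I \<and> card S = k + 1}"
  define f where "f u = real (spherical_face_number k (pos I u))" for u :: "nat \<Rightarrow> real \<times> (real ^ 'd)"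
  interpret R: prob_space ?R by (rule prob_space_PiM) (rule prob_space_row_measure)
  have "I \<noteq> {}" using I by auto
  have rv: "U i \<in> borel_measurable M" if "i \<in> I" for i
    using indep that unfolding M.indep_vars_def by blast
  have Nm: "?N \<in> measurable row_measure borel"
    by (simp only: measurable_cong_sets[OF sets_row_measure refl]) measurable
  have fm: "f \<in> borel_measurable ?B"
    unfolding f_def using I(1) by (intro measurable_face_number measurable_component_singleton) 
  have Um: "(\<lambda>\<omega>. \<lambda>i\<in>I. U i \<omega>) \<in> measurable M ?B" using rv by (intro measurable_restrict)
  have cm: "compose I ?N \<in> measurable ?R ?B"
    unfolding compose_def by (intro measurable_restrict) (rule measurable_compose[OF _ Nm], rule measurable_component_singleton)
  have joint: "distr M ?B (\<lambda>\<omega>. \<lambda>i\<in>I. U i \<omega>) = distr ?R ?B (compose I ?N)"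
  proof -
    have "distr M ?B (\<lambda>\<omega>. \<lambda>i\<in>I. U i \<omega>) = Pi\<^sub>M I (\<lambda>i. distr M borel (U i))"
      using M.indep_vars_iff_distr_eq_PiM'[OF \<open>I \<noteq> {}\<close>, of U "\<lambda>_. borel"] rv indep by blast
    also have "\<dots> = Pi\<^sub>M I (\<lambda>i. distr row_measure borel ?N)"
      by (rule PiM_cong) (simp_all add: law distr_row_measure)
    also have "\<dots> = Pi\<^sub>M I (\<lambda>i. distr row_measure uniform_half_sphere ?N)"
      by (intro PiM_cong refl distr_cong) (simp_all add: uniform_half_sphere_def)
    also have "\<dots> = distr ?R (Pi\<^sub>M I (\<lambda>_. uniform_half_sphere)) (compose I ?N)"
    proof (rule distr_PiM_finite_prob_space'[symmetric, OF I(1) prob_space_row_measure])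
      show N': "?N \<in> measurable row_measure uniform_half_sphere"
      proof -
        have eq: "sets uniform_half_sphere = sets (borel :: (real \<times> (real ^ 'd)) measure)" by (simp add: uniform_half_sphere_def)
        show ?thesis unfolding measurable_cong_sets[OF refl eq] by (rule Nm)
      qed
      show "prob_space (uniform_half_sphere :: (real \<times> (real ^ 'd)) measure)"
        unfolding distr_row_measure[symmetric] by (intro prob_space.prob_space_distr prob_space_row_measure Nm)
    qed
    also have "\<dots> = distr ?R ?B (compose I ?N)"
      by (intro distr_cong refl sets_PiM_cong) (simp add: uniform_half_sphere_def)
    finally show ?thesis .
  qed
  have ex: "Measurable.pred ?R (\<lambda>x. exposes (flag CARD('d)) x I S)" if "S \<in> ?A" for S
    using that I(1) by (intro exposes_measurable_row) auto
  have int: "integrable ?R (\<lambda>x. of_bool (exposes (flag CARD('d)) x I S) :: real)" if "S \<in> ?A" for S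
    using ex[OF that] by (intro R.integrable_const_bound[where B = 1]) (auto intro!: AE_I2)
  have eq: "(\<integral>x. of_bool (exposes (flag CARD('d)) x I S) \<partial>?R) = exposure_prob TYPE(real ^ 'd) I S CARD('d)" if "S \<in> ?A" for S
  proof -
    have "(\<integral>x. of_bool (exposes (flag CARD('d)) x I S) \<partial>?R) = (\<integral>x. indicator {x \<in> space ?R. exposes (flag CARD('d)) x I S} x \<partial>?R)"
      by (rule Bochner_Integration.integral_cong) (auto simp: indicator_def)
    also have "\<dots> = exposure_prob TYPE(real ^ 'd) I S CARD('d)"
      unfolding exposure_prob_def by (simp add: Int_absorb2)
    finally show ?thesis .
  qed
  have fl: "flag CARD('d) = (UNIV :: (real \<times> (real ^ 'd)) set)" using flag_DIM[where 'b = "real ^ 'd"] by simp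
  have "M.expectation (\<lambda>\<omega>. real (spherical_face_number k (pos I (\<lambda>i. U i \<omega>)))) = (\<integral>\<omega>. f (\<lambda>i\<in>I. U i \<omega>) \<partial>M)"
  proof (rule Bochner_Integration.integral_cong[OF refl])
    fix \<omega>
    have "pos I (\<lambda>i. U i \<omega>) = pos I (\<lambda>i\<in>I. U i \<omega>)" by (rule pos_cong) simp
    then show "real (spherical_face_number k (pos I (\<lambda>i. U i \<omega>))) = f (\<lambda>i\<in>I. U i \<omega>)" by (simp only: f_def)
  qed
  also have "\<dots> = (\<integral>u. f u \<partial>distr M ?B (\<lambda>\<omega>. \<lambda>i\<in>I. U i \<omega>))"
    by (rule integral_distr[OF Um fm, symmetric])
  also have "\<dots> = (\<integral>x. f (compose I ?N x) \<partial>?R)"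
    unfolding joint by (rule integral_distr[OF cm fm])
  also have "\<dots> = (\<integral>x. (\<Sum>S\<in>?A. of_bool (exposes (flag CARD('d)) x I S)) \<partial>?R)"
  proof (rule integral_cong_AE)
    show "(\<lambda>x. f (compose I ?N x)) \<in> borel_measurable ?R" using cm fm by (rule measurable_compose)
    show "(\<lambda>x. \<Sum>S\<in>?A. of_bool (exposes (flag CARD('d)) x I S) :: real) \<in> borel_measurable ?R"
      using int by (intro borel_measurable_sum) (auto dest: borel_measurable_integrable)
    show "AE x in ?R. f (compose I ?N x) = (\<Sum>S\<in>?A. of_bool (exposes (flag CARD('d)) x I S))"
      using AE_generic[OF I(1), where 'b = "real ^ 'd"]
    proof eventually_elim
      fix x :: "nat \<Rightarrow> real \<times> (real ^ 'd)" assume "\<forall>m\<le>DIM(real ^ 'd). generic (flag m) x I"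
      then have g: "generic UNIV x I" using fl by auto
      have "pos I (compose I ?N x) = pos I (\<lambda>i. x i /\<^sub>R norm (x i))"
        by (rule pos_cong) (simp add: compose_def)
      then show "f (compose I ?N x) = (\<Sum>S\<in>?A. of_bool (exposes (flag CARD('d)) x I S))"
        using face_number_normalized[OF I(1) _ g, of k] I(2) k by (simp add: f_def fl)
    qed
  qed
  also have "\<dots> = (\<Sum>S\<in>?A. \<integral>x. of_bool (exposes (flag CARD('d)) x I S) \<partial>?R)"
    using int by (rule Bochner_Integration.integral_sum)
  also have "\<dots> = (\<Sum>S\<in>?A. exposure_prob TYPE(real ^ 'd) I S CARD('d))"
    by (rule sum.cong[OF refl]) (rule eq)
  finally show ?thesis .
qed

theorem theorem2p2:
  fixes M :: "'w measure"
    and U :: "nat \<Rightarrow> 'w \<Rightarrow> real \<times> (real ^ 'd)"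
    and d n k :: nat
  assumes "prob_space M"
    and "d = CARD('d)"
    and "n \<ge> d + 1"
    and "k \<in> {0..d - 1}"
    and "prob_space.indep_vars M (\<lambda>_. borel) U {1..n}"
    and "\<And>i. i \<in> {1..n} \<Longrightarrow> distr M borel (U i) = uniform_half_sphere"
  shows "prob_space.expectation M
           (\<lambda>\<omega>. real (spherical_face_number k (pos {1..n} (\<lambda>i. U i \<omega>)))) =
         fact n * pi powi (int k + 1 - int n) / fact (k + 1) *
           (\<Sum>s | d - 2 * s \<ge> k + 1. B_num n (d - 2 * s) * A_factor (d - 2 * s) k)"
proof -
  let ?A = "{S. S \<subseteq> {1..n} \<and> card S = k + 1}"
  \<comment> \<open>A finite index type is nonempty, so \<open>d - 1\<close> is not truncated and
    \<open>k < d\<close> follows.\<close>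
  have "0 < d" using assms(2) by simp
  then have k: "k < d" using assms(4) by auto
  have "prob_space.expectation M (\<lambda>\<omega>. real (spherical_face_number k (pos {1..n} (\<lambda>i. U i \<omega>)))) =
      (\<Sum>S\<in>?A. exposure_prob TYPE(real ^ 'd) {1..n} S d)"
    using assms k by (simp only: expectation_face_number[where I = "{1..n}"] finite_atLeastAtMost card_atLeastAtMost diff_Suc_1)
  also have "\<dots> = (\<Sum>S\<in>?A. exposure_formula n d (k + 1))"
  proof (rule sum.cong[OF refl])
    fix S assume "S \<in> ?A"
    then show "exposure_prob TYPE(real ^ 'd) {1..n} S d = exposure_formula n d (k + 1)"
      using exposure_prob_eq_formula[where 'b = "real ^ 'd" and I = "{1..n}" and R = S and m = d] assms(2,3) k by simp
  qed
  also have "\<dots> = real (n choose (k + 1)) * exposure_formula n d (k + 1)"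
    using n_subsets[of "{1..n}" "k + 1"] by simp
  also have "real (n choose (k + 1)) = fact n / (fact (k + 1) * fact (n - (k + 1)))"
    using k assms(3) by (intro binomial_fact) simp
  finally have "prob_space.expectation M (\<lambda>\<omega>. real (spherical_face_number k (pos {1..n} (\<lambda>i. U i \<omega>)))) =
      fact n / (fact (k + 1) * fact (n - (k + 1))) * exposure_formula n d (k + 1)" .
  moreover have "pi powi (int k + 1 - int n) = 1 / pi ^ (n - (k + 1))"
  proof -
    have "int k + 1 - int n = - int (n - (k + 1))" using k assms(3) by simp
    then show ?thesis by (simp only: power_int_minus power_int_of_nat inverse_eq_divide)
  qed
  ultimately show ?thesis by (simp add: exposure_formula_def)
qed

end
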